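(* Let $d\ge1$, $L\in\mathbb{N}$, $\Lambda=\mathbb{Z}^d/(L\mathbb{Z})^d$, and let $\beta$ be translation invariant, finite-range non-negative edge weights on $\Lambda$. Let $h>0$. For the $\mathbb{H}^n$ model with $n\ge2$, for all $p\in\Lambda^\star$, $$\hat G_{\beta,h}(p)\ge\frac{1}{(1+(n+1)G_{\beta,h}(0))\lambda(p)+h}.$$ For the $\mathbb{H}^{2|2}$ model, for all $p\in\Lambda^\star$, $$\hat G_{\beta,h}(p)\ge\frac{1}{(1+G_{\beta,h}(0))\lambda(p)+h}.$$
   Context: Edge weights $\beta_{ij}=\beta_{ji}\ge0$; translation invariant means $\beta_{ij}=\beta_{i+k,j+k}$ for all $k\in\Lambda$; sums over $\langle ij\rangle$ are over unordered pairs. $\Lambda^\star=\{2\pi k/L: k\in\{0,\dots,L-1\}^d\}$ is the Fourier dual of the torus. $\lambda(p)=\sum_{j\in\Lambda}\beta_{0j}(1-\cos(p\cdot j))$. $G_{\beta,h}(j)=\langle y_0y_j\rangle_{\beta,h}$ and $\hat G_{\beta,h}(p)=\sum_{j\in\Lambda}G_{\beta,h}(j)e^{i p\cdot j}$, where $\langle\cdot\rangle_{\beta,h}$ is the expectation of the model in question and, for $\mathbb{H}^n$, $y_j=y_j^1$. $\mathbb{H}^n$ model: in $\mathbb{R}^{n,1}$ with $u=(x,y^1,\dots,y^{n-1},z)$ and $u\cdot v=xx'+\sum_ry^ry'^r-zz'$, $\mathbb{H}^n=\{u\cdot u=-1,z>0\}$ with measure $\mu$, $\int Fd\mu=\int_{\mathbb{R}^n}F\,\frac{dx\,d\tilde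 y}{z}$, $z=\sqrt{1+x^2+|\tilde y|^2}$; $H_{\beta,h}(u)=\sum_{\langle ij\rangle}\beta_{ij}(-u_i\cdot u_j-1)+h\sum_j(z_j-1)$; $\langle F\rangle=\int Fe^{-H_{\beta,h}}d\mu^{\otimes\Lambda}/\int e^{-H_{\beta,h}}d\mu^{\otimes\Lambda}$. $\mathbb{H}^{2|2}$ model: for functions $F$ of $y=(y_i)_{i\in\Lambda}$ only, $\langle F(y)\rangle_{\mathbb{H}^{2|2}}=\int_{(\mathbb{R}^2)^\Lambda}F(e^{t}s)e^{-\tilde H(s,t)}\,dt\,ds$, where $e^ts=(e^{t_i}s_i)_i$ and $\tilde H(s,t)=\sum_{\langle ij\rangle}\beta_{ij}\big(\cosh(t_i-t_j)-1+\tfrac12(s_i-s_j)^2e^{t_i+t_j}\big)+h\sum_i\big(\cosh t_i-1+\tfrac12s_i^2e^{t_i}\big)+\sum_i(t_i+\log 2\pi)-\log\det D_{\beta,h}(t)$, with $D_{\beta,h}(t)$ the matrix with quadratic form $(v,D_{\beta,h}(t)v)=\sum_{\langle ij\rangle}\beta_{ij}e^{t_i+t_j}(v_i-v_j)^2+h\sum_ie^{t_i}v_i^2$. (This is a probability density on $(\mathbb{R}^2)^\Lambda$.) *)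

theory Defs
  imports "HOL-Analysis.Analysis"
begin

type_synonym site = "nat \<Rightarrow> nat"

definition torus :: "nat \<Rightarrow> nat \<Rightarrow> site set" where
  "torus d L = PiE {..<d} (\<lambda>_. {..<L})"

definition tadd :: "nat \<Rightarrow> nat \<Rightarrow> site \<Rightarrow> site \<Rightarrow> site" where
  "tadd d L a b = restrict (\<lambda>i. (a i + b i) mod L) {..<d}"

definition torigin :: "nat \<Rightarrow> site" where
  "torigin d = restrict (\<lambda>_. 0) {..<d}"

text \<open>The dual momentum p = 2 pi k / L (k in the torus) paired with a site j: p . j\<close>
definition pdot :: "nat \<Rightarrow> nat \<Rightarrow> site \<Rightarrow> site \<Rightarrow> real" where
  "pdot d L k j = (\<Sum>i<d. 2 * pi * real (k i) / real L * real (j i))"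

definition lam :: "nat \<Rightarrow> nat \<Rightarrow> (site \<Rightarrow> site \<Rightarrow> real) \<Rightarrow> site \<Rightarrow> real" where
  "lam d L \<beta> k = (\<Sum>j\<in>torus d L. \<beta> (torigin d) j * (1 - cos (pdot d L k j)))"

definition translation_invariant :: "nat \<Rightarrow> nat \<Rightarrow> (site \<Rightarrow> site \<Rightarrow> real) \<Rightarrow> bool" where
  "translation_invariant d L \<beta> \<longleftrightarrow>
     (\<forall>i\<in>torus d L. \<forall>j\<in>torus d L. \<forall>k\<in>torus d L. \<beta> (tadd d L i k) (tadd d L j k) = \<beta> i j)"

definition fourier :: "nat \<Rightarrow> nat \<Rightarrow> (site \<Rightarrow> real) \<Rightarrow> site \<Rightarrow> complex" where
  "fourier d L G k = (\<Sum>j\<in>torus d L. complex_of_real (G j) * cis (pdot d L k j))"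

text \<open>Configuration: phi (j, r) for j in Lambda, r < n; component 0 is x, components
  1..n-1 are y^1..y^{n-1}; z is determined by the hyperboloid constraint.\<close>
definition Hn_z :: "nat \<Rightarrow> (site \<times> nat \<Rightarrow> real) \<Rightarrow> site \<Rightarrow> real" where
  "Hn_z n \<phi> j = sqrt (1 + (\<Sum>r<n. (\<phi> (j, r))\<^sup>2))"

definition Hn_dot :: "nat \<Rightarrow> (site \<times> nat \<Rightarrow> real) \<Rightarrow> site \<Rightarrow> site \<Rightarrow> real" where
  "Hn_dot n \<phi> i j = (\<Sum>r<n. \<phi> (i, r) * \<phi> (j, r)) - Hn_z n \<phi> i * Hn_z n \<phi> j"

text \<open>Hamiltonian; the sum over unordered pairs is half the ordered double sum
  (diagonal terms vanish since u.u = -1).\<close>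
definition Hn_H :: "nat \<Rightarrow> nat \<Rightarrow> nat \<Rightarrow> (site \<Rightarrow> site \<Rightarrow> real) \<Rightarrow> real
                    \<Rightarrow> (site \<times> nat \<Rightarrow> real) \<Rightarrow> real" where
  "Hn_H d L n \<beta> h \<phi> =
     (1/2) * (\<Sum>i\<in>torus d L. \<Sum>j\<in>torus d L. \<beta> i j * (- Hn_dot n \<phi> i j - 1))
     + h * (\<Sum>j\<in>torus d L. Hn_z n \<phi> j - 1)"

text \<open>Unnormalised weight: e^{-H} times the density 1/z of mu w.r.t. Lebesgue measure.\<close>
definition Hn_weight :: "nat \<Rightarrow> nat \<Rightarrow> nat \<Rightarrow> (site \<Rightarrow> site \<Rightarrow> real) \<Rightarrow> real
                    \<Rightarrow> (site \<times> nat \<Rightarrow> real) \<Rightarrow> real" where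
  "Hn_weight d L n \<beta> h \<phi> =
     exp (- Hn_H d L n \<beta> h \<phi>) * (\<Prod>j\<in>torus d L. 1 / Hn_z n \<phi> j)"

definition Hn_space :: "nat \<Rightarrow> nat \<Rightarrow> nat \<Rightarrow> (site \<times> nat \<Rightarrow> real) measure" where
  "Hn_space d L n = PiM (torus d L \<times> {..<n}) (\<lambda>_. lborel)"

definition Hn_expect :: "nat \<Rightarrow> nat \<Rightarrow> nat \<Rightarrow> (site \<Rightarrow> site \<Rightarrow> real) \<Rightarrow> real
                    \<Rightarrow> ((site \<times> nat \<Rightarrow> real) \<Rightarrow> real) \<Rightarrow> real" where
  "Hn_expect d L n \<beta> h F =
     (\<integral>\<phi>. F \<phi> * Hn_weight d L n \<beta> h \<phi> \<partial>Hn_space d L n) /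
     (\<integral>\<phi>. Hn_weight d L n \<beta> h \<phi> \<partial>Hn_space d L n)"

definition Hn_G :: "nat \<Rightarrow> nat \<Rightarrow> nat \<Rightarrow> (site \<Rightarrow> site \<Rightarrow> real) \<Rightarrow> real \<Rightarrow> site \<Rightarrow> real" where
  "Hn_G d L n \<beta> h j = Hn_expect d L n \<beta> h (\<lambda>\<phi>. \<phi> (torigin d, 1) * \<phi> (j, 1))"

subsection \<open>H^{2|2} model (horospherical coordinates)\<close>

definition det_on :: "'a set \<Rightarrow> ('a \<Rightarrow> 'a \<Rightarrow> real) \<Rightarrow> real" where
  "det_on I M = (\<Sum>\<sigma>\<in>{\<sigma>. \<sigma> permutes I}. of_int (sign \<sigma>) * (\<Prod>i\<in>I. M i (\<sigma> i)))"

text \<open>The symmetric matrix D_{beta,h}(t) whose quadratic form is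
  sum_<ij> beta_ij e^{t_i+t_j} (v_i - v_j)^2 + h sum_i e^{t_i} v_i^2.\<close>
definition Dmat :: "nat \<Rightarrow> nat \<Rightarrow> (site \<Rightarrow> site \<Rightarrow> real) \<Rightarrow> real \<Rightarrow> (site \<Rightarrow> real)
                    \<Rightarrow> site \<Rightarrow> site \<Rightarrow> real" where
  "Dmat d L \<beta> h t i j =
     (if i = j then (\<Sum>k\<in>torus d L - {i}. \<beta> i k * exp (t i + t k)) + h * exp (t i)
      else - \<beta> i j * exp (t i + t j))"

definition S22_H :: "nat \<Rightarrow> nat \<Rightarrow> (site \<Rightarrow> site \<Rightarrow> real) \<Rightarrow> real
                    \<Rightarrow> (site \<times> nat \<Rightarrow> real) \<Rightarrow> real" where
  "S22_H d L \<beta> h \<phi> =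
     (let s = (\<lambda>i. \<phi> (i, 0)); t = (\<lambda>i. \<phi> (i, 1)); \<Lambda> = torus d L in
       (1/2) * (\<Sum>i\<in>\<Lambda>. \<Sum>j\<in>\<Lambda>. \<beta> i j *
           (cosh (t i - t j) - 1 + (1/2) * (s i - s j)\<^sup>2 * exp (t i + t j)))
       + h * (\<Sum>i\<in>\<Lambda>. cosh (t i) - 1 + (1/2) * (s i)\<^sup>2 * exp (t i))
       + (\<Sum>i\<in>\<Lambda>. t i + ln (2 * pi))
       - ln (det_on \<Lambda> (Dmat d L \<beta> h t)))"

definition S22_space :: "nat \<Rightarrow> nat \<Rightarrow> (site \<times> nat \<Rightarrow> real) measure" where
  "S22_space d L = PiM (torus d L \<times> {..<2}) (\<lambda>_. lborel)"

definition S22_expect :: "nat \<Rightarrow> nat \<Rightarrow> (site \<Rightarrow> site \<Rightarrow> real) \<Rightarrow> real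
                    \<Rightarrow> ((site \<Rightarrow> real) \<Rightarrow> real) \<Rightarrow> real" where
  "S22_expect d L \<beta> h F =
     (\<integral>\<phi>. F (\<lambda>i. exp (\<phi> (i, 1)) * \<phi> (i, 0)) * exp (- S22_H d L \<beta> h \<phi>) \<partial>S22_space d L)"

definition S22_G :: "nat \<Rightarrow> nat \<Rightarrow> (site \<Rightarrow> site \<Rightarrow> real) \<Rightarrow> real \<Rightarrow> site \<Rightarrow> real" where
  "S22_G d L \<beta> h j = S22_expect d L \<beta> h (\<lambda>y. y (torigin d) * y j)"

end

theory Submission
  imports Defs "HOL-Probability.Sinc_Integral" "HOL-Probability.Distributions"
begin

text \<open>
  Both bounds are Mermin--Wagner type estimates: the Cauchy--Schwarz inequality for the observable
  \<open>\<Sum>\<^sub>j c\<^sub>j y\<^sub>j\<close> and the derivative of the Hamiltonian along a symmetry localised with the profile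
  \<open>c\<close>, combined with integration by parts, for \<open>c = cos (p \<cdot> j)\<close> and \<open>c = sin (p \<cdot> j)\<close>.

  For the \<open>H\<^sup>n\<close> model the symmetry is the Lorentz boost \<open>z \<partial>/\<partial>y\<close>. The factor in front of \<open>\<lambda>(p)\<close> is
  \<open>\<langle>z\<^sub>0 z\<^sub>j - y\<^sub>0 y\<^sub>j\<rangle> \<le> \<langle>z\<^sub>0\<^sup>2\<rangle> + \<langle>y\<^sub>0\<^sup>2\<rangle> = 1 + (n + 1) \<langle>y\<^sub>0\<^sup>2\<rangle>\<close>, and \<open>\<langle>z\<^sub>0\<rangle> \<ge> 1\<close>.

  For the \<open>H\<^sup>2\<^sup>|\<^sup>2\<close> model it is the horospherical translation \<open>\<partial>/\<partial>s\<close>. Given \<open>t\<close>, the field \<open>s\<close> is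
  Gaussian with precision matrix \<open>D(t)\<close>, and one needs \<open>\<langle>e\<^sup>t\<rangle> = 1\<close> and \<open>\<langle>e\<^sup>2\<^sup>t\<rangle> = 1 + \<langle>y\<^sup>2\<rangle>\<close>. Instead of
  using supersymmetry, these are proved by integrating out the sites one at a time: with the pivot
  \<open>p = e\<^sup>-\<^sup>2\<^sup>t D\<^sub>N\<^sub>N\<close> as new coordinate in place of \<open>t\<^sub>N\<close>, the remaining sites carry the same model with
  the weights of the Schur complement, so that everything reduces to a single site.
\<close>

subsection \<open>Elimination of one site\<close>

text \<open>Cauchy--Schwarz enters as an inequality quadratic in a free parameter \<open>a\<close>.
  Both models then supply the same input to \<open>infrared_bound\<close>, with \<open>b\<close>
  equal to \<open>\<langle>z\<^sub>0\<rangle>\<close> or to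
  \<open>\<langle>e\<^sup>t\<rangle> = 1\<close>, and \<open>a\<close> is optimised only after the
  contributions of the two test vectors have been added.

  The elimination closes up because one Schur complement acts on the energy, on the quadratic form
  in \<open>s\<close> and on the determinant, provided that \<open>p\<close> and not
  \<open>t N\<close> is held fixed. What is left over depends only on \<open>p\<close> and on the
  total weight \<open>a = (\<Sum>k. W N k) + \<eta> N\<close> at the removed site, so
  \<open>p\<close> has an explicit law: its reciprocal is inverse Gaussian with mean
  \<open>1 / a\<close> and shape 1. An expectation at one site is therefore a mixture of
  expectations in smaller models, and a comparison that holds on a single site for every admissible
  field passes to all finite index sets. At one site only Bessel functions of half-integer order
  occur, which are elementary.

  This part is written with non-negative extended integrals, so that Tonelli applies before anything
  is known to be integrable. The Gaussian estimate for \<open>s\<close> is likewise obtained by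
  elimination, which avoids inverting \<open>D(t)\<close>.\<close>

text \<open>The parameters left behind when site \<open>N\<close> is eliminated with pivot \<open>p\<close> (a Schur complement). They
  force general site-dependent fields and diagonal weights \<open>W i i\<close>, which have no effect.\<close>

definition elim_weight :: "('a \<Rightarrow> 'a \<Rightarrow> real) \<Rightarrow> 'a \<Rightarrow> real \<Rightarrow> 'a \<Rightarrow> 'a \<Rightarrow> real" where
  "elim_weight W N p i j = W i j + W i N * W j N / p"

definition elim_field :: "('a \<Rightarrow> 'a \<Rightarrow> real) \<Rightarrow> ('a \<Rightarrow> real) \<Rightarrow> 'a \<Rightarrow> real \<Rightarrow> 'a \<Rightarrow> real" where
  "elim_field W \<eta> N p i = \<eta> i + W i N * \<eta> N / p"

definition quad_form :: "'a set \<Rightarrow> ('a \<Rightarrow> 'a \<Rightarrow> real) \<Rightarrow> ('a \<Rightarrow> real) \<Rightarrow> ('a \<Rightarrow> real) \<Rightarrow> ('a \<Rightarrow> real) \<Rightarrow> real" where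
  "quad_form I W \<eta> t s = (1/2) * (\<Sum>i\<in>I. \<Sum>j\<in>I. W i j * (exp (t i + t j) * (s i - s j)\<^sup>2))
     + (\<Sum>i\<in>I. \<eta> i * (exp (t i) * (s i)\<^sup>2))"

definition energy :: "'a set \<Rightarrow> ('a \<Rightarrow> 'a \<Rightarrow> real) \<Rightarrow> ('a \<Rightarrow> real) \<Rightarrow> ('a \<Rightarrow> real) \<Rightarrow> real" where
  "energy I W \<eta> t = (1/2) * (\<Sum>i\<in>I. \<Sum>j\<in>I. W i j * (cosh (t i - t j) - 1))
     + (\<Sum>i\<in>I. \<eta> i * (cosh (t i) - 1))"

definition dmat :: "'a set \<Rightarrow> ('a \<Rightarrow> 'a \<Rightarrow> real) \<Rightarrow> ('a \<Rightarrow> real) \<Rightarrow> ('a \<Rightarrow> real) \<Rightarrow> 'a \<Rightarrow> 'a \<Rightarrow> real" where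
  "dmat I W \<eta> t i j = (if i = j then (\<Sum>k\<in>I - {i}. W i k * exp (t i + t k)) + \<eta> i * exp (t i)
     else - W i j * exp (t i + t j))"

text \<open>This is \<open>e^(-t N)\<close> times the diagonal entry of \<open>D(t)\<close> at
  \<open>N\<close>. For \<open>N\<close> outside \<open>V\<close> it does not involve
  \<open>t N\<close>, so the pivot \<open>p = pivot * e^(-t N)\<close> can replace
  \<open>t N\<close> as a coordinate while the other sites are fixed.\<close>

definition pivot :: "'a set \<Rightarrow> ('a \<Rightarrow> 'a \<Rightarrow> real) \<Rightarrow> ('a \<Rightarrow> real) \<Rightarrow> ('a \<Rightarrow> real) \<Rightarrow> 'a \<Rightarrow> real" where
  "pivot V W \<eta> t N = (\<Sum>k\<in>V. W N k * exp (t k)) + \<eta> N"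

lemma exp_twice: "exp (x * 2) = exp x * exp x" "exp (2 * x) = exp x * exp x" for x :: real
  by (simp_all add: exp_add[symmetric])

lemma quad_form_cong: "(\<And>i. i \<in> I \<Longrightarrow> t i = t' i) \<Longrightarrow> (\<And>i. i \<in> I \<Longrightarrow> s i = s' i) \<Longrightarrow> quad_form I W \<eta> t s = quad_form I W \<eta> t' s'"
  by (simp add: quad_form_def)

lemma energy_cong: "(\<And>i. i \<in> I \<Longrightarrow> t i = t' i) \<Longrightarrow> energy I W \<eta> t = energy I W \<eta> t'"
  by (simp add: energy_def)

lemma det_on_cong:
  assumes "\<And>i j. i \<in> I \<Longrightarrow> j \<in> I \<Longrightarrow> M i j = M' i j"
  shows "det_on I M = det_on I M'"
  unfolding det_on_def using assms
  by (intro sum.cong refl arg_cong2[where f="(*)"] prod.cong) (auto simp: permutes_in_image)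

lemma dmat_cong: "(\<And>i. i \<in> I \<Longrightarrow> t i = t' i) \<Longrightarrow> i \<in> I \<Longrightarrow> j \<in> I \<Longrightarrow> dmat I W \<eta> t i j = dmat I W \<eta> t' i j"
  by (auto simp: dmat_def)

lemma det_dmat_cong: "(\<And>i. i \<in> I \<Longrightarrow> t i = t' i) \<Longrightarrow> det_on I (dmat I W \<eta> t) = det_on I (dmat I W \<eta> t')"
  by (intro det_on_cong dmat_cong)

lemma sum_insert_double:
  fixes f :: "'a \<Rightarrow> 'a \<Rightarrow> real"
  assumes "finite V" "N \<notin> V" "f N N = 0" "\<And>k. k \<in> V \<Longrightarrow> f k N = f N k"
  shows "(\<Sum>i\<in>insert N V. \<Sum>j\<in>insert N V. f i j) = (\<Sum>i\<in>V. \<Sum>j\<in>V. f i j) + 2 * (\<Sum>k\<in>V. f N k)"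
proof -
  have "(\<Sum>i\<in>V. f i N) = (\<Sum>i\<in>V. f N i)" using assms by (intro sum.cong) auto
  then show ?thesis using assms by (simp add: sum.distrib)
qed

text \<open>The star-mesh transformation of electrical networks: a node \<open>x\<close> joined to
  the \<open>s k\<close> with conductances \<open>a k\<close>, and to ground with \<open>a0\<close>,
  is removed. Completing the square in \<open>x\<close> leaves \<open>P * (x - m)^2\<close>, and the
  remainder is a mesh with conductances \<open>a j * a k / P\<close> between the neighbours and
  \<open>a0 * a k / P\<close> to ground. Both sides are expressed through the three sums
  \<open>A\<close>, \<open>B\<close>, \<open>C\<close> of \<open>a k\<close> against 1,
  \<open>s k\<close> and \<open>s k\<close> squared.\<close>

lemma star_mesh:
  fixes a s :: "'a \<Rightarrow> real"
  assumes V: "finite V" and P: "P = (\<Sum>k\<in>V. a k) + a0" "P \<noteq> 0" and m: "m = (\<Sum>k\<in>V. a k * s k) / P"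
  shows "(\<Sum>k\<in>V. a k * (x - s k)\<^sup>2) + a0 * x\<^sup>2 =
    P * (x - m)\<^sup>2 + (1/2) * (\<Sum>j\<in>V. \<Sum>k\<in>V. a j * a k / P * (s j - s k)\<^sup>2) + (\<Sum>k\<in>V. a0 * a k / P * (s k)\<^sup>2)"
proof -
  define A B C where "A = (\<Sum>k\<in>V. a k)" and "B = (\<Sum>k\<in>V. a k * s k)" and "C = (\<Sum>k\<in>V. a k * (s k)\<^sup>2)"
  have 1: "(\<Sum>k\<in>V. a k * (x - s k)\<^sup>2) = A * x\<^sup>2 - 2 * x * B + C"
  proof -
    have "(\<Sum>k\<in>V. a k * (x - s k)\<^sup>2) = (\<Sum>k\<in>V. a k * x\<^sup>2 - 2 * x * (a k * s k) + a k * (s k)\<^sup>2)"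
      by (intro sum.cong refl) (simp add: power2_diff algebra_simps)
    then show ?thesis unfolding A_def B_def C_def
      by (simp only: sum.distrib sum_subtractf sum_distrib_left sum_distrib_right)
  qed
  have 2: "(\<Sum>j\<in>V. \<Sum>k\<in>V. a j * a k / P * (s j - s k)\<^sup>2) = (2 * A * C - 2 * B * B) / P"
  proof -
    have "(\<Sum>j\<in>V. \<Sum>k\<in>V. a j * a k / P * (s j - s k)\<^sup>2) =
        (\<Sum>j\<in>V. \<Sum>k\<in>V. (a j * (s j)\<^sup>2 * a k + a j * (a k * (s k)\<^sup>2) - 2 * (a j * s j * (a k * s k))) / P)"
      using P(2) by (intro sum.cong refl) (simp add: power2_diff algebra_simps diff_divide_distrib add_divide_distrib)
    also have "\<dots> = (C * A + A * C - 2 * (B * B)) / P"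
      unfolding A_def B_def C_def
      by (simp only: sum_divide_distrib[symmetric] sum.distrib sum_subtractf sum_distrib_left[symmetric] sum_distrib_right[symmetric])
    finally show ?thesis by (simp add: mult.commute mult.left_commute)
  qed
  have 3: "(\<Sum>k\<in>V. a0 * a k / P * (s k)\<^sup>2) = a0 * C / P"
    unfolding C_def sum_distrib_left sum_divide_distrib by (intro sum.cong refl) simp
  have "P = A + a0" "m = B / P" using P m by (simp_all add: A_def B_def)
  moreover have "A * x\<^sup>2 - 2 * x * B + C + a0 * x\<^sup>2 =
     P * (x - m)\<^sup>2 + (1/2) * ((2 * A * C - 2 * B * B) / P) + a0 * C / P"
    if "P = A + a0" "m = B / P"
  proof -
    have A: "A = P - a0" and B: "B = m * P" using that P(2) by simp_all
    have q: "(2 * A * C - 2 * B * B) / P = 2 * (C - a0 * C / P - m * m * P)"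
      unfolding A B using P(2) by (simp add: field_simps)
    show ?thesis unfolding q unfolding A B by (simp add: power2_eq_square algebra_simps)
  qed
  ultimately show ?thesis unfolding 1 2 3 by simp
qed

lemma pivot_pos:
  assumes "finite V" "\<eta> N > 0" "\<And>k. k \<in> V \<Longrightarrow> W N k \<ge> 0"
  shows "pivot V W \<eta> t N > 0"
  unfolding pivot_def using assms by (intro add_nonneg_pos sum_nonneg) auto

text \<open>The conductances at \<open>N\<close> are \<open>W N k * e^(t N + t k)\<close>. In the
  products \<open>a j * a k\<close> the factor \<open>e^(2 t N)\<close> cancels against
  \<open>P = p * e^(2 t N)\<close>, so the mesh conductances are again a weight times
  \<open>e^(t j + t k)\<close>: for fixed \<open>p\<close> the form keeps its shape and no trace of
  \<open>t N\<close> remains outside the square.\<close>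

lemma quad_form_elim:
  assumes V: "finite V" "N \<notin> V" and sym: "\<And>k. k \<in> V \<Longrightarrow> W k N = W N k"
    and pos: "pivot V W \<eta> t N > 0"
    and p: "p = pivot V W \<eta> t N * exp (- t N)"
    and m: "m = (\<Sum>k\<in>V. W N k * exp (t N + t k) * s k) / (p * exp (2 * t N))"
  shows "quad_form (insert N V) W \<eta> t s = p * exp (2 * t N) * (s N - m)\<^sup>2 + quad_form V (elim_weight W N p) (elim_field W \<eta> N p) t s"
proof -
  define a where "a k = W N k * exp (t N + t k)" for k
  define a0 where "a0 = \<eta> N * exp (t N)"
  define P where "P = p * exp (2 * t N)"
  have p0: "p > 0" using pos p by simp
  have PP: "P = (\<Sum>k\<in>V. a k) + a0" "P \<noteq> 0"
  proof -
    have "P = pivot V W \<eta> t N * exp (t N)" unfolding P_def p by (simp add: mult.assoc exp_add[symmetric])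
    also have "\<dots> = (\<Sum>k\<in>V. a k) + a0"
      unfolding a_def a0_def pivot_def by (simp add: exp_add algebra_simps sum_distrib_left)
    finally show "P = (\<Sum>k\<in>V. a k) + a0" .
    show "P \<noteq> 0" using p0 by (simp add: P_def)
  qed
  have aa: "a j * a k / P = W j N * W k N / p * exp (t j + t k)" if "j \<in> V" "k \<in> V" for j k
    using that p0 by (simp add: a_def P_def sym field_simps exp_add exp_twice power2_eq_square)
  have a0a: "a0 * a k / P = W k N * \<eta> N / p * exp (t k)" if "k \<in> V" for k
    using that p0 by (simp add: a_def a0_def P_def sym field_simps exp_add exp_twice power2_eq_square)
  have E: "quad_form (insert N V) W \<eta> t s = quad_form V W \<eta> t s + ((\<Sum>k\<in>V. a k * (s N - s k)\<^sup>2) + a0 * (s N)\<^sup>2)"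
    unfolding quad_form_def
    apply (subst sum_insert_double)
    using V by (auto simp: sym power2_commute add.commute a_def a0_def algebra_simps)
  also have "(\<Sum>k\<in>V. a k * (s N - s k)\<^sup>2) + a0 * (s N)\<^sup>2 = P * (s N - m)\<^sup>2 
      + (1/2) * (\<Sum>j\<in>V. \<Sum>k\<in>V. a j * a k / P * (s j - s k)\<^sup>2) + (\<Sum>k\<in>V. a0 * a k / P * (s k)\<^sup>2)"
    by (rule star_mesh[OF V(1) PP]) (simp add: m a_def P_def)
  also have "quad_form V W \<eta> t s + (P * (s N - m)\<^sup>2 
      + (1/2) * (\<Sum>j\<in>V. \<Sum>k\<in>V. a j * a k / P * (s j - s k)\<^sup>2) + (\<Sum>k\<in>V. a0 * a k / P * (s k)\<^sup>2))
     = P * (s N - m)\<^sup>2 + quad_form V (elim_weight W N p) (elim_field W \<eta> N p) t s"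
    unfolding quad_form_def elim_weight_def elim_field_def
    by (simp add: aa a0a distrib_right sum.distrib algebra_simps cong: sum.cong)
  finally show ?thesis unfolding P_def .
qed

text \<open>With \<open>B\<close> and \<open>C\<close> the sums of \<open>W N k * e^(t k)\<close>
  and \<open>W N k * e^(-t k)\<close>, the definition of \<open>p\<close> says
  \<open>e^(t N) = (B + \<eta> N) / p\<close>. Hence the terms at \<open>N\<close> equal
  \<open>((B + \<eta> N) * (C + \<eta> N) / p + p) / 2 - a\<close>. The product over
  \<open>p\<close> is the energy of the mesh together with its ground terms, up to constants, and
  these constants complete \<open>p / 2 - a\<close> to \<open>(p - a)^2 / (2 p)\<close>.\<close>

lemma energy_elim:
  assumes V: "finite V" "N \<notin> V" and sym: "\<And>k. k \<in> V \<Longrightarrow> W k N = W N k"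
    and pos: "pivot V W \<eta> t N > 0"
    and p: "p = pivot V W \<eta> t N * exp (- t N)"
    and a: "a = (\<Sum>k\<in>V. W N k) + \<eta> N"
  shows "energy (insert N V) W \<eta> t = (p - a)\<^sup>2 / (2 * p) + energy V (elim_weight W N p) (elim_field W \<eta> N p) t"
proof -
  have p0: "p > 0" using pos p by simp
  define A B C where "A = (\<Sum>k\<in>V. W N k)" and "B = (\<Sum>k\<in>V. W N k * exp (t k))" and "C = (\<Sum>k\<in>V. W N k * exp (- t k))"
  have et: "exp (t N) = (B + \<eta> N) / p" "exp (- t N) = p / (B + \<eta> N)"
  proof -
    have "p = (B + \<eta> N) * exp (- t N)" by (simp add: p pivot_def B_def)
    moreover have "exp (t N) = 1 / exp (- t N)" by (simp add: exp_minus field_simps)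
    moreover have "B + \<eta> N \<noteq> 0" using pos by (simp add: pivot_def B_def)
    ultimately show "exp (t N) = (B + \<eta> N) / p" "exp (- t N) = p / (B + \<eta> N)" by auto
  qed
  have E: "energy (insert N V) W \<eta> t = energy V W \<eta> t + ((\<Sum>k\<in>V. W N k * (cosh (t N - t k) - 1)) + \<eta> N * (cosh (t N) - 1))"
    unfolding energy_def
    apply (subst sum_insert_double)
    using V by (auto simp: sym cosh_def add.commute)
  have 1: "(\<Sum>k\<in>V. W N k * (cosh (t N - t k) - 1)) = (exp (t N) * C + exp (- t N) * B) / 2 - A"
  proof -
    have "(\<Sum>k\<in>V. W N k * (cosh (t N - t k) - 1)) = (\<Sum>k\<in>V. (exp (t N) * (W N k * exp (- t k)) + exp (- t N) * (W N k * exp (t k))) / 2 - W N k)"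
      by (intro sum.cong refl) (simp add: cosh_field_def exp_diff exp_minus field_simps)
    then show ?thesis unfolding A_def B_def C_def
      by (simp add: sum_subtractf sum.distrib sum_distrib_left sum_divide_distrib[symmetric])
  qed
  have 2: "(\<Sum>j\<in>V. \<Sum>k\<in>V. W j N * W k N / p * (cosh (t j - t k) - 1)) = (B * C - A * A) / p"
  proof -
    have "(\<Sum>j\<in>V. \<Sum>k\<in>V. W j N * W k N / p * (cosh (t j - t k) - 1)) =
      (\<Sum>j\<in>V. \<Sum>k\<in>V. ((W N j * exp (t j)) * (W N k * exp (- t k)) + (W N j * exp (- t j)) * (W N k * exp (t k))) / (2 * p) - W N j * W N k / p)"
      using p0 by (intro sum.cong refl) (simp add: cosh_field_def exp_diff exp_minus sym field_simps)
    also have "\<dots> = (B * C + C * B) / (2 * p) - A * A / p"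
      unfolding A_def B_def C_def
      by (simp add: sum_divide_distrib[symmetric] sum.distrib sum_subtractf sum_product)
    finally show ?thesis using p0 by (simp add: field_simps)
  qed
  have 3: "(\<Sum>k\<in>V. W k N * \<eta> N / p * (cosh (t k) - 1)) = \<eta> N * ((B + C) / 2 - A) / p"
  proof -
    have "(\<Sum>k\<in>V. W k N * \<eta> N / p * (cosh (t k) - 1)) = (\<Sum>k\<in>V. \<eta> N / p * (((W N k * exp (t k)) + (W N k * exp (- t k))) / 2 - W N k))"
      using p0 by (intro sum.cong refl) (simp add: cosh_field_def exp_diff exp_minus sym field_simps)
    also have "\<dots> = \<eta> N / p * ((B + C) / 2 - A)"
      unfolding A_def B_def C_def
      by (simp add: sum_divide_distrib[symmetric] sum.distrib sum_subtractf sum_distrib_left[symmetric])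
    finally show ?thesis by simp
  qed
  have BN: "B + \<eta> N > 0" using pos by (simp add: pivot_def B_def)
  have "(exp (t N) * C + exp (- t N) * B) / 2 - A + \<eta> N * (cosh (t N) - 1)
      = (p - a)\<^sup>2 / (2 * p) + (1/2) * ((B * C - A * A) / p) + \<eta> N * ((B + C) / 2 - A) / p"
  proof -
    have "(exp (t N) * C + exp (- t N) * B) / 2 - A + \<eta> N * (cosh (t N) - 1) =
      (exp (t N) * (C + \<eta> N) + exp (- t N) * (B + \<eta> N)) / 2 - (A + \<eta> N)"
      by (simp add: cosh_field_def add_divide_distrib algebra_simps)
    also have "\<dots> = ((B + \<eta> N) * (C + \<eta> N) / p + p) / 2 - (A + \<eta> N)"
      using BN unfolding et by simp
    also have "\<dots> = (p - a)\<^sup>2 / (2 * p) + (1/2) * ((B * C - A * A) / p) + \<eta> N * ((B + C) / 2 - A) / p"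
    proof -
      have a: "a = A + \<eta> N" using a by (simp add: A_def)
      have "(p - a)\<^sup>2 / (2 * p) = p / 2 - a + a * a / (2 * p)"
        using p0 by (simp add: power2_eq_square field_simps)
      then show ?thesis unfolding a using p0
        by (simp add: add_divide_distrib diff_divide_distrib algebra_simps)
    qed
    finally show ?thesis .
  qed
  then show ?thesis
    unfolding E 1 unfolding energy_def elim_weight_def elim_field_def
    by (simp add: distrib_right distrib_left sum.distrib 2 3 del: times_divide_eq_left times_divide_eq_right)
qed

section \<open>Determinants over a finite index set and Schur complements\<close>

text \<open>A permutation that moves \<open>N\<close> sends some \<open>i\<close> in
  \<open>V\<close> to \<open>N\<close> and picks up the zero entry \<open>M i N\<close>; only the
  permutations of \<open>V\<close> survive.\<close>

lemma det_on_elim_zero: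
  assumes V: "finite V" "N \<notin> V" and z: "\<And>i. i \<in> V \<Longrightarrow> M i N = 0"
  shows "det_on (insert N V) M = M N N * det_on V M"
proof -
  have "det_on (insert N V) M = (\<Sum>\<sigma>\<in>{\<sigma>. \<sigma> permutes V}. of_int (sign \<sigma>) * (\<Prod>i\<in>insert N V. M i (\<sigma> i)))"
    unfolding det_on_def
  proof (rule sum.mono_neutral_right)
    show "finite {\<sigma>. \<sigma> permutes insert N V}" using V by (simp add: finite_permutations)
    show "{\<sigma>. \<sigma> permutes V} \<subseteq> {\<sigma>. \<sigma> permutes insert N V}" by (auto intro: permutes_subset)
    show "\<forall>\<sigma>\<in>{\<sigma>. \<sigma> permutes insert N V} - {\<sigma>. \<sigma> permutes V}. real_of_int (sign \<sigma>) * (\<Prod>i\<in>insert N V. M i (\<sigma> i)) = 0"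
    proof
      fix \<sigma> assume "\<sigma> \<in> {\<sigma>. \<sigma> permutes insert N V} - {\<sigma>. \<sigma> permutes V}"
      then have s: "\<sigma> permutes insert N V" "\<not> \<sigma> permutes V" by auto
      then have "\<sigma> N \<noteq> N"
        by (metis insertE permutes_superset Diff_iff)
      obtain i where i: "i \<in> insert N V" "\<sigma> i = N" 
        using permutes_image[OF s(1)] by (metis imageE insertI1)
      then have "i \<in> V" using \<open>\<sigma> N \<noteq> N\<close> by auto
      then have "M i (\<sigma> i) = 0" using z i by simp
      then show "real_of_int (sign \<sigma>) * (\<Prod>i\<in>insert N V. M i (\<sigma> i)) = 0"
        using V i by (auto intro!: prod_zero)
    qed
  qed
  also have "\<dots> = (\<Sum>\<sigma>\<in>{\<sigma>. \<sigma> permutes V}. M N N * (of_int (sign \<sigma>) * (\<Prod>i\<in>V. M i (\<sigma> i))))"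
    using V by (intro sum.cong refl) (auto simp: permutes_not_in)
  finally show ?thesis by (simp add: det_on_def sum_distrib_left)
qed

text \<open>Composing every permutation with the transposition of \<open>i\<close> and
  \<open>j\<close> reverses its sign but leaves the product of entries unchanged, so the determinant
  equals its own negative.\<close>

lemma det_on_eq_rows:
  assumes I: "finite I" "i \<in> I" "j \<in> I" "i \<noteq> j" and eq: "\<And>k. k \<in> I \<Longrightarrow> M i k = M j k"
  shows "det_on I M = 0"
proof -
  let ?T = "Transposition.transpose i j"
  have T: "?T permutes I" using I by (simp add: permutes_swap_id)
  have "det_on I M = (\<Sum>\<sigma>\<in>{\<sigma>. \<sigma> permutes I}. of_int (sign (\<sigma> \<circ> ?T)) * (\<Prod>k\<in>I. M k ((\<sigma> \<circ> ?T) k)))"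
    unfolding det_on_def by (rule sum_permutations_compose_right[OF T])
  also have "\<dots> = (\<Sum>\<sigma>\<in>{\<sigma>. \<sigma> permutes I}. - (of_int (sign \<sigma>) * (\<Prod>k\<in>I. M k (\<sigma> k))))"
  proof (intro sum.cong refl)
    fix \<sigma> assume "\<sigma> \<in> {\<sigma>. \<sigma> permutes I}"
    then have s: "\<sigma> permutes I" by simp
    have "sign (\<sigma> \<circ> ?T) = - sign \<sigma>"
      using s T I by (subst sign_compose) (auto intro: permutation_permutes[THEN iffD2] simp: sign_swap_id permutation_permutes)
    moreover have "(\<Prod>k\<in>I. M k ((\<sigma> \<circ> ?T) k)) = (\<Prod>k\<in>I. M (?T k) ((\<sigma> \<circ> ?T) (?T k)))"
      using prod.permute[OF T, of "\<lambda>k. M k ((\<sigma> \<circ> ?T) k)"] by (simp add: o_def)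
    moreover have "\<dots> = (\<Prod>k\<in>I. M k (\<sigma> k))"
      using s I eq by (intro prod.cong refl) (auto simp: Transposition.transpose_def permutes_in_image)
    ultimately show "real_of_int (sign (\<sigma> \<circ> ?T)) * (\<Prod>k\<in>I. M k ((\<sigma> \<circ> ?T) k)) = - (of_int (sign \<sigma>) * (\<Prod>k\<in>I. M k (\<sigma> k)))"
      by simp
  qed
  also have "\<dots> = - det_on I M" by (simp add: det_on_def sum_negf)
  finally show ?thesis by simp
qed

lemma det_on_row_add:
  assumes I: "finite I" "i \<in> I" "j \<in> I" "i \<noteq> j"
  shows "det_on I (\<lambda>k l. if k = i then M i l + c * M j l else M k l) = det_on I M"
proof -
  let ?R = "\<lambda>k l. if k = i then M j l else M k l"
  have "det_on I (\<lambda>k l. if k = i then M i l + c * M j l else M k l) = det_on I M + c * det_on I ?R"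
    unfolding det_on_def sum_distrib_left sum.distrib[symmetric]
  proof (intro sum.cong refl)
    fix \<sigma> :: "'a \<Rightarrow> 'a"
    have s: "(\<Prod>k\<in>I. f k) = f i * (\<Prod>k\<in>I - {i}. f k)" for f :: "'a \<Rightarrow> real"
      using I by (simp add: prod.remove)
    have e: "(\<Prod>k\<in>I - {i}. if k = i then f k else g k) = (\<Prod>k\<in>I - {i}. g k)" for f g :: "'a \<Rightarrow> real"
      by (intro prod.cong) auto
    show "real_of_int (sign \<sigma>) * (\<Prod>k\<in>I. if k = i then M i (\<sigma> k) + c * M j (\<sigma> k) else M k (\<sigma> k)) =
       real_of_int (sign \<sigma>) * (\<Prod>i\<in>I. M i (\<sigma> i)) + c * (real_of_int (sign \<sigma>) * (\<Prod>k\<in>I. if k = i then M j (\<sigma> k) else M k (\<sigma> k)))"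
      unfolding s e by (simp add: algebra_simps)
  qed
  moreover have "det_on I ?R = 0"
    by (rule det_on_eq_rows[OF I]) (use I in auto)
  ultimately show ?thesis by simp
qed

text \<open>Gaussian elimination of column \<open>N\<close>. Row operations preserve the
  determinant, and once all rows in \<open>V\<close> are cleared, \<open>det_on_elim_zero\<close>
  splits off the entry \<open>M N N\<close>.\<close>

lemma det_on_schur:
  assumes V: "finite V" "N \<notin> V" and p: "M N N \<noteq> 0"
  shows "det_on (insert N V) M = M N N * det_on V (\<lambda>i j. M i j - M i N * M N j / M N N)"
proof -
  \<comment> \<open>\<open>?R U\<close> is the matrix after the rows in \<open>U\<close> have been
    cleared. Row \<open>N\<close> is never altered, since \<open>U\<close> lies in \<open>V\<close>,
    so it stays available for the next operation.\<close>
  let ?R = "\<lambda>U i j. if i \<in> U then M i j - M i N * M N j / M N N else M i j"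
  have "det_on (insert N V) (?R U) = det_on (insert N V) M" if "finite U" "U \<subseteq> V" for U
    using that
  proof (induction U rule: finite_induct)
    case empty
    then show ?case by simp
  next
    case (insert x U)
    have "?R (insert x U) = (\<lambda>k l. if k = x then ?R U x l + (- M x N / M N N) * ?R U N l else ?R U k l)"
      using insert V by (intro ext) auto
    then have "det_on (insert N V) (?R (insert x U)) = det_on (insert N V) (?R U)"
      using det_on_row_add[of "insert N V" x N "?R U" "- M x N / M N N"] insert V by auto
    then show ?case using insert by simp
  qed
  from this[of V] have "det_on (insert N V) M = det_on (insert N V) (?R V)" using V by simp
  also have "\<dots> = ?R V N N * det_on V (?R V)"
    by (rule det_on_elim_zero[OF V]) (use p in auto)
  also have "det_on V (?R V) = det_on V (\<lambda>i j. M i j - M i N * M N j / M N N)"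
    by (rule det_on_cong) auto
  finally show ?thesis using V by simp
qed

text \<open>Off the diagonal the Schur complement adds \<open>W i N * W j N / p\<close> to the
  weight directly. On the diagonal the identity \<open>p * e^(t N) = pivot\<close> is needed: it
  redistributes the lost conductance \<open>W i N * e^(t i + t N)\<close> over the new mesh edges,
  the new field at \<open>i\<close>, and the term with \<open>k = i\<close> that the Schur
  complement subtracts.\<close>

lemma dmat_elim:
  assumes V: "finite V" "N \<notin> V" and sym: "\<And>k. k \<in> V \<Longrightarrow> W k N = W N k"
    and pos: "pivot V W \<eta> t N > 0"
    and p: "p = pivot V W \<eta> t N * exp (- t N)"
  shows "det_on (insert N V) (dmat (insert N V) W \<eta> t) =
    p * exp (2 * t N) * det_on V (dmat V (elim_weight W N p) (elim_field W \<eta> N p) t)"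
proof -
  let ?D = "dmat (insert N V) W \<eta> t"
  have p0: "p > 0" using pos p by simp
  have VN: "insert N V - {N} = V" using V by auto
  have D: "?D N N = p * exp (2 * t N)"
    unfolding dmat_def p VN pivot_def
    by (simp add: mult.assoc exp_add[symmetric]) (simp add: exp_add algebra_simps sum_distrib_left)
  have pe: "p * exp (t N) = pivot V W \<eta> t N" unfolding p by (simp add: exp_minus)
  have "?D i j - ?D i N * ?D N j / ?D N N = dmat V (elim_weight W N p) (elim_field W \<eta> N p) t i j"
    if ij: "i \<in> V" "j \<in> V" for i j
  proof (cases "i = j")
    case False
    then show ?thesis unfolding D using that V p0
      by (auto simp: dmat_def elim_weight_def sym exp_add exp_twice power2_eq_square field_simps)
  next
    case True
    have iN: "i \<noteq> N" using ij V by auto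
    have "insert N V - {i} = insert N (V - {i})" using iN by auto
    then have "?D i i = (\<Sum>k\<in>V-{i}. W i k * exp (t i + t k)) + W i N * exp (t i + t N) + \<eta> i * exp (t i)"
      using V by (simp add: dmat_def)
    moreover have "?D i N * ?D N i / ?D N N = W i N * W i N / p * exp (2 * t i)"
      unfolding D using iN ij p0 by (simp add: dmat_def sym exp_add exp_twice power2_eq_square field_simps)
    moreover have "dmat V (elim_weight W N p) (elim_field W \<eta> N p) t i i =
       (\<Sum>k\<in>V-{i}. W i k * exp (t i + t k)) + (\<Sum>k\<in>V-{i}. W i N * W k N / p * exp (t i + t k)) + \<eta> i * exp (t i) + W i N * \<eta> N / p * exp (t i)"
      by (simp add: dmat_def elim_weight_def elim_field_def distrib_right sum.distrib)
    moreover have "W i N * exp (t i + t N) = (\<Sum>k\<in>V-{i}. W i N * W k N / p * exp (t i + t k)) + W i N * W i N / p * exp (2 * t i) + W i N * \<eta> N / p * exp (t i)"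
    proof -
      have "W i N * exp (t i + t N) = W i N / p * exp (t i) * (p * exp (t N))"
        using p0 by (simp add: exp_add)
      also have "\<dots> = W i N / p * exp (t i) * ((\<Sum>k\<in>V. W N k * exp (t k)) + \<eta> N)"
        unfolding pe pivot_def ..
      also have "(\<Sum>k\<in>V. W N k * exp (t k)) = W i N * exp (t i) + (\<Sum>k\<in>V - {i}. W k N * exp (t k))"
        using V ij by (subst sum.remove[of V i]) (auto simp: sym)
      also have "W i N / p * exp (t i) * (W i N * exp (t i) + (\<Sum>k\<in>V - {i}. W k N * exp (t k)) + \<eta> N)
       = (\<Sum>k\<in>V-{i}. W i N * W k N / p * exp (t i + t k)) + W i N * W i N / p * exp (2 * t i) + W i N * \<eta> N / p * exp (t i)"
        by (simp add: algebra_simps sum_distrib_left exp_add exp_twice power2_eq_square)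
      finally show ?thesis .
    qed
    ultimately show ?thesis using True by simp
  qed
  then have "det_on V (\<lambda>i j. ?D i j - ?D i N * ?D N j / ?D N N) = det_on V (dmat V (elim_weight W N p) (elim_field W \<eta> N p) t)"
    by (rule det_on_cong)
  then show ?thesis using det_on_schur[OF V, of ?D] D p0 by simp
qed

section \<open>Admissible parameters and positivity of the determinant\<close>

text \<open>This class is closed under elimination and so carries the inductions over sites. Strict
  positivity of the field makes every pivot positive, even at a site whose weights all
  vanish.\<close>

definition admissible :: "'a set \<Rightarrow> ('a \<Rightarrow> 'a \<Rightarrow> real) \<Rightarrow> ('a \<Rightarrow> real) \<Rightarrow> bool" where
  "admissible I W \<eta> \<longleftrightarrow> finite I \<and> (\<forall>i\<in>I. \<forall>j\<in>I. W i j = W j i \<and> W i j \<ge> 0) \<and> (\<forall>i\<in>I. \<eta> i > 0)"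

lemma admissible_insertD:
  assumes "admissible (insert N V) W \<eta>"
  shows "finite V" "\<eta> N > 0" "\<And>k. k \<in> V \<Longrightarrow> W k N = W N k" "\<And>k. k \<in> V \<Longrightarrow> W N k \<ge> 0"
proof -
  note A = assms[unfolded admissible_def]
  note f = A[THEN conjunct1] and w = A[THEN conjunct2, THEN conjunct1] and e = A[THEN conjunct2, THEN conjunct2]
  show "finite V" "\<eta> N > 0" using f e by simp_all
  show "W k N = W N k" "W N k \<ge> 0" if "k \<in> V" for k
    using bspec[OF bspec[OF w], of k N] bspec[OF bspec[OF w], of N k] that by simp_all
qed

lemma admissible_pivot:
  assumes "admissible (insert N V) W \<eta>"
  shows "pivot V W \<eta> t N > 0"
  using admissible_insertD[OF assms] by (intro pivot_pos) auto

lemma admissible_elim: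
  assumes "admissible (insert N V) W \<eta>" "p > 0"
  shows "admissible V (elim_weight W N p) (elim_field W \<eta> N p)"
  unfolding admissible_def
proof (intro conjI ballI)
  note D = admissible_insertD[OF assms(1)]
  show "finite V" by (rule D)
  show "elim_weight W N p i j = elim_weight W N p j i" "elim_weight W N p i j \<ge> 0" if "i \<in> V" "j \<in> V" for i j
  proof -
    have "W i j = W j i" "W i j \<ge> 0" using assms(1) that unfolding admissible_def by blast+
    then show "elim_weight W N p i j = elim_weight W N p j i" "elim_weight W N p i j \<ge> 0"
      using D that assms(2) by (simp_all add: elim_weight_def)
  qed
  show "elim_field W \<eta> N p i > 0" if "i \<in> V" for i
  proof -
    have "\<eta> i > 0" using assms(1) that unfolding admissible_def by blast
    then show ?thesis using D that assms(2) by (simp add: elim_field_def add_pos_nonneg)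
  qed
qed

text \<open>Elimination writes the determinant as a product of the positive factors
  \<open>p * e^(2 t N)\<close>, one for each site.\<close>

lemma det_dmat_pos:
  assumes "admissible I W \<eta>"
  shows "det_on I (dmat I W \<eta> t) > 0"
proof -
  have "finite I" using assms by (simp add: admissible_def)
  then show ?thesis using assms
  proof (induction I arbitrary: W \<eta> rule: finite_induct)
    case empty
    then show ?case by (simp add: det_on_def permutes_empty)
  next
    case (insert N V)
    note pp = admissible_pivot[OF insert.prems, of t]
    define p where "p = pivot V W \<eta> t N * exp (- t N)"
    have "p > 0" using pp by (simp add: p_def)
    moreover have "det_on (insert N V) (dmat (insert N V) W \<eta> t) =
      p * exp (2 * t N) * det_on V (dmat V (elim_weight W N p) (elim_field W \<eta> N p) t)"
      using insert.hyps admissible_insertD[OF insert.prems] pp by (intro dmat_elim) (auto simp: p_def)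
    moreover have "det_on V (dmat V (elim_weight W N p) (elim_field W \<eta> N p) t) > 0"
      using insert.IH admissible_elim[OF insert.prems \<open>p > 0\<close>] by blast
    ultimately show ?case by simp
  qed
qed

subsection \<open>Integration lemmas\<close>

abbreviation lborel_Pi :: "'a set \<Rightarrow> ('a \<Rightarrow> real) measure" where
  "lborel_Pi K \<equiv> PiM K (\<lambda>_. lborel)"

lemma product_sigma_finite_lborel: "product_sigma_finite (\<lambda>_. lborel :: real measure)"
  by unfold_locales

lemma measurable_coord [measurable (raw)]:
  assumes "k \<in> K"
  shows "(\<lambda>\<phi>. \<phi> k) \<in> borel_measurable (lborel_Pi K)"
  using measurable_component_singleton[OF assms, of "\<lambda>_. lborel :: real measure"] by simp

text \<open>The integral of \<open>g (x + u)\<close> over \<open>u\<close> in the unit interval is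
  \<open>G (x + 1) - G x\<close>. Integrating over \<open>x\<close> as well and exchanging the order
  gives the integral of \<open>g\<close> on one side, by translation invariance, and 0 on the other.
  Thus integrability of \<open>G\<close> replaces any check of its decay at infinity.\<close>

lemma integral_deriv_eq_0:
  fixes G g :: "real \<Rightarrow> real"
  assumes deriv: "\<And>x. (G has_real_derivative g x) (at x)" and cont: "\<And>x. isCont g x"
    and G: "integrable lborel G" and g: "integrable lborel g"
  shows "integral\<^sup>L lborel g = 0"
proof -
  let ?f = "\<lambda>x u. indicator {0..1} u * g (x + u) :: real"
  have gm [measurable]: "g \<in> borel_measurable borel" using g by simp
  have gu: "integrable lborel (\<lambda>x. g (x + u))" "(LBINT x. g (x + u)) = integral\<^sup>L lborel g" 
    "(LBINT x. norm (g (x + u))) = (LBINT x. norm (g x))" for u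
  proof -
    show "integrable lborel (\<lambda>x. g (x + u))"
      using lborel_integrable_real_affine[OF g, of 1 u] by (simp add: add.commute)
    show "(LBINT x. g (x + u)) = integral\<^sup>L lborel g"
      using lborel_integral_real_affine[of 1 g u] by (simp add: add.commute)
    show "(LBINT x. norm (g (x + u))) = (LBINT x. norm (g x))"
      using lborel_integral_real_affine[of 1 "\<lambda>x. norm (g x)" u] by (simp add: add.commute)
  qed
  have Gu: "integrable lborel (\<lambda>x. G (x + 1))" "(LBINT x. G (x + 1)) = integral\<^sup>L lborel G"
    using lborel_integrable_real_affine[OF G, of 1 1] lborel_integral_real_affine[of 1 G 1] by (simp_all add: add.commute)
  have int: "integrable (lborel \<Otimes>\<^sub>M lborel) (\<lambda>(u, x). ?f x u)"
  proof (rule lborel_pair.Fubini_integrable)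
    show "(\<lambda>(u, x). ?f x u) \<in> borel_measurable (lborel \<Otimes>\<^sub>M lborel)" by measurable
    have "(\<lambda>u. LBINT x. norm (case (u, x) of (u, x) \<Rightarrow> ?f x u)) = (\<lambda>u. indicator {0..1} u * (LBINT x. norm (g x)))"
      by (intro ext) (auto simp: abs_mult gu(3)[simplified] split: split_indicator)
    then show "integrable lborel (\<lambda>u. LBINT x. norm (case (u, x) of (u, x) \<Rightarrow> ?f x u))"
      by simp
    show "AE u in lborel. integrable lborel (\<lambda>x. case (u, x) of (u, x) \<Rightarrow> ?f x u)"
      using gu(1) by simp
  qed
  have "(LBINT x. LBINT u. ?f x u) = (LBINT u. LBINT x. ?f x u)"
    using lborel_pair.Fubini_integral[OF int] by simp
  also have "\<dots> = integral\<^sup>L lborel g"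
    by (simp add: gu(2))
  finally have 1: "integral\<^sup>L lborel g = (LBINT x. LBINT u. ?f x u)" by simp
  have "(LBINT u. ?f x u) = G (x + 1) - G x" for x
  proof -
    have "(LBINT u. g (x + u) * indicator {0..1} u) = G (x + 1) - G (x + 0)"
    proof (rule integral_FTC_Icc_real)
      show "((\<lambda>u. G (x + u)) has_real_derivative g (x + u)) (at u)" for u
        using DERIV_chain2[where f=G and g="\<lambda>u. x + u" and x=u, OF deriv DERIV_cong[OF DERIV_add[OF DERIV_const DERIV_ident]]]
        by simp
      show "isCont (\<lambda>u. g (x + u)) u" for u
        by (intro isCont_o2[OF _ cont] continuous_intros)
    qed simp
    then show ?thesis by (simp add: mult.commute)
  qed
  then have "(LBINT x. LBINT u. ?f x u) = (LBINT x. G (x + 1) - G x)" by simp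
  also have "\<dots> = 0" using Gu G by simp
  finally show ?thesis using 1 by simp
qed

lemma PiM_integral_deriv_eq_0:
  fixes F G :: "('a \<Rightarrow> real) \<Rightarrow> real"
  assumes K: "finite K" "k \<in> K"
    and G: "integrable (lborel_Pi K) G" and F: "integrable (lborel_Pi K) F"
    and deriv: "\<And>\<phi> x. ((\<lambda>x. G (\<phi>(k := x))) has_real_derivative F (\<phi>(k := x))) (at x)"
    and cont: "\<And>\<phi> x. isCont (\<lambda>x. F (\<phi>(k := x))) x"
  shows "(\<integral>\<phi>. F \<phi> \<partial>lborel_Pi K) = 0"
proof -
  interpret product_sigma_finite "\<lambda>_. lborel :: real measure" by (rule product_sigma_finite_lborel)
  define J where "J = K - {k}"
  have J: "finite J" "k \<notin> J" and KJ: "K = insert k J" using K by (auto simp: J_def)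
  \<comment> \<open>By Tonelli almost every line parallel to the \<open>k\<close> axis carries an
    integrable section, and this is applied to \<open>G\<close> and \<open>F\<close> together before
    the one-dimensional lemma is used on each such line.\<close>
  have sect: "AE \<phi> in lborel_Pi J. integrable lborel (\<lambda>x. H (\<phi>(k := x)))"
    if H: "integrable (lborel_Pi K) H" for H :: "('a \<Rightarrow> real) \<Rightarrow> real"
  proof -
    have m: "H \<in> borel_measurable (lborel_Pi (insert k J))" using H KJ by auto
    then have m': "(\<lambda>\<phi>. ennreal (norm (H \<phi>))) \<in> borel_measurable (lborel_Pi (insert k J))" by measurable
    have "(\<integral>\<^sup>+\<phi>. (\<integral>\<^sup>+x. ennreal (norm (H (\<phi>(k := x)))) \<partial>lborel) \<partial>lborel_Pi J) = (\<integral>\<^sup>+\<phi>. ennreal (norm (H \<phi>)) \<partial>lborel_Pi (insert k J))"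
      by (rule product_nn_integral_insert[OF J m', symmetric])
    also have "\<dots> < \<infinity>" using H unfolding KJ integrable_iff_bounded by simp
    finally have fin: "(\<integral>\<^sup>+\<phi>. (\<integral>\<^sup>+x. ennreal (norm (H (\<phi>(k := x)))) \<partial>lborel) \<partial>lborel_Pi J) \<noteq> \<infinity>" by simp
    have "AE \<phi> in lborel_Pi J. (\<integral>\<^sup>+x. ennreal (norm (H (\<phi>(k := x)))) \<partial>lborel) \<noteq> \<infinity>"
    proof (rule nn_integral_PInf_AE[OF _ fin])
      have "(\<lambda>(\<phi>, x). \<phi>(k := x)) \<in> lborel_Pi J \<Otimes>\<^sub>M lborel \<rightarrow>\<^sub>M lborel_Pi (insert k J)"
        by (rule measurable_add_dim)
      note [measurable] = measurable_compose[OF this m', unfolded split_beta']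
      show "(\<lambda>\<phi>. \<integral>\<^sup>+x. ennreal (norm (H (\<phi>(k := x)))) \<partial>lborel) \<in> borel_measurable (lborel_Pi J)"
          by measurable
    qed
    then show ?thesis
    proof (rule AE_mp, intro AE_I2 impI)
      fix \<phi> assume \<phi>: "\<phi> \<in> space (lborel_Pi J)" and f: "(\<integral>\<^sup>+x. ennreal (norm (H (\<phi>(k := x)))) \<partial>lborel) \<noteq> \<infinity>"
      have "(\<lambda>x. H (\<phi>(k := x))) \<in> borel_measurable lborel"
        using measurable_comp[OF measurable_component_update m, OF \<phi> J(2)] by (simp add: comp_def fun_upd_def)
      then show "integrable lborel (\<lambda>x. H (\<phi>(k := x)))"
        using f unfolding integrable_iff_bounded by (simp add: less_top)
    qed
  qed
  have "(\<integral>\<phi>. F \<phi> \<partial>lborel_Pi K) = (\<integral>\<phi>. (LBINT x. F (\<phi>(k := x))) \<partial>lborel_Pi J)"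
    unfolding KJ by (rule product_integral_insert[OF J]) (use F KJ in simp)
  also have "\<dots> = 0"
  proof (rule integral_eq_zero_AE)
    show "AE \<phi> in lborel_Pi J. (LBINT x. F (\<phi>(k := x))) = 0"
      using sect[OF G] sect[OF F]
    proof eventually_elim
      case (elim \<phi>)
      show ?case by (rule integral_deriv_eq_0[OF deriv cont elim])
    qed
  qed
  finally show ?thesis .
qed

lemma integrable_inverse_1_plus_square_lborel: "integrable lborel (\<lambda>x::real. inverse (1 + x\<^sup>2))"
  using integrable_inverse_1_plus_square by (simp add: set_integrable_def)

text \<open>The dominating function is a constant times a product of Cauchy densities, one for each
  coordinate.\<close>

lemma PiM_integrable_bound:
  fixes F :: "('a \<Rightarrow> real) \<Rightarrow> real"
  assumes K: "finite K" and F: "F \<in> borel_measurable (lborel_Pi K)"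
    and b: "\<And>\<phi>. \<bar>F \<phi>\<bar> * (\<Prod>k\<in>K. 1 + (\<phi> k)\<^sup>2) \<le> C"
  shows "integrable (lborel_Pi K) F"
proof -
  interpret product_sigma_finite "\<lambda>_. lborel :: real measure" by (rule product_sigma_finite_lborel)
  have "integrable (lborel_Pi K) (\<lambda>\<phi>. C * (\<Prod>k\<in>K. inverse (1 + (\<phi> k)\<^sup>2)))"
    by (intro integrable_mult_right product_integrable_prod K integrable_inverse_1_plus_square_lborel)
  then show ?thesis
  proof (rule Bochner_Integration.integrable_bound[OF _ F], intro AE_I2)
    fix \<phi> :: "'a \<Rightarrow> real"
    have p: "(\<Prod>k\<in>K. 1 + (\<phi> k)\<^sup>2) > 0" by (intro prod_pos) (auto intro: add_pos_nonneg)
    have "\<bar>F \<phi>\<bar> \<le> C / (\<Prod>k\<in>K. 1 + (\<phi> k)\<^sup>2)"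
      using b[of \<phi>] p by (simp add: pos_le_divide_eq)
    also have "\<dots> = C * (\<Prod>k\<in>K. inverse (1 + (\<phi> k)\<^sup>2))"
      using prod_inversef[of "\<lambda>k. 1 + (\<phi> k)\<^sup>2" K] by (simp add: o_def divide_inverse del: inverse_eq_divide)
    finally show "norm (F \<phi>) \<le> norm (C * (\<Prod>k\<in>K. inverse (1 + (\<phi> k)\<^sup>2)))" by simp
  qed
qed

text \<open>A single term of the exponential series, \<open>(c * x)^m / m!\<close>, is at most
  \<open>e^(c x)\<close>; this gives the constant \<open>m! / c^m\<close>.\<close>

lemma power_exp_bound:
  fixes c :: real
  assumes "c > 0"
  obtains B where "B > 0" "\<And>x. x \<ge> 0 \<Longrightarrow> x ^ m * exp (- c * x) \<le> B"
proof
  show "fact m / c ^ m > (0::real)" using assms by simp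
  fix x :: real assume x: "x \<ge> 0"
  have "(\<lambda>n. (c * x) ^ n / fact n) sums exp (c * x)"
    using exp_converges[of "c * x"] by (simp add: divide_inverse mult.commute)
  then have "(\<Sum>n<Suc m. (c * x) ^ n / fact n) \<le> exp (c * x)"
  proof -
    assume s: "(\<lambda>n. (c * x) ^ n / fact n) sums exp (c * x)"
    have "(\<Sum>n<Suc m. (c * x) ^ n / fact n) \<le> (\<Sum>n. (c * x) ^ n / fact n)"
      using s x assms by (intro sum_le_suminf) (auto dest: sums_summable)
    then show ?thesis using sums_unique[OF s] by simp
  qed
  moreover have "(c * x) ^ m / fact m \<le> (\<Sum>n<Suc m. (c * x) ^ n / fact n)"
    using x assms by (intro member_le_sum[where f="\<lambda>n. (c * x) ^ n / fact n"]) auto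
  ultimately have "(c * x) ^ m / fact m \<le> exp (c * x)" by linarith
  then have "c ^ m * x ^ m \<le> fact m * exp (c * x)" by (simp add: field_simps power_mult_distrib)
  then show "x ^ m * exp (- c * x) \<le> fact m / c ^ m"
    using assms by (simp add: exp_minus field_simps)
qed

section \<open>Gaussian integrals and Bessel integrals of half-integer order\<close>

text \<open>The second formula is for a squared linear functional of the field, integrated over one
  coordinate: \<open>a\<close> is the coefficient of that coordinate and \<open>b\<close> the
  contribution of the others. It is the variance \<open>a^2 / P\<close> plus the square of the mean
  \<open>a * m + b\<close>.\<close>

lemma nn_integral_gauss:
  assumes P: "P > 0"
  shows "(\<integral>\<^sup>+x. ennreal (exp (- (P * (x - m)\<^sup>2) / 2)) \<partial>lborel) = ennreal (sqrt (2 * pi / P))"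
    and "(\<integral>\<^sup>+x. ennreal ((a * x + b)\<^sup>2 * exp (- (P * (x - m)\<^sup>2) / 2)) \<partial>lborel) = ennreal (sqrt (2 * pi / P) * (a\<^sup>2 / P + (a * m + b)\<^sup>2))"
proof -
  define \<sigma> where "\<sigma> = 1 / sqrt P"
  have \<sigma>: "\<sigma> > 0" "\<sigma>\<^sup>2 = 1 / P" using P by (auto simp: \<sigma>_def power_divide)
  have nd: "exp (- (P * (x - m)\<^sup>2) / 2) = sqrt (2 * pi / P) * normal_density m \<sigma> x" for x
    using P unfolding normal_density_def \<sigma>(2) by (simp add: real_sqrt_divide real_sqrt_mult)
  show "(\<integral>\<^sup>+x. ennreal (exp (- (P * (x - m)\<^sup>2) / 2)) \<partial>lborel) = ennreal (sqrt (2 * pi / P))"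
    unfolding nd using \<sigma> P by (subst nn_integral_eq_integral) auto
  have e: "(a * x + b)\<^sup>2 = a\<^sup>2 * (x - m)^2 + 2 * a * (a * m + b) * (x - m) + (a * m + b)\<^sup>2" for x
    by (simp add: power2_eq_square algebra_simps)
  have "has_bochner_integral lborel (\<lambda>x. normal_density m \<sigma> x * (x - m) ^ 2) (1 / P)"
    using normal_moment_even[OF \<sigma>(1), of m 1] P \<sigma>(2) by simp
  moreover have "has_bochner_integral lborel (\<lambda>x. normal_density m \<sigma> x * (x - m)) 0"
    using normal_moment_odd[OF \<sigma>(1), of m 0] by simp
  moreover have "has_bochner_integral lborel (normal_density m \<sigma>) 1"
    using \<sigma>(1) by (simp add: has_bochner_integral_iff)
  ultimately have "has_bochner_integral lborel (\<lambda>x. a\<^sup>2 * (normal_density m \<sigma> x * (x - m) ^ 2) + 2 * a * (a * m + b) * (normal_density m \<sigma> x * (x - m)) + (a * m + b)\<^sup>2 * normal_density m \<sigma> x) (a\<^sup>2 * (1 / P) + 2 * a * (a * m + b) * 0 + (a * m + b)\<^sup>2 * 1)"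
    by (intro has_bochner_integral_add has_bochner_integral_mult_right)
  note * = has_bochner_integral_mult_right[OF this, of "sqrt (2 * pi / P)"]
  have H: "has_bochner_integral lborel (\<lambda>x. (a * x + b)\<^sup>2 * exp (- (P * (x - m)\<^sup>2) / 2)) (sqrt (2 * pi / P) * (a\<^sup>2 / P + (a * m + b)\<^sup>2))"
  proof -
    have poly: "(A * d\<^sup>2 + B * d + C) * (s * n) = s * (A * (n * d ^ 2) + B * (n * d) + C * n)" for A B C d s n :: real
      by (simp add: distrib_left distrib_right mult_ac)
    have fe: "(a * x + b)\<^sup>2 * exp (- (P * (x - m)\<^sup>2) / 2) = sqrt (2 * pi / P) * (a\<^sup>2 * (normal_density m \<sigma> x * (x - m) ^ 2) + 2 * a * (a * m + b) * (normal_density m \<sigma> x * (x - m)) + (a * m + b)\<^sup>2 * normal_density m \<sigma> x)" for x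
      unfolding nd e[of x] by (rule poly)
    show ?thesis unfolding fe using * by (simp only: mult_zero_right mult_1_right add_0_right times_divide_eq_right)
  qed
  then show "(\<integral>\<^sup>+x. ennreal ((a * x + b)\<^sup>2 * exp (- (P * (x - m)\<^sup>2) / 2)) \<partial>lborel) = ennreal (sqrt (2 * pi / P) * (a\<^sup>2 / P + (a * m + b)\<^sup>2))"
    by (subst nn_integral_eq_integral) (auto simp: has_bochner_integral_iff)
qed

text \<open>This is \<open>2 * e^\<eta>\<close> times the modified Bessel function of the second
  kind of order \<open>q\<close>, evaluated at \<open>\<eta>\<close>.\<close>

definition cosh_integral :: "real \<Rightarrow> real \<Rightarrow> ennreal" where
  "cosh_integral \<eta> q = (\<integral>\<^sup>+t. ennreal (exp (q * t) * exp (- \<eta> * (cosh t - 1))) \<partial>lborel)"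

lemma cosh_integral_integrable:
  fixes \<eta> q :: real
  assumes "\<eta> > 0"
  shows "integrable lborel (\<lambda>t. exp (q * t) * exp (- \<eta> * (cosh t - 1)))"
proof -
  obtain m :: nat where m: "\<bar>q\<bar> \<le> real m" using real_arch_simple by blast
  \<comment> \<open>With \<open>y = e^\<bar>t\<bar>\<close>, the factor \<open>e^(q t)\<close> costs
    the power \<open>m\<close> and the bound \<open>1 + t^2 \<le> y^2\<close> costs two more. The
    rate \<open>\<eta> / 2\<close> comes from \<open>cosh t \<ge> y / 2\<close>.\<close>
  obtain B where B: "B > 0" "\<And>x. x \<ge> 0 \<Longrightarrow> x ^ (m + 2) * exp (- (\<eta>/2) * x) \<le> B"
    using power_exp_bound[of "\<eta>/2" "m+2"] assms by auto
  have "integrable lborel (\<lambda>t. (3 * exp \<eta> * B) * inverse (1 + t\<^sup>2))"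
    by (intro integrable_mult_right integrable_inverse_1_plus_square_lborel)
  then show ?thesis
  proof (rule Bochner_Integration.integrable_bound, goal_cases)
    case 2
    show ?case
    proof (intro AE_I2)
      fix t :: real
      define y where "y = exp \<bar>t\<bar>"
      have y: "y \<ge> 1" by (simp add: y_def)
      have "q * t \<le> \<bar>q\<bar> * \<bar>t\<bar>" by (metis abs_ge_self abs_mult)
      also have "\<dots> \<le> real m * \<bar>t\<bar>" using m by (intro mult_right_mono) auto
      finally have 1: "exp (q * t) \<le> y ^ m" by (simp add: y_def exp_of_nat_mult[symmetric])
      have "y \<le> exp t + exp (- t)" by (cases "t \<ge> 0") (auto simp: y_def)
      then have "y / 2 \<le> cosh t" by (simp add: cosh_field_def)
      then have "\<eta> * (y / 2) \<le> \<eta> * cosh t" using assms by (intro mult_left_mono) auto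
      then have 2: "exp (- \<eta> * (cosh t - 1)) \<le> exp \<eta> * exp (- (\<eta>/2) * y)"
        by (simp add: exp_add[symmetric] algebra_simps)
      have "1 + \<bar>t\<bar> \<le> y" using exp_ge_add_one_self[of "\<bar>t\<bar>"] by (simp add: y_def)
      then have "(1 + \<bar>t\<bar>)\<^sup>2 \<le> y\<^sup>2" by (intro power_mono) auto
      then have 3: "1 + t\<^sup>2 \<le> y\<^sup>2" by (simp add: power2_eq_square algebra_simps)
      have "(exp (q * t) * exp (- \<eta> * (cosh t - 1))) * (1 + t\<^sup>2) \<le> (y ^ m * (exp \<eta> * exp (- (\<eta>/2) * y))) * y\<^sup>2"
        by (intro mult_mono 1 2 3) (use y in auto)
      also have "\<dots> = exp \<eta> * (y ^ (m + 2) * exp (- (\<eta>/2) * y))" by (simp add: power_add power2_eq_square)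
      also have "\<dots> \<le> exp \<eta> * B" using B(2)[of y] y by (intro mult_left_mono) auto
      also have "\<dots> \<le> 3 * exp \<eta> * B" using B(1) by simp
      finally have "exp (q * t) * exp (- \<eta> * (cosh t - 1)) \<le> (3 * exp \<eta> * B) / (1 + t\<^sup>2)"
        by (subst pos_le_divide_eq) (auto intro: add_pos_nonneg)
      then show "norm (exp (q * t) * exp (- \<eta> * (cosh t - 1))) \<le> norm ((3 * exp \<eta> * B) * inverse (1 + t\<^sup>2))"
        using B(1) by (simp add: divide_inverse abs_mult)
    qed
  qed (simp add: cosh_field_def)
qed

lemma cosh_integral_eq:
  assumes "\<eta> > 0"
  shows "cosh_integral \<eta> q = ennreal (LBINT t. exp (q * t) * exp (- \<eta> * (cosh t - 1)))"
  unfolding cosh_integral_def by (rule nn_integral_eq_integral[OF cosh_integral_integrable[OF assms]]) simp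

lemma cosh_integral_uminus: "cosh_integral \<eta> (- q) = cosh_integral \<eta> q"
  unfolding cosh_integral_def
  by (subst nn_integral_real_affine[where c="-1" and t=0]) (auto simp: cosh_field_def add.commute)

text \<open>Since \<open>cosh t - 1 = 2 sinh(t/2)^2\<close>, the substitution
  \<open>u = 2 sqrt(\<eta>) sinh(t/2)\<close> turns \<open>e^(-u^2/2) du\<close> into
  \<open>sqrt(\<eta>) cosh(t/2) e^(-\<eta> (cosh t - 1)) dt\<close>. The right-hand side averages
  the orders 1/2 and -1/2, whose integrals agree by reflection, so the value follows from the
  Gaussian integral.\<close>

lemma cosh_integral_half:
  assumes \<eta>: "\<eta> > 0"
  shows "cosh_integral \<eta> (1/2) = ennreal (sqrt (2 * pi / \<eta>))"
proof -
  define g where "g t = 2 * sqrt \<eta> * sinh (t / 2)" for t :: real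
  define g' where "g' t = sqrt \<eta> * cosh (t / 2)" for t :: real
  let ?f = "\<lambda>u::real. exp (- (1 * (u - 0)\<^sup>2) / 2)"
  have c: "cosh t - 1 = 2 * (sinh (t / 2))\<^sup>2" for t :: real
    using cosh_double[of "t/2"] cosh_square_eq[of "t/2"] by simp
  have fg: "?f (g t) * g' t = sqrt \<eta> / 2 * (exp (1/2 * t) * exp (- \<eta> * (cosh t - 1)) + exp (- (1/2) * t) * exp (- \<eta> * (cosh t - 1)))" for t
  proof -
    have "(g t)\<^sup>2 / 2 = \<eta> * (cosh t - 1)" using \<eta> unfolding g_def c by (simp add: power_mult_distrib)
    then have "?f (g t) = exp (- \<eta> * (cosh t - 1))" by simp
    then show ?thesis unfolding g'_def by (simp add: cosh_field_def[of "t/2"] algebra_simps)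
  qed
  have int: "integrable lborel (\<lambda>t. ?f (g t) * g' t)"
    unfolding fg by (intro integrable_mult_right Bochner_Integration.integrable_add cosh_integral_integrable \<eta>)
  have t: "filterlim g at_top at_top" "filterlim g at_bot at_bot"
  proof -
    have s: "filterlim (\<lambda>t::real. sinh (t / 2)) at_top at_top"
    proof -
      have "filterlim (\<lambda>t::real. 1/2 * t) at_top at_top"
        by (rule filterlim_tendsto_pos_mult_at_top[OF tendsto_const _ filterlim_ident]) simp
      from filterlim_compose[OF sinh_real_at_top this] show ?thesis by simp
    qed
    have "filterlim (\<lambda>t. 2 * sqrt \<eta> * sinh (t / 2)) at_top at_top"
      by (rule filterlim_tendsto_pos_mult_at_top[OF tendsto_const _ s]) (use \<eta> in auto)
    then show 1: "filterlim g at_top at_top" unfolding g_def[abs_def] .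
    have "(\<lambda>t. - g (- t)) = g" by (auto simp: g_def)
    then have "filterlim (\<lambda>t. - g (- t)) at_top at_top" using 1 by simp
    then have "filterlim (\<lambda>t. g (- t)) at_bot at_top" by (simp add: filterlim_uminus_at_bot)
    then show "filterlim g at_bot at_bot" by (simp add: filterlim_at_bot_mirror)
  qed
  have "(LBINT x=-\<infinity>..\<infinity>. ?f x) = (LBINT t=-\<infinity>..\<infinity>. ?f (g t) * g' t)"
  proof (rule interval_integral_substitution_nonneg(2))
    show "DERIV g t :> g' t" for t
      unfolding g_def g'_def by (auto intro!: derivative_eq_intros)
    show "isCont g' t" for t unfolding g'_def by (intro continuous_intros) auto
    show "0 \<le> g' t" for t using \<eta> by (simp add: g'_def)
    show "((ereal \<circ> g \<circ> real_of_ereal) \<longlongrightarrow> - \<infinity>) (at_right (- \<infinity>))"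
      using t(2) by (simp add: ereal_tendsto_simps)
    show "((ereal \<circ> g \<circ> real_of_ereal) \<longlongrightarrow> \<infinity>) (at_left \<infinity>)"
      using t(1) by (simp add: ereal_tendsto_simps)
    show "set_integrable lborel (einterval (- \<infinity>) \<infinity>) (\<lambda>t. ?f (g t) * g' t)"
      using int by (simp add: set_integrable_def)
  qed auto
  then have "(LBINT x. ?f x) = (LBINT t. ?f (g t) * g' t)"
    by (simp add: interval_lebesgue_integral_def set_lebesgue_integral_def)
  moreover have "(LBINT x. ?f x) = sqrt (2 * pi)"
  proof -
    have "ennreal (LBINT x. ?f x) = (\<integral>\<^sup>+x. ennreal (?f x) \<partial>lborel)"
    proof (rule nn_integral_eq_integral[symmetric])
      show "integrable lborel ?f"
        by (rule integrableI_bounded) (use nn_integral_gauss(1)[of 1 0] in simp_all)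
    qed simp
    also have "\<dots> = ennreal (sqrt (2 * pi))" using nn_integral_gauss(1)[of 1 0] by simp
    finally show ?thesis by (simp add: integral_nonneg_AE)
  qed
  moreover have "has_bochner_integral lborel (\<lambda>t. ?f (g t) * g' t) (sqrt \<eta> / 2 * ((LBINT t. exp (1/2 * t) * exp (- \<eta> * (cosh t - 1))) + (LBINT t. exp (- (1/2) * t) * exp (- \<eta> * (cosh t - 1)))))"
    unfolding fg by (intro has_bochner_integral_add has_bochner_integral_mult_right has_bochner_integral_integrable cosh_integral_integrable \<eta>)
  ultimately have "sqrt (2 * pi) = sqrt \<eta> / 2 * ((LBINT t. exp (1/2 * t) * exp (- \<eta> * (cosh t - 1))) + (LBINT t. exp (- (1/2) * t) * exp (- \<eta> * (cosh t - 1))))"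
    by (auto simp only: dest!: has_bochner_integral_integral_eq)
  moreover have "(LBINT t. exp (- (1/2) * t) * exp (- \<eta> * (cosh t - 1))) = (LBINT t. exp (1/2 * t) * exp (- \<eta> * (cosh t - 1)))"
    using cosh_integral_uminus[of \<eta> "1/2"] unfolding cosh_integral_eq[OF \<eta>] by (subst (asm) ennreal_inj) (auto intro!: integral_nonneg_AE)
  ultimately have "(LBINT t. exp (1/2 * t) * exp (- \<eta> * (cosh t - 1))) = sqrt (2 * pi) / sqrt \<eta>"
    using \<eta> by (simp add: field_simps)
  then show ?thesis unfolding cosh_integral_eq[OF \<eta>] by (simp add: real_sqrt_divide)
qed

text \<open>The Bessel recurrence between orders 3/2, 1/2 and -1/2, obtained by integrating the
  derivative of \<open>e^(t/2) * e^(-\<eta> (cosh t - 1))\<close> over the line.\<close>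

lemma cosh_integral_three_halves:
  assumes \<eta>: "\<eta> > 0"
  shows "cosh_integral \<eta> (3/2) = ennreal (sqrt (2 * pi / \<eta>) * (1 + 1 / \<eta>))"
proof -
  let ?b = "\<lambda>q t. exp (q * t) * exp (- \<eta> * (cosh t - 1)) :: real"
  let ?I = "\<lambda>q. LBINT t. ?b q t"
  have 1: "?I (1/2) = sqrt (2 * pi / \<eta>)" "?I (-(1/2)) = sqrt (2 * pi / \<eta>)"
    using cosh_integral_half[OF \<eta>] cosh_integral_uminus[of \<eta> "1/2"] unfolding cosh_integral_eq[OF \<eta>] using \<eta>
    by (auto simp: integral_nonneg_AE)
  have "(LBINT t. 1/2 * ?b (1/2) t - \<eta>/2 * (?b (3/2) t - ?b (-(1/2)) t)) = 0"
  proof (rule integral_deriv_eq_0)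
    fix t :: real
    have "sinh t * exp (1/2 * t) = (exp (3/2 * t) - exp (-(1/2) * t)) / 2"
      by (simp add: sinh_field_def left_diff_distrib exp_add[symmetric])
    then have "\<eta>/2 * (exp (3/2 * t) - exp (-(1/2) * t)) * exp (- \<eta> * (cosh t - 1)) = \<eta> * (sinh t * exp (1/2 * t)) * exp (- \<eta> * (cosh t - 1))"
      by simp
    then have "\<eta>/2 * (?b (3/2) t - ?b (-(1/2)) t) = \<eta> * (sinh t * exp (1/2 * t)) * exp (- \<eta> * (cosh t - 1))"
      by (simp only: left_diff_distrib mult.assoc)
    then show "(?b (1/2) has_real_derivative 1/2 * ?b (1/2) t - \<eta>/2 * (?b (3/2) t - ?b (-(1/2)) t)) (at t)"
      by (auto intro!: derivative_eq_intros simp: algebra_simps)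
    show "isCont (\<lambda>t. 1/2 * ?b (1/2) t - \<eta>/2 * (?b (3/2) t - ?b (-(1/2)) t)) t"
      by (intro continuous_intros)
  qed (intro Bochner_Integration.integrable_diff integrable_mult_right cosh_integral_integrable \<eta>)+
  moreover have "has_bochner_integral lborel (\<lambda>t. 1/2 * ?b (1/2) t - \<eta>/2 * (?b (3/2) t - ?b (-(1/2)) t)) (1/2 * ?I (1/2) - \<eta>/2 * (?I (3/2) - ?I (-(1/2))))"
    by (intro has_bochner_integral_diff has_bochner_integral_mult_right has_bochner_integral_integrable cosh_integral_integrable \<eta>)
  ultimately have "1/2 * ?I (1/2) - \<eta>/2 * (?I (3/2) - ?I (-(1/2))) = 0"
    by (auto simp only: dest!: has_bochner_integral_integral_eq)
  then have "?I (3/2) = sqrt (2 * pi / \<eta>) * (1 + 1 / \<eta>)"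
    unfolding 1 using \<eta> by (simp add: field_simps)
  then show ?thesis unfolding cosh_integral_eq[OF \<eta>] by simp
qed

subsection \<open>Horospherical weights\<close>

text \<open>The density \<open>e\<^sup>-\<^sup>H\<close> in horospherical coordinates. The Gaussian exponent carries the factor \<open>1/2\<close>,
  since \<open>quad_form\<close> is \<open>(s, D(t) s)\<close>.\<close>

definition horo_weight :: "'a set \<Rightarrow> ('a \<Rightarrow> 'a \<Rightarrow> real) \<Rightarrow> ('a \<Rightarrow> real) \<Rightarrow> ('a \<Rightarrow> real) \<Rightarrow> ('a \<Rightarrow> real) \<Rightarrow> real" where
  "horo_weight I W \<eta> t s = exp (- energy I W \<eta> t) * exp (- quad_form I W \<eta> t s / 2) * (\<Prod>i\<in>I. exp (- t i))
     * det_on I (dmat I W \<eta> t) / (2 * pi) ^ card I"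

lemma horo_weight_cong:
  assumes "\<And>i. i \<in> I \<Longrightarrow> t i = t' i" "\<And>i. i \<in> I \<Longrightarrow> s i = s' i"
  shows "horo_weight I W \<eta> t s = horo_weight I W \<eta> t' s'"
  unfolding horo_weight_def using assms
  by (simp add: energy_cong[of I t t'] quad_form_cong[of I t t' s s'] det_dmat_cong[of I t t'] cong: prod.cong)

lemma horo_weight_pos: "admissible I W \<eta> \<Longrightarrow> horo_weight I W \<eta> t s > 0"
  unfolding horo_weight_def by (intro divide_pos_pos mult_pos_pos prod_pos det_dmat_pos) auto

lemma measurable_dmat:
  assumes "\<And>i. i \<in> I \<Longrightarrow> (\<lambda>x. T x i) \<in> borel_measurable M"
    and "\<And>i j. i \<in> I \<Longrightarrow> j \<in> I \<Longrightarrow> (\<lambda>x. W x i j) \<in> borel_measurable M"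
    and "\<And>i. i \<in> I \<Longrightarrow> (\<lambda>x. \<eta> x i) \<in> borel_measurable M" and ij: "i \<in> I" "j \<in> I"
  shows "(\<lambda>x. dmat I (W x) (\<eta> x) (T x) i j) \<in> borel_measurable M"
proof (cases "i = j")
  case True
  note [measurable] = assms(1)[OF ij(1)] assms(3)[OF ij(1)]
  have "(\<lambda>x. \<Sum>k\<in>I - {i}. W x i k * exp (T x i + T x k)) \<in> borel_measurable M"
  proof (rule borel_measurable_sum)
    fix k assume "k \<in> I - {i}"
    then have k: "k \<in> I" by simp
    note [measurable] = assms(1)[OF k] assms(2)[OF ij(1) k]
    show "(\<lambda>x. W x i k * exp (T x i + T x k)) \<in> borel_measurable M" by measurable
  qed
  then have "(\<lambda>x. (\<Sum>k\<in>I - {i}. W x i k * exp (T x i + T x k)) + \<eta> x i * exp (T x i)) \<in> borel_measurable M"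
    by measurable
  then show ?thesis using True unfolding dmat_def by simp
next
  case False
  note [measurable] = assms(1)[OF ij(1)] assms(1)[OF ij(2)] assms(2)[OF ij]
  have "(\<lambda>x. - W x i j * exp (T x i + T x j)) \<in> borel_measurable M" by measurable
  then show ?thesis using False unfolding dmat_def by simp
qed

lemma measurable_quad_form:
  assumes "\<And>i. i \<in> I \<Longrightarrow> (\<lambda>x. T x i) \<in> borel_measurable M"
    and "\<And>i. i \<in> I \<Longrightarrow> (\<lambda>x. S x i) \<in> borel_measurable M"
    and "\<And>i j. i \<in> I \<Longrightarrow> j \<in> I \<Longrightarrow> (\<lambda>x. W x i j) \<in> borel_measurable M"
    and "\<And>i. i \<in> I \<Longrightarrow> (\<lambda>x. \<eta> x i) \<in> borel_measurable M"
  shows "(\<lambda>x. quad_form I (W x) (\<eta> x) (T x) (S x)) \<in> borel_measurable M"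
  unfolding quad_form_def
  by (intro borel_measurable_add borel_measurable_times borel_measurable_sum borel_measurable_const
      borel_measurable_power borel_measurable_diff borel_measurable_exp[THEN measurable_compose[rotated]] assms)

text \<open>The weights and the field may vary with \<open>x\<close>, because after an elimination
  they depend on the pivot, which is itself an integration variable.\<close>

lemma measurable_horo_weight:
  assumes T: "\<And>i. i \<in> I \<Longrightarrow> (\<lambda>x. T x i) \<in> borel_measurable M"
    and S: "\<And>i. i \<in> I \<Longrightarrow> (\<lambda>x. S x i) \<in> borel_measurable M"
    and W: "\<And>i j. i \<in> I \<Longrightarrow> j \<in> I \<Longrightarrow> (\<lambda>x. W x i j) \<in> borel_measurable M"
    and H: "\<And>i. i \<in> I \<Longrightarrow> (\<lambda>x. \<eta> x i) \<in> borel_measurable M"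
  shows "(\<lambda>x. horo_weight I (W x) (\<eta> x) (T x) (S x)) \<in> borel_measurable M"
proof -
  have [measurable]: "(\<lambda>x. quad_form I (W x) (\<eta> x) (T x) (S x)) \<in> borel_measurable M"
    by (rule measurable_quad_form[OF T S W H])
  have [measurable]: "(\<lambda>x. energy I (W x) (\<eta> x) (T x)) \<in> borel_measurable M"
    unfolding energy_def cosh_field_def
    by (intro borel_measurable_add borel_measurable_times borel_measurable_sum borel_measurable_const borel_measurable_divide borel_measurable_uminus
      borel_measurable_power borel_measurable_diff borel_measurable_exp[THEN measurable_compose[rotated]] T S W H)
  have [measurable]: "(\<lambda>x. det_on I (dmat I (W x) (\<eta> x) (T x))) \<in> borel_measurable M"
    unfolding det_on_def
    by (intro borel_measurable_sum borel_measurable_times borel_measurable_const borel_measurable_prod measurable_dmat T W H)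
      (auto simp: permutes_in_image)
  have [measurable]: "(\<lambda>x. \<Prod>i\<in>I. exp (- T x i)) \<in> borel_measurable M"
    by (intro borel_measurable_prod borel_measurable_uminus borel_measurable_exp[THEN measurable_compose[rotated]] T)
  show ?thesis unfolding horo_weight_def by measurable
qed

text \<open>Density of the pivot with respect to \<open>dp / p\<close>, that is, in the coordinate \<open>\<tau> = ln p\<close>.\<close>

definition pivot_density :: "real \<Rightarrow> real \<Rightarrow> real" where
  "pivot_density a p = sqrt p * exp (- ((p - a)\<^sup>2 / (2 * p))) / sqrt (2 * pi)"

text \<open>The density factors into the density of the eliminated model, the law of the pivot, and
  a normalised Gaussian for \<open>s N\<close> whose mean \<open>m\<close> and precision
  \<open>P = p * e^(2 t N)\<close> depend on the other sites and on \<open>t N\<close>.\<close>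

lemma horo_weight_insert:
  assumes adm: "admissible (insert N V) W \<eta>" and N: "N \<notin> V"
    and p: "p = pivot V W \<eta> t N * exp (- t N)"
    and m: "m = (\<Sum>k\<in>V. W N k * exp (t N + t k) * s k) / (p * exp (2 * t N))"
    and a: "a = (\<Sum>k\<in>V. W N k) + \<eta> N"
  shows "horo_weight (insert N V) W \<eta> t s =
     horo_weight V (elim_weight W N p) (elim_field W \<eta> N p) t s * pivot_density a p
       * (sqrt (p * exp (2 * t N) / (2 * pi)) * exp (- (p * exp (2 * t N) * (s N - m)\<^sup>2) / 2))"
proof -
  note D = admissible_insertD[OF adm]
  note pp = admissible_pivot[OF adm, of t]
  have p0: "p > 0" using pp p by simp
  have e: "energy (insert N V) W \<eta> t = (p - a)\<^sup>2 / (2 * p) + energy V (elim_weight W N p) (elim_field W \<eta> N p) t"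
    by (rule energy_elim[OF D(1) N D(3) pp p a])
  have q: "quad_form (insert N V) W \<eta> t s = p * exp (2 * t N) * (s N - m)\<^sup>2 + quad_form V (elim_weight W N p) (elim_field W \<eta> N p) t s"
    by (rule quad_form_elim[OF D(1) N D(3) pp p m])
  have d: "det_on (insert N V) (dmat (insert N V) W \<eta> t) = p * exp (2 * t N) * det_on V (dmat V (elim_weight W N p) (elim_field W \<eta> N p) t)"
    by (rule dmat_elim[OF D(1) N D(3) pp p])
  have c: "card (insert N V) = Suc (card V)" using D(1) N by simp
  \<comment> \<open>The determinant contributes \<open>P = p * e^(2 t N)\<close> at site
    \<open>N\<close>. One square root of \<open>P / (2 pi)\<close> normalises the Gaussian in
    \<open>s N\<close>; the other, together with \<open>e^(-t N)\<close>, is the prefactor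
    \<open>sqrt p / sqrt(2 pi)\<close> of the pivot density.\<close>
  have r: "exp (- t N) * (p * exp (2 * t N)) / (2 * pi) = sqrt p / sqrt (2 * pi) * sqrt (p * exp (2 * t N) / (2 * pi))"
  proof -
    have "sqrt (exp (2 * t N)) = exp (t N)"
      unfolding exp_twice(2) by simp
    then have "sqrt p / sqrt (2 * pi) * sqrt (p * exp (2 * t N) / (2 * pi)) = (sqrt p * sqrt p) * exp (t N) / (sqrt (2 * pi) * sqrt (2 * pi))"
      by (simp only: real_sqrt_mult real_sqrt_divide times_divide_times_eq mult_ac)
    also have "\<dots> = p * exp (t N) / (2 * pi)" using p0 by simp
    finally show ?thesis by (simp add: exp_twice exp_minus)
  qed
  let ?E = "exp (- energy V (elim_weight W N p) (elim_field W \<eta> N p) t)" and ?Q = "exp (- quad_form V (elim_weight W N p) (elim_field W \<eta> N p) t s / 2)"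
    and ?D = "det_on V (dmat V (elim_weight W N p) (elim_field W \<eta> N p) t)" and ?X = "\<Prod>i\<in>V. exp (- t i)"
    and ?R = "exp (- ((p - a)\<^sup>2 / (2 * p)))" and ?G = "exp (- (p * exp (2 * t N) * (s N - m)\<^sup>2) / 2)"
  have "horo_weight (insert N V) W \<eta> t s = (?R * ?E) * (?G * ?Q) * (exp (- t N) * ?X) * (p * exp (2 * t N) * ?D) / (2 * pi * (2 * pi) ^ card V)"
    unfolding horo_weight_def e q d c using D(1) N
    by (simp add: exp_add[symmetric] add_divide_distrib)
  also have "\<dots> = (?E * ?Q * ?X * ?D / (2 * pi) ^ card V) * ?R * ?G * (exp (- t N) * (p * exp (2 * t N)) / (2 * pi))"
    by (simp only: times_divide_eq_left times_divide_eq_right times_divide_times_eq divide_divide_eq_left mult_ac)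
  also have "\<dots> = (?E * ?Q * ?X * ?D / (2 * pi) ^ card V) * (sqrt p * ?R / sqrt (2 * pi)) * (sqrt (p * exp (2 * t N) / (2 * pi)) * ?G)"
    unfolding r by simp
  finally show ?thesis unfolding horo_weight_def pivot_density_def .
qed

section \<open>One-site expectations under elimination\<close>

text \<open>\<open>F\<close> receives \<open>t\<close> before \<open>s\<close>, although
  \<open>t\<close> is stored as component 1 and \<open>s\<close> as component 0. It sees one
  distinguished site only, so that all other sites can be eliminated without affecting it.\<close>

definition horo_mean :: "'a set \<Rightarrow> ('a \<Rightarrow> 'a \<Rightarrow> real) \<Rightarrow> ('a \<Rightarrow> real) \<Rightarrow> 'a \<Rightarrow> (real \<Rightarrow> real \<Rightarrow> ennreal) \<Rightarrow> ennreal" where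
  "horo_mean I W \<eta> i F = (\<integral>\<^sup>+\<phi>. F (\<phi> (i, 1)) (\<phi> (i, 0)) * ennreal (horo_weight I W \<eta> (\<lambda>j. \<phi> (j, 1)) (\<lambda>j. \<phi> (j, 0)))
     \<partial>lborel_Pi (I \<times> {..<2::nat}))"

lemma times2_insert: "insert N V \<times> {..<2::nat} = insert (N, 0) (insert (N, 1) (V \<times> {..<2}))"
  by (auto simp: numeral_2_eq_2 less_Suc_eq)

lemma gauss_normalized:
  assumes "P > 0"
  shows "(\<integral>\<^sup>+x. ennreal (sqrt (P / (2 * pi)) * exp (- (P * (x - m)\<^sup>2) / 2)) \<partial>lborel) = 1"
proof -
  have "(\<integral>\<^sup>+x. ennreal (sqrt (P / (2 * pi)) * exp (- (P * (x - m)\<^sup>2) / 2)) \<partial>lborel)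
     = ennreal (sqrt (P / (2 * pi))) * (\<integral>\<^sup>+x. ennreal (exp (- (P * (x - m)\<^sup>2) / 2)) \<partial>lborel)"
    using assms by (subst nn_integral_cmult[symmetric]) (auto simp: ennreal_mult)
  also have "\<dots> = ennreal (sqrt (P / (2 * pi)) * sqrt (2 * pi / P))"
    unfolding nn_integral_gauss(1)[OF assms] using assms by (simp add: ennreal_mult)
  also have "sqrt (P / (2 * pi)) * sqrt (2 * pi / P) = 1"
    using assms by (simp add: real_sqrt_mult[symmetric])
  finally show ?thesis by simp
qed

lemma measurable_horo_weight_coord:
  assumes "\<And>i. i \<in> I \<Longrightarrow> (i, 0) \<in> K" "\<And>i. i \<in> I \<Longrightarrow> (i, 1) \<in> K"
  shows "(\<lambda>\<phi>. horo_weight I W \<eta> (\<lambda>j. \<phi> (j, 1::nat)) (\<lambda>j. \<phi> (j, 0))) \<in> borel_measurable (lborel_Pi K)"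
  by (intro measurable_horo_weight measurable_coord assms borel_measurable_const)

lemma measurable_uncurried:
  assumes "case_prod F \<in> borel_measurable (borel \<Otimes>\<^sub>M borel)"
    and "X \<in> borel_measurable M" "Y \<in> borel_measurable M"
  shows "(\<lambda>x. F (X x) (Y x)) \<in> borel_measurable M"
  using measurable_compose[OF measurable_Pair[OF assms(2,3)] assms(1)] by simp

text \<open>The Gaussian in \<open>s N\<close> integrates to 1, the coordinate \<open>t N\<close> is
  traded for \<open>\<tau> = ln p\<close>, and Tonelli moves the integral over \<open>\<tau>\<close>
  to the outside. The result is a mixture, over the pivot, of the same expectation in models with
  one site fewer.\<close>

lemma horo_mean_insert:
  assumes adm: "admissible (insert N V) W \<eta>" and N: "N \<notin> V" and i: "i \<in> V"
    and F: "case_prod F \<in> borel_measurable (borel \<Otimes>\<^sub>M borel)"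
  shows "horo_mean (insert N V) W \<eta> i F =
    (\<integral>\<^sup>+\<tau>. ennreal (pivot_density ((\<Sum>k\<in>V. W N k) + \<eta> N) (exp \<tau>)) * horo_mean V (elim_weight W N (exp \<tau>)) (elim_field W \<eta> N (exp \<tau>)) i F \<partial>lborel)"
proof -
  interpret product_sigma_finite "\<lambda>_. lborel :: real measure" by (rule product_sigma_finite_lborel)
  note D = admissible_insertD[OF adm]
  define a where "a = (\<Sum>k\<in>V. W N k) + \<eta> N"
  define f where "f \<phi> = F (\<phi> (i, 1)) (\<phi> (i, 0)) * ennreal (horo_weight (insert N V) W \<eta> (\<lambda>j. \<phi> (j, 1::nat)) (\<lambda>j. \<phi> (j, 0)))" for \<phi>
  define B where "B \<phi> = pivot V W \<eta> (\<lambda>j. \<phi> (j, 1::nat)) N" for \<phi>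
  define g where "g \<tau> \<phi> = ennreal (pivot_density a (exp \<tau>)) * (F (\<phi> (i, 1)) (\<phi> (i, 0)) * ennreal (horo_weight V (elim_weight W N (exp \<tau>)) (elim_field W \<eta> N (exp \<tau>)) (\<lambda>j. \<phi> (j, 1::nat)) (\<lambda>j. \<phi> (j, 0))))" for \<tau> \<phi>
  let ?K = "V \<times> {..<2::nat}"
  have fin: "finite ?K" "(N, 1) \<notin> ?K" "finite (insert (N, 1) ?K)" "(N, 0) \<notin> insert (N, 1) ?K"
    using D(1) N by auto
  note Fm = measurable_uncurried[OF F]
  have fm: "f \<in> borel_measurable (lborel_Pi (insert N V \<times> {..<2::nat}))"
    unfolding f_def using i
    by (intro borel_measurable_times_ennreal Fm measurable_coord measurable_compose[OF measurable_horo_weight_coord measurable_ennreal]) auto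
  have Bp: "B \<phi> > 0" for \<phi> unfolding B_def by (rule admissible_pivot[OF adm])
  have inner: "(\<integral>\<^sup>+s. f (\<phi>((N,1) := t, (N,0) := s)) \<partial>lborel) = g (ln (B \<phi>) - t) \<phi>" for \<phi> t
  proof -
    define p where "p = exp (ln (B \<phi>) - t)"
    define P where "P = p * exp (2 * t)"
    define m where "m = (\<Sum>k\<in>V. W N k * exp (t + \<phi> (k, 1)) * \<phi> (k, 0)) / (p * exp (2 * t))"
    have P: "P > 0" by (simp add: P_def p_def)
    have p: "p = B \<phi> * exp (- t)" using Bp[of \<phi>] by (simp add: p_def exp_diff exp_minus field_simps)
    have "f (\<phi>((N,1) := t, (N,0) := s)) = g (ln (B \<phi>) - t) \<phi> * ennreal (sqrt (P / (2 * pi)) * exp (- (P * (s - m)\<^sup>2) / 2))" for s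
    proof -
      let ?\<psi> = "\<phi>((N,1) := t, (N,0) := s)"
      let ?t = "\<lambda>j. ?\<psi> (j, 1::nat)" and ?s = "\<lambda>j. ?\<psi> (j, 0)"
      have ne: "k \<noteq> N" if "k \<in> V" for k using that N by auto
      have tv: "?t k = \<phi> (k, 1)" "?s k = \<phi> (k, 0)" if "k \<in> V" for k using ne[OF that] by auto
      have tN: "?t N = t" "?s N = s" by auto
      have "pivot V W \<eta> ?t N = B \<phi>" unfolding B_def pivot_def using tv by simp
      then have p': "p = pivot V W \<eta> ?t N * exp (- ?t N)" using p tN by simp
      have m': "m = (\<Sum>k\<in>V. W N k * exp (?t N + ?t k) * ?s k) / (p * exp (2 * ?t N))"
        unfolding m_def tN using tv by (simp cong: sum.cong)
      have "horo_weight (insert N V) W \<eta> ?t ?s = horo_weight V (elim_weight W N p) (elim_field W \<eta> N p) ?t ?s * pivot_density a p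
         * (sqrt (p * exp (2 * ?t N) / (2 * pi)) * exp (- (p * exp (2 * ?t N) * (?s N - m)\<^sup>2) / 2))"
        by (rule horo_weight_insert[OF adm N p' m' a_def])
      also have "horo_weight V (elim_weight W N p) (elim_field W \<eta> N p) ?t ?s = horo_weight V (elim_weight W N p) (elim_field W \<eta> N p) (\<lambda>j. \<phi> (j, 1)) (\<lambda>j. \<phi> (j, 0))"
        by (rule horo_weight_cong) (use tv in auto)
      finally have 1: "horo_weight (insert N V) W \<eta> ?t ?s = pivot_density a p * horo_weight V (elim_weight W N p) (elim_field W \<eta> N p) (\<lambda>j. \<phi> (j, 1)) (\<lambda>j. \<phi> (j, 0))
         * (sqrt (P / (2 * pi)) * exp (- (P * (s - m)\<^sup>2) / 2))"
        unfolding P_def tN by (simp only: mult_ac)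
      have "p > 0" by (simp add: p_def)
      then have "horo_weight V (elim_weight W N p) (elim_field W \<eta> N p) (\<lambda>j. \<phi> (j, 1)) (\<lambda>j. \<phi> (j, 0)) \<ge> 0"
        by (intro less_imp_le horo_weight_pos admissible_elim[OF adm])
      moreover have "pivot_density a p \<ge> 0" using \<open>p > 0\<close> by (simp add: pivot_density_def)
      ultimately have "ennreal (horo_weight (insert N V) W \<eta> ?t ?s) = ennreal (pivot_density a p) * ennreal (horo_weight V (elim_weight W N p) (elim_field W \<eta> N p) (\<lambda>j. \<phi> (j, 1)) (\<lambda>j. \<phi> (j, 0)))
         * ennreal (sqrt (P / (2 * pi)) * exp (- (P * (s - m)\<^sup>2) / 2))"
        unfolding 1 using P by (simp add: ennreal_mult)
      moreover have "F (?\<psi> (i, 1)) (?\<psi> (i, 0)) = F (\<phi> (i, 1)) (\<phi> (i, 0))" using tv[OF i] by simp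
      ultimately show ?thesis unfolding f_def g_def p_def[symmetric] by (simp add: mult_ac)
    qed
    then have "(\<integral>\<^sup>+s. f (\<phi>((N,1) := t, (N,0) := s)) \<partial>lborel) = (\<integral>\<^sup>+s. g (ln (B \<phi>) - t) \<phi> * ennreal (sqrt (P / (2 * pi)) * exp (- (P * (s - m)\<^sup>2) / 2)) \<partial>lborel)"
      by simp
    also have "\<dots> = g (ln (B \<phi>) - t) \<phi> * (\<integral>\<^sup>+s. ennreal (sqrt (P / (2 * pi)) * exp (- (P * (s - m)\<^sup>2) / 2)) \<partial>lborel)"
      by (rule nn_integral_cmult) simp
    also have "\<dots> = g (ln (B \<phi>) - t) \<phi>" unfolding gauss_normalized[OF P] by simp
    finally show ?thesis .
  qed
  have gm: "(\<lambda>(\<phi>, \<tau>). g \<tau> \<phi>) \<in> borel_measurable (lborel_Pi ?K \<Otimes>\<^sub>M lborel)"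
  proof -
    have c [measurable]: "(\<lambda>x. fst x k) \<in> borel_measurable (lborel_Pi ?K \<Otimes>\<^sub>M (lborel :: real measure))" if "k \<in> ?K" for k
      by (rule measurable_compose[OF measurable_fst measurable_coord[OF that]])
    have sm [measurable]: "(\<lambda>x. exp (snd x)) \<in> borel_measurable (lborel_Pi ?K \<Otimes>\<^sub>M (lborel :: real measure))"
      by measurable
    have [measurable]: "(\<lambda>x. horo_weight V (elim_weight W N (exp (snd x))) (elim_field W \<eta> N (exp (snd x))) (\<lambda>j. fst x (j, 1::nat)) (\<lambda>j. fst x (j, 0))) \<in> borel_measurable (lborel_Pi ?K \<Otimes>\<^sub>M lborel)"
      by (intro measurable_horo_weight c) (auto simp: elim_weight_def elim_field_def)
    have [measurable]: "(\<lambda>x. F (fst x (i, 1)) (fst x (i, 0))) \<in> borel_measurable (lborel_Pi ?K \<Otimes>\<^sub>M (lborel :: real measure))"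
      using measurable_compose[OF measurable_Pair[OF c c] F] i by simp
    show ?thesis unfolding g_def pivot_density_def split_beta' by measurable
  qed
  have g\<phi>: "g' \<in> borel_measurable lborel" if "g' = (\<lambda>\<tau>. g \<tau> \<phi>)" "\<phi> \<in> space (lborel_Pi ?K)" for g' \<phi>
    using measurable_Pair2[OF gm that(2)] that(1) by simp
  interpret P: pair_sigma_finite "lborel_Pi ?K" "lborel :: real measure"
    using sigma_finite[OF fin(1)] by (simp add: pair_sigma_finite.intro sigma_finite_lborel)
  have "horo_mean (insert N V) W \<eta> i F = (\<integral>\<^sup>+\<phi>. f \<phi> \<partial>lborel_Pi (insert (N,0) (insert (N,1) ?K)))"
    unfolding horo_mean_def f_def times2_insert ..
  also have "\<dots> = (\<integral>\<^sup>+\<phi>. (\<integral>\<^sup>+s. f (\<phi>((N,0) := s)) \<partial>lborel) \<partial>lborel_Pi (insert (N,1) ?K))"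
    using fm unfolding times2_insert by (intro product_nn_integral_insert fin) 
  also have "\<dots> = (\<integral>\<^sup>+\<phi>. (\<integral>\<^sup>+t. (\<integral>\<^sup>+s. f (\<phi>((N,1) := t, (N,0) := s)) \<partial>lborel) \<partial>lborel) \<partial>lborel_Pi ?K)"
  proof (rule product_nn_integral_insert[OF fin(1,2)])
    have "(\<lambda>(\<phi>, s). \<phi>((N,0) := s)) \<in> lborel_Pi (insert (N,1) ?K) \<Otimes>\<^sub>M lborel \<rightarrow>\<^sub>M lborel_Pi (insert (N,0) (insert (N,1) ?K))"
      by (rule measurable_add_dim)
    note [measurable] = measurable_compose[OF this fm[unfolded times2_insert], unfolded split_beta']
    show "(\<lambda>\<phi>. \<integral>\<^sup>+s. f (\<phi>((N,0) := s)) \<partial>lborel) \<in> borel_measurable (lborel_Pi (insert (N,1) ?K))"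
      by measurable
  qed
  also have "\<dots> = (\<integral>\<^sup>+\<phi>. (\<integral>\<^sup>+t. g (ln (B \<phi>) - t) \<phi> \<partial>lborel) \<partial>lborel_Pi ?K)"
    unfolding inner ..
  also have "\<dots> = (\<integral>\<^sup>+\<phi>. (\<integral>\<^sup>+\<tau>. g \<tau> \<phi> \<partial>lborel) \<partial>lborel_Pi ?K)"
  proof (rule nn_integral_cong)
    fix \<phi> :: "'a \<times> nat \<Rightarrow> real" assume "\<phi> \<in> space (lborel_Pi ?K)"
    \<comment> \<open>\<open>\<tau> = ln (B \<phi>) - t N\<close>, where \<open>B \<phi>\<close>
      depends only on the sites in \<open>V\<close>. For fixed \<open>\<phi>\<close> this is a
      reflection followed by a translation of the line, with Jacobian 1.\<close>
    from nn_integral_real_affine[of "\<lambda>\<tau>. g \<tau> \<phi>" "-1" "ln (B \<phi>)"] g\<phi>[OF refl this]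
    show "(\<integral>\<^sup>+t. g (ln (B \<phi>) - t) \<phi> \<partial>lborel) = (\<integral>\<^sup>+\<tau>. g \<tau> \<phi> \<partial>lborel)" by simp
  qed
  also have "\<dots> = (\<integral>\<^sup>+\<tau>. (\<integral>\<^sup>+\<phi>. g \<tau> \<phi> \<partial>lborel_Pi ?K) \<partial>lborel)"
    using P.Fubini'[OF gm] by simp
  also have "\<dots> = (\<integral>\<^sup>+\<tau>. ennreal (pivot_density a (exp \<tau>)) * horo_mean V (elim_weight W N (exp \<tau>)) (elim_field W \<eta> N (exp \<tau>)) i F \<partial>lborel)"
  proof (rule nn_integral_cong)
    fix \<tau> :: real
    show "(\<integral>\<^sup>+\<phi>. g \<tau> \<phi> \<partial>lborel_Pi ?K) = ennreal (pivot_density a (exp \<tau>)) * horo_mean V (elim_weight W N (exp \<tau>)) (elim_field W \<eta> N (exp \<tau>)) i F"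
      unfolding g_def horo_mean_def
      using i by (intro nn_integral_cmult borel_measurable_times_ennreal Fm measurable_coord measurable_compose[OF measurable_horo_weight_coord measurable_ennreal]) auto
  qed
  finally show ?thesis unfolding a_def .
qed

text \<open>At \<open>p = a * e^u\<close> the exponent \<open>(p - a)^2 / (2 p)\<close> becomes
  \<open>a * (cosh u - 1)\<close>, so the total mass is a Bessel integral of order 1/2.\<close>

lemma pivot_density_integral:
  assumes a: "a > 0"
  shows "(\<integral>\<^sup>+\<tau>. ennreal (pivot_density a (exp \<tau>)) \<partial>lborel) = 1"
proof -
  have r: "pivot_density a (exp (ln a + u)) = sqrt (a / (2 * pi)) * (exp (1/2 * u) * exp (- a * (cosh u - 1)))" for u
  proof -
    have e: "exp (ln a + u) = a * exp u" using a by (simp add: exp_add)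
    have "(a * exp u - a)\<^sup>2 / (2 * (a * exp u)) = a * (cosh u - 1)"
      using a by (simp add: cosh_field_def exp_minus power2_eq_square field_simps)
    moreover have "sqrt (exp u) = exp (1/2 * u)"
    proof -
      have "exp u = exp (1/2 * u) * exp (1/2 * u)" by (simp add: exp_add[symmetric])
      then show ?thesis by (metis abs_exp_cancel real_sqrt_mult_self real_sqrt_abs2)
    qed
    ultimately show ?thesis unfolding pivot_density_def e by (simp add: real_sqrt_mult real_sqrt_divide)
  qed
  have "(\<integral>\<^sup>+\<tau>. ennreal (pivot_density a (exp \<tau>)) \<partial>lborel) = (\<integral>\<^sup>+u. ennreal (pivot_density a (exp (ln a + u))) \<partial>lborel)"
    by (subst nn_integral_real_affine[where c=1 and t="ln a"]) (auto simp: pivot_density_def)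
  also have "\<dots> = ennreal (sqrt (a / (2 * pi))) * cosh_integral a (1/2)"
    unfolding r cosh_integral_def using a by (subst nn_integral_cmult[symmetric]) (auto simp: ennreal_mult cosh_field_def)
  also have "\<dots> = ennreal (sqrt (a / (2 * pi)) * sqrt (2 * pi / a))"
    unfolding cosh_integral_half[OF a] using a by (simp add: ennreal_mult)
  also have "sqrt (a / (2 * pi)) * sqrt (2 * pi / a) = 1"
    using a by (simp add: real_sqrt_mult[symmetric])
  finally show ?thesis by simp
qed

text \<open>Both sides are the same non-negative mixture of one-site expectations, so a comparison
  at one site is enough. Elimination only adds to the field at \<open>i\<close>, which is why a
  lower bound \<open>lb\<close> on \<open>\<eta> i\<close> is inherited by every one-site model
  reached. Applied in both directions, the lemma also transfers equalities.\<close>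

lemma horo_mean_mono:
  assumes I: "finite I" "i \<in> I" "admissible I W \<eta>" "lb \<le> \<eta> i"
    and F: "case_prod F \<in> borel_measurable (borel \<Otimes>\<^sub>M borel)" and F': "case_prod F' \<in> borel_measurable (borel \<Otimes>\<^sub>M borel)"
    and base: "\<And>W \<eta>. admissible {i} W \<eta> \<Longrightarrow> lb \<le> \<eta> i \<Longrightarrow> horo_mean {i} W \<eta> i F \<le> horo_mean {i} W \<eta> i F'"
  shows "horo_mean I W \<eta> i F \<le> horo_mean I W \<eta> i F'"
proof -
  define V where "V = I - {i}"
  have IV: "I = insert i V" "i \<notin> V" "finite V" using I by (auto simp: V_def)
  have "horo_mean (insert i V) W \<eta> i F \<le> horo_mean (insert i V) W \<eta> i F'"
    if "admissible (insert i V) W \<eta>" "lb \<le> \<eta> i" using IV(3,2) that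
  proof (induction V arbitrary: W \<eta> rule: finite_induct)
    case empty
    then show ?case using base by simp
  next
    case (insert N V)
    have adm: "admissible (insert N (insert i V)) W \<eta>" using insert.prems by (simp add: insert_commute)
    have N: "N \<notin> insert i V" using insert by auto
    note D = admissible_insertD[OF adm]
    have "horo_mean (insert i V) (elim_weight W N (exp \<tau>)) (elim_field W \<eta> N (exp \<tau>)) i F
      \<le> horo_mean (insert i V) (elim_weight W N (exp \<tau>)) (elim_field W \<eta> N (exp \<tau>)) i F'" for \<tau>
    proof (rule insert.IH)
      show "admissible (insert i V) (elim_weight W N (exp \<tau>)) (elim_field W \<eta> N (exp \<tau>))"
        by (rule admissible_elim[OF adm]) simp
      have "W i N * \<eta> N / exp \<tau> \<ge> 0" using D(2) D(3,4)[of i] by simp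
      then show "lb \<le> elim_field W \<eta> N (exp \<tau>) i" using insert.prems unfolding elim_field_def by linarith
    qed (use insert in auto)
    then show ?case
      unfolding insert_commute[of i N] horo_mean_insert[OF adm N insertI1 F] horo_mean_insert[OF adm N insertI1 F']
      by (intro nn_integral_mono mult_left_mono) auto
  qed
  then show ?thesis using I IV by simp
qed

text \<open>A mixture of ones is one only because the pivot density has total mass 1; the comparison
  lemma does not see this. Here \<open>a\<close> is positive since the field at the removed site
  is.\<close>

lemma horo_mean_one:
  assumes I: "finite I" "i \<in> I" "admissible I W \<eta>"
    and base: "\<And>W \<eta>. admissible {i} W \<eta> \<Longrightarrow> horo_mean {i} W \<eta> i (\<lambda>_ _. 1) = 1"
  shows "horo_mean I W \<eta> i (\<lambda>_ _. 1) = 1"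
proof -
  define V where "V = I - {i}"
  have IV: "I = insert i V" "i \<notin> V" "finite V" using I by (auto simp: V_def)
  have "horo_mean (insert i V) W \<eta> i (\<lambda>_ _. 1) = 1"
    if "admissible (insert i V) W \<eta>" using IV(3,2) that
  proof (induction V arbitrary: W \<eta> rule: finite_induct)
    case empty
    then show ?case using base by simp
  next
    case (insert N V)
    have adm: "admissible (insert N (insert i V)) W \<eta>" using insert.prems by (simp add: insert_commute)
    have N: "N \<notin> insert i V" using insert by auto
    note D = admissible_insertD[OF adm]
    have 1: "horo_mean (insert i V) (elim_weight W N (exp \<tau>)) (elim_field W \<eta> N (exp \<tau>)) i (\<lambda>_ _. 1) = 1" for \<tau>
      by (rule insert.IH) (use insert admissible_elim[OF adm] in auto)
    have "(\<Sum>k\<in>insert i V. W N k) + \<eta> N > 0" using D by (intro add_nonneg_pos sum_nonneg) auto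
    then show ?case
      unfolding insert_commute[of i N] by (subst horo_mean_insert[OF adm N insertI1]) (auto simp: 1 pivot_density_integral simp del: sum.insert)
  qed
  then show ?thesis using I IV by simp
qed

text \<open>For one site \<open>D(t)\<close> is the number \<open>\<eta> i * e^t\<close>, and its
  exponential cancels the factor \<open>e^(-t)\<close> of the density; only
  \<open>\<eta> i / (2 pi)\<close> remains in front.\<close>

lemma horo_mean_singleton:
  assumes adm: "admissible {i} W \<eta>"
    and F: "case_prod F \<in> borel_measurable (borel \<Otimes>\<^sub>M borel)"
  shows "horo_mean {i} W \<eta> i F = (\<integral>\<^sup>+t. (\<integral>\<^sup>+s. F t s *
     ennreal (exp (- \<eta> i * (cosh t - 1)) * exp (- (\<eta> i * exp t * (s - 0)\<^sup>2) / 2) * (\<eta> i / (2 * pi))) \<partial>lborel) \<partial>lborel)"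
proof -
  interpret product_sigma_finite "\<lambda>_. lborel :: real measure" by (rule product_sigma_finite_lborel)
  define f where "f \<phi> = F (\<phi> (i, 1)) (\<phi> (i, 0)) * ennreal (horo_weight {i} W \<eta> (\<lambda>j. \<phi> (j, 1::nat)) (\<lambda>j. \<phi> (j, 0)))" for \<phi>
  have sw: "horo_weight {i} W \<eta> t s = exp (- \<eta> i * (cosh (t i) - 1)) * exp (- (\<eta> i * exp (t i) * (s i - 0)\<^sup>2) / 2) * (\<eta> i / (2 * pi))" for t s
    unfolding horo_weight_def energy_def quad_form_def det_on_def by (simp add: permutes_sing dmat_def exp_minus mult.assoc)
  have two: "{i} \<times> {..<2::nat} = insert (i, 0) {(i, 1)}" using times2_insert[of i "{}"] by simp
  have fm: "f \<in> borel_measurable (lborel_Pi ({i} \<times> {..<2::nat}))"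
    unfolding f_def
    by (intro borel_measurable_times_ennreal measurable_uncurried[OF F] measurable_coord measurable_compose[OF measurable_horo_weight_coord measurable_ennreal]) auto
  define h where "h t s = F t s * ennreal (exp (- \<eta> i * (cosh t - 1)) * exp (- (\<eta> i * exp t * (s - 0)\<^sup>2) / 2) * (\<eta> i / (2 * pi)))" for t s
  have Fm [measurable]: "(\<lambda>x. F (fst x) (snd x)) \<in> borel_measurable (lborel \<Otimes>\<^sub>M lborel)"
    by (rule measurable_uncurried[OF F]) auto
  have hm: "(\<lambda>x. h (fst x) (snd x)) \<in> borel_measurable (lborel \<Otimes>\<^sub>M lborel)"
    unfolding h_def cosh_field_def by measurable
  have "horo_mean {i} W \<eta> i F = (\<integral>\<^sup>+\<phi>. (\<integral>\<^sup>+s. f (\<phi>((i,0) := s)) \<partial>lborel) \<partial>lborel_Pi {(i,1::nat)})"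
    unfolding horo_mean_def f_def[symmetric] two using fm unfolding two
    by (intro product_nn_integral_insert) auto
  also have "\<dots> = (\<integral>\<^sup>+\<phi>. (\<lambda>t. \<integral>\<^sup>+s. h t s \<partial>lborel) (\<phi> (i, 1::nat)) \<partial>lborel_Pi {(i,1::nat)})"
    unfolding f_def sw h_def by (simp del: One_nat_def)
  also have "\<dots> = (\<integral>\<^sup>+t. (\<integral>\<^sup>+s. h t s \<partial>lborel) \<partial>lborel)"
  proof (rule product_nn_integral_singleton)
    show "(\<lambda>t. \<integral>\<^sup>+s. h t s \<partial>lborel) \<in> borel_measurable lborel"
      using hm by (intro lborel.borel_measurable_nn_integral) (simp add: split_beta')
  qed
  finally show ?thesis unfolding h_def .
qed

text \<open>Integrating out \<open>s\<close>, a centred Gaussian of variance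
  \<open>e^(-t) / \<eta> i\<close>, leaves a factor \<open>e^(-t/2)\<close>, hence the order
  \<open>q - 1/2\<close>. The observable \<open>(e^t s)^2\<close> contributes
  \<open>e^t / \<eta> i\<close> on average, which raises the order by one to
  \<open>q + 1/2\<close>.\<close>

lemma horo_mean_singleton_exp:
  assumes adm: "admissible {i} W \<eta>"
  shows "horo_mean {i} W \<eta> i (\<lambda>t s. ennreal (exp (q * t))) = ennreal (sqrt (\<eta> i / (2 * pi))) * cosh_integral (\<eta> i) (q - 1/2)"
    and "horo_mean {i} W \<eta> i (\<lambda>t s. ennreal (exp (q * t) * (exp t * s)\<^sup>2)) = ennreal (sqrt (\<eta> i / (2 * pi)) / \<eta> i) * cosh_integral (\<eta> i) (q + 1/2)"
proof -
  define e where "e = \<eta> i"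
  have e: "e > 0" using adm by (simp add: admissible_def e_def)
  have sq: "sqrt (exp t) = exp (t / 2)" for t :: real
  proof -
    have "exp t = exp (t / 2) * exp (t / 2)" by (simp add: exp_add[symmetric])
    then show ?thesis by (metis abs_exp_cancel real_sqrt_abs2)
  qed
  have c: "e / (2 * pi) * sqrt (2 * pi / (e * exp t)) = sqrt (e / (2 * pi)) * exp (- (1/2) * t)" for t
  proof -
    have "e / (2 * pi) = sqrt (e / (2 * pi)) * sqrt (e / (2 * pi))" using e by simp
    moreover have "sqrt (e / (2 * pi)) * sqrt (2 * pi / (e * exp t)) = exp (- (1/2) * t)"
    proof -
      have "e / (2 * pi) * (2 * pi / (e * exp t)) = exp (- t)" using e by (simp add: exp_minus field_simps)
      then show ?thesis using sq[of "- t"] by (simp add: real_sqrt_mult[symmetric])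
    qed
    ultimately show ?thesis by (metis mult.assoc)
  qed
  have s0: "(\<integral>\<^sup>+s. ennreal (exp (q * t)) * ennreal (exp (- e * (cosh t - 1)) * exp (- (e * exp t * (s - 0)\<^sup>2) / 2) * (e / (2 * pi))) \<partial>lborel)
     = ennreal (sqrt (e / (2 * pi))) * ennreal (exp ((q - 1/2) * t) * exp (- e * (cosh t - 1)))" for t
  proof -
    have "(\<integral>\<^sup>+s. ennreal (exp (q * t)) * ennreal (exp (- e * (cosh t - 1)) * exp (- (e * exp t * (s - 0)\<^sup>2) / 2) * (e / (2 * pi))) \<partial>lborel)
      = (\<integral>\<^sup>+s. ennreal (exp (q * t) * exp (- e * (cosh t - 1)) * (e / (2 * pi))) * ennreal (exp (- (e * exp t * (s - 0)\<^sup>2) / 2)) \<partial>lborel)"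
      using e by (intro nn_integral_cong) (simp add: ennreal_mult[symmetric] mult_ac)
    also have "\<dots> = ennreal (exp (q * t) * exp (- e * (cosh t - 1)) * (e / (2 * pi))) * ennreal (sqrt (2 * pi / (e * exp t)))"
      using e by (subst nn_integral_cmult) (simp, subst nn_integral_gauss(1), simp_all)
    also have "\<dots> = ennreal (exp (q * t) * exp (- e * (cosh t - 1)) * (e / (2 * pi) * sqrt (2 * pi / (e * exp t))))"
      using e by (simp add: ennreal_mult[symmetric] mult.assoc)
    also have "exp (q * t) * exp (- e * (cosh t - 1)) * (e / (2 * pi) * sqrt (2 * pi / (e * exp t))) = sqrt (e / (2 * pi)) * ((exp (q * t) * exp (- (1/2) * t)) * exp (- e * (cosh t - 1)))"
      unfolding c by (simp only: mult_ac)
    also have "exp (q * t) * exp (- (1/2) * t) = exp ((q - 1/2) * t)"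
      by (simp add: exp_add[symmetric] left_diff_distrib)
    finally show ?thesis using e by (simp add: ennreal_mult)
  qed
  have s2: "(\<integral>\<^sup>+s. ennreal (exp (q * t) * (exp t * s)\<^sup>2) * ennreal (exp (- e * (cosh t - 1)) * exp (- (e * exp t * (s - 0)\<^sup>2) / 2) * (e / (2 * pi))) \<partial>lborel)
     = ennreal (sqrt (e / (2 * pi)) / e) * ennreal (exp ((q + 1/2) * t) * exp (- e * (cosh t - 1)))" for t
  proof -
    have "(\<integral>\<^sup>+s. ennreal (exp (q * t) * (exp t * s)\<^sup>2) * ennreal (exp (- e * (cosh t - 1)) * exp (- (e * exp t * (s - 0)\<^sup>2) / 2) * (e / (2 * pi))) \<partial>lborel)
      = (\<integral>\<^sup>+s. ennreal (exp (q * t) * exp (- e * (cosh t - 1)) * (e / (2 * pi))) * ennreal ((exp t * s + 0)\<^sup>2 * exp (- (e * exp t * (s - 0)\<^sup>2) / 2)) \<partial>lborel)"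
      using e by (intro nn_integral_cong) (simp add: ennreal_mult[symmetric] mult_ac)
    also have "\<dots> = ennreal (exp (q * t) * exp (- e * (cosh t - 1)) * (e / (2 * pi))) * ennreal (sqrt (2 * pi / (e * exp t)) * (exp t / e))"
    proof -
      have "(exp t)\<^sup>2 / (e * exp t) + (exp t * 0 + 0)\<^sup>2 = exp t / e" using e by (simp add: power2_eq_square)
      then show ?thesis
        using e by (subst nn_integral_cmult) (simp, subst nn_integral_gauss(2), simp_all)
    qed
    also have "\<dots> = ennreal (exp (q * t) * exp (- e * (cosh t - 1)) * (e / (2 * pi) * sqrt (2 * pi / (e * exp t))) * (exp t / e))"
      using e by (simp add: ennreal_mult[symmetric] mult.assoc)
    also have "exp (q * t) * exp (- e * (cosh t - 1)) * (e / (2 * pi) * sqrt (2 * pi / (e * exp t))) * (exp t / e) = sqrt (e / (2 * pi)) / e * ((exp (q * t) * (exp (- (1/2) * t) * exp t)) * exp (- e * (cosh t - 1)))"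
      unfolding c by simp
    also have "exp (q * t) * (exp (- (1/2) * t) * exp t) = exp ((q + 1/2) * t)"
      by (simp add: exp_add[symmetric] distrib_right)
    finally show ?thesis using e by (simp add: ennreal_mult[symmetric])
  qed
  show "horo_mean {i} W \<eta> i (\<lambda>t s. ennreal (exp (q * t))) = ennreal (sqrt (\<eta> i / (2 * pi))) * cosh_integral (\<eta> i) (q - 1/2)"
    unfolding cosh_integral_def
    by (subst horo_mean_singleton[OF adm], measurable) (unfold e_def[symmetric] s0, rule nn_integral_cmult, simp add: cosh_field_def)
  show "horo_mean {i} W \<eta> i (\<lambda>t s. ennreal (exp (q * t) * (exp t * s)\<^sup>2)) = ennreal (sqrt (\<eta> i / (2 * pi)) / \<eta> i) * cosh_integral (\<eta> i) (q + 1/2)"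
    unfolding cosh_integral_def
    by (subst horo_mean_singleton[OF adm], measurable) (unfold e_def[symmetric] s2, rule nn_integral_cmult, simp add: cosh_field_def)
qed

lemma horo_mean_singleton_values:
  assumes adm: "admissible {i} W \<eta>"
  shows "horo_mean {i} W \<eta> i (\<lambda>_ _. 1) = 1"
    and "horo_mean {i} W \<eta> i (\<lambda>t s. ennreal (exp t)) = 1"
    and "horo_mean {i} W \<eta> i (\<lambda>t s. ennreal ((exp t * s)\<^sup>2)) = ennreal (1 / \<eta> i)"
    and "horo_mean {i} W \<eta> i (\<lambda>t s. ennreal (exp (2 * t))) = ennreal (1 + 1 / \<eta> i)"
proof -
  have e: "\<eta> i > 0" using adm by (simp add: admissible_def)
  have 1: "sqrt (\<eta> i / (2 * pi)) * sqrt (2 * pi / \<eta> i) = 1"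
    using e by (simp add: real_sqrt_mult[symmetric])
  then have 2: "ennreal (sqrt (\<eta> i / (2 * pi))) * ennreal (sqrt (2 * pi / \<eta> i)) = 1"
    using e by (simp add: ennreal_mult[symmetric])
  show "horo_mean {i} W \<eta> i (\<lambda>_ _. 1) = 1"
    using horo_mean_singleton_exp(1)[OF adm, of 0] cosh_integral_uminus[of "\<eta> i" "1/2"] cosh_integral_half[OF e] 2 by simp
  show "horo_mean {i} W \<eta> i (\<lambda>t s. ennreal (exp t)) = 1"
    using horo_mean_singleton_exp(1)[OF adm, of 1] cosh_integral_half[OF e] 2 by simp
  show "horo_mean {i} W \<eta> i (\<lambda>t s. ennreal ((exp t * s)\<^sup>2)) = ennreal (1 / \<eta> i)"
  proof -
    have "horo_mean {i} W \<eta> i (\<lambda>t s. ennreal ((exp t * s)\<^sup>2)) = ennreal (sqrt (\<eta> i / (2 * pi)) / \<eta> i) * ennreal (sqrt (2 * pi / \<eta> i))"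
      using horo_mean_singleton_exp(2)[OF adm, of 0] cosh_integral_half[OF e] by simp
    also have "\<dots> = ennreal ((sqrt (\<eta> i / (2 * pi)) * sqrt (2 * pi / \<eta> i)) / \<eta> i)"
      using e by (simp add: ennreal_mult[symmetric])
    finally show ?thesis unfolding 1 .
  qed
  show "horo_mean {i} W \<eta> i (\<lambda>t s. ennreal (exp (2 * t))) = ennreal (1 + 1 / \<eta> i)"
  proof -
    have "horo_mean {i} W \<eta> i (\<lambda>t s. ennreal (exp (2 * t))) = ennreal (sqrt (\<eta> i / (2 * pi))) * ennreal (sqrt (2 * pi / \<eta> i) * (1 + 1 / \<eta> i))"
      using horo_mean_singleton_exp(1)[OF adm, of 2] cosh_integral_three_halves[OF e] by simp
    also have "\<dots> = ennreal ((sqrt (\<eta> i / (2 * pi)) * sqrt (2 * pi / \<eta> i)) * (1 + 1 / \<eta> i))"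
      using e by (simp add: ennreal_mult[symmetric] mult.assoc)
    finally show ?thesis unfolding 1 by simp
  qed
qed

lemma horo_mean_add:
  assumes "i \<in> I" "case_prod F \<in> borel_measurable (borel \<Otimes>\<^sub>M borel)" "case_prod F' \<in> borel_measurable (borel \<Otimes>\<^sub>M borel)"
  shows "horo_mean I W \<eta> i (\<lambda>t s. F t s + F' t s) = horo_mean I W \<eta> i F + horo_mean I W \<eta> i F'"
  unfolding horo_mean_def distrib_right using assms
  by (intro nn_integral_add borel_measurable_times_ennreal measurable_uncurried[of F] measurable_uncurried[of F']
      measurable_coord measurable_compose[OF measurable_horo_weight_coord measurable_ennreal]) auto

text \<open>The second and fourth claims are the Ward identities of the supersymmetric model. They
  hold at a single site for every field, so two applications of the comparison lemma carry them to
  all of \<open>I\<close>.\<close>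

lemma horo_mean_values:
  assumes adm: "admissible I W \<eta>" and i: "i \<in> I"
  shows "horo_mean I W \<eta> i (\<lambda>_ _. 1) = 1"
    and "horo_mean I W \<eta> i (\<lambda>t s. ennreal (exp t)) = 1"
    and "horo_mean I W \<eta> i (\<lambda>t s. ennreal ((exp t * s)\<^sup>2)) < \<infinity>"
    and "horo_mean I W \<eta> i (\<lambda>t s. ennreal (exp (2 * t))) = 1 + horo_mean I W \<eta> i (\<lambda>t s. ennreal ((exp t * s)\<^sup>2))"
proof -
  have fin: "finite I" and e: "\<eta> i > 0" using adm i unfolding admissible_def by auto
  note mono = horo_mean_mono[OF fin i adm]
  show 1: "horo_mean I W \<eta> i (\<lambda>_ _. 1) = 1"
    by (rule horo_mean_one[OF fin i adm horo_mean_singleton_values(1)])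
  have pos: "0 < \<eta>' i" if "admissible {i} W' \<eta>'" for W' \<eta>' using that by (simp add: admissible_def)
  have "horo_mean I W \<eta> i (\<lambda>t s. ennreal (exp t)) = horo_mean I W \<eta> i (\<lambda>_ _. 1)"
  proof (intro antisym mono[where lb="0"])
    show "horo_mean {i} W' \<eta>' i (\<lambda>t s. ennreal (exp t)) \<le> horo_mean {i} W' \<eta>' i (\<lambda>_ _. 1)"
      "horo_mean {i} W' \<eta>' i (\<lambda>_ _. 1) \<le> horo_mean {i} W' \<eta>' i (\<lambda>t s. ennreal (exp t))"
      if "admissible {i} W' \<eta>'" for W' \<eta>'
      unfolding horo_mean_singleton_values(1,2)[OF that] by simp_all
  qed (use e in \<open>auto simp: less_imp_le\<close>)
  with 1 show "horo_mean I W \<eta> i (\<lambda>t s. ennreal (exp t)) = 1" by simp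
  \<comment> \<open>\<open>1 / \<eta>' i\<close> is the exact second moment at one site with field
    \<open>\<eta>' i\<close>. As elimination never lowers the field at \<open>i\<close>, the
    original value \<open>\<eta> i\<close> gives a bound uniform over the mixture.\<close>
  define c where "c = 1 / \<eta> i"
  have "horo_mean I W \<eta> i (\<lambda>t s. ennreal ((exp t * s)\<^sup>2)) \<le> horo_mean I W \<eta> i (\<lambda>_ _. ennreal c)"
  proof (rule mono[where lb="\<eta> i"])
    fix W' \<eta>' assume a: "admissible {i} W' \<eta>'" and l: "\<eta> i \<le> \<eta>' i"
    have "horo_mean {i} W' \<eta>' i (\<lambda>_ _. ennreal c) = ennreal c * horo_mean {i} W' \<eta>' i (\<lambda>_ _. 1)"
      unfolding horo_mean_def mult_1_left
      by (intro nn_integral_cmult measurable_compose[OF measurable_horo_weight_coord measurable_ennreal]) auto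
    then show "horo_mean {i} W' \<eta>' i (\<lambda>t s. ennreal ((exp t * s)\<^sup>2)) \<le> horo_mean {i} W' \<eta>' i (\<lambda>_ _. ennreal c)"
      unfolding horo_mean_singleton_values(1,3)[OF a] c_def using l e by (simp add: ennreal_leI frac_le)
  qed auto
  also have "\<dots> = ennreal c * horo_mean I W \<eta> i (\<lambda>_ _. 1)"
    unfolding horo_mean_def mult_1_left
    by (intro nn_integral_cmult measurable_compose[OF measurable_horo_weight_coord measurable_ennreal]) auto
  also have "\<dots> < \<infinity>" unfolding 1 by simp
  finally show "horo_mean I W \<eta> i (\<lambda>t s. ennreal ((exp t * s)\<^sup>2)) < \<infinity>" .
  have base: "horo_mean {i} W' \<eta>' i (\<lambda>t s. ennreal (exp (2 * t))) = horo_mean {i} W' \<eta>' i (\<lambda>t s. 1 + ennreal ((exp t * s)\<^sup>2))"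
    if a: "admissible {i} W' \<eta>'" for W' \<eta>'
    using pos[OF a] by (subst horo_mean_add) (auto simp: horo_mean_singleton_values[OF a])
  have "horo_mean I W \<eta> i (\<lambda>t s. ennreal (exp (2 * t))) = horo_mean I W \<eta> i (\<lambda>t s. 1 + ennreal ((exp t * s)\<^sup>2))"
  proof (intro antisym mono[where lb="0"])
    show "horo_mean {i} W' \<eta>' i (\<lambda>t s. ennreal (exp (2 * t))) \<le> horo_mean {i} W' \<eta>' i (\<lambda>t s. 1 + ennreal ((exp t * s)\<^sup>2))"
      "horo_mean {i} W' \<eta>' i (\<lambda>t s. 1 + ennreal ((exp t * s)\<^sup>2)) \<le> horo_mean {i} W' \<eta>' i (\<lambda>t s. ennreal (exp (2 * t)))"
      if "admissible {i} W' \<eta>'" for W' \<eta>'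
      unfolding base[OF that] by simp_all
  qed (use e in \<open>auto simp: less_imp_le\<close>)
  also have "\<dots> = 1 + horo_mean I W \<eta> i (\<lambda>t s. ennreal ((exp t * s)\<^sup>2))"
    by (subst horo_mean_add[OF i]) (auto simp: 1)
  finally show "horo_mean I W \<eta> i (\<lambda>t s. ennreal (exp (2 * t))) = 1 + horo_mean I W \<eta> i (\<lambda>t s. ennreal ((exp t * s)\<^sup>2))" .
qed

section \<open>Lower bounds for the Gaussian field \<open>s\<close> at fixed
  \<open>t\<close>\<close>

lemma quad_form_nonneg:
  assumes "admissible I W \<eta>"
  shows "quad_form I W \<eta> t s \<ge> 0"
proof -
  have "W i j \<ge> 0" "\<eta> i > 0" if "i \<in> I" "j \<in> I" for i j
    using assms that unfolding admissible_def by blast+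
  then show ?thesis unfolding quad_form_def
    by (intro add_nonneg_nonneg mult_nonneg_nonneg sum_nonneg) (auto intro: less_imp_le)
qed

text \<open>A Cramer--Rao type bound: for a centred Gaussian vector with precision matrix \<open>D\<close>,
  \<open>E (v, s)\<^sup>2 = (v, D\<^sup>-\<^sup>1 v) \<ge> 2 (v, u) - (u, D u)\<close>.\<close>
lemma gauss_lower_bound:
  assumes "admissible I W \<eta>"
  shows "(\<integral>\<^sup>+\<phi>. ennreal (2 * (\<Sum>i\<in>I. v i * u i) * exp (- quad_form I W \<eta> t (\<lambda>i. \<phi> (i, 0::nat)) / 2)) \<partial>lborel_Pi (I \<times> {0}))
    \<le> (\<integral>\<^sup>+\<phi>. ennreal (((\<Sum>i\<in>I. v i * \<phi> (i, 0::nat))\<^sup>2 + quad_form I W \<eta> t u) * exp (- quad_form I W \<eta> t (\<lambda>i. \<phi> (i, 0)) / 2)) \<partial>lborel_Pi (I \<times> {0}))"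
proof -
  interpret product_sigma_finite "\<lambda>_. lborel :: real measure" by (rule product_sigma_finite_lborel)
  define Z where "Z I W \<eta> = (\<integral>\<^sup>+\<phi>. ennreal (exp (- quad_form I W \<eta> t (\<lambda>i. \<phi> (i, 0::nat)) / 2)) \<partial>lborel_Pi (I \<times> {0}))" for I :: "'a set" and W \<eta>
  define Y where "Y I W \<eta> v = (\<integral>\<^sup>+\<phi>. ennreal ((\<Sum>i\<in>I. v i * \<phi> (i, 0::nat))\<^sup>2 * exp (- quad_form I W \<eta> t (\<lambda>i. \<phi> (i, 0)) / 2)) \<partial>lborel_Pi (I \<times> {0}))" for I :: "'a set" and W \<eta> v
  have co: "(\<lambda>\<phi>. \<phi> (i, 0::nat)) \<in> borel_measurable (lborel_Pi (I \<times> {0}))" if "i \<in> I" for i and I :: "'a set"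
    by (rule measurable_coord) (use that in auto)
  have qm: "(\<lambda>\<phi>. quad_form I W \<eta> t (\<lambda>i. \<phi> (i, 0::nat))) \<in> borel_measurable (lborel_Pi (I \<times> {0}))" for I :: "'a set" and W \<eta>
    by (rule measurable_quad_form) (auto intro: co)
  have lm: "(\<lambda>\<phi>. \<Sum>i\<in>I. v i * \<phi> (i, 0::nat)) \<in> borel_measurable (lborel_Pi (I \<times> {0}))" for I :: "'a set" and v
    by (intro borel_measurable_sum borel_measurable_times borel_measurable_const co)
  \<comment> \<open>\<open>Z\<close> is the Gaussian normalisation and \<open>Y\<close> the
    unnormalised second moment of \<open>(v, s)\<close>. The claim is stated for all
    \<open>v\<close>, since each elimination changes the functional.\<close>
  have main: "ennreal (2 * (\<Sum>i\<in>I. v i * u i)) * Z I W \<eta> \<le> Y I W \<eta> v + ennreal (quad_form I W \<eta> t u) * Z I W \<eta>"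
    if "finite I" "admissible I W \<eta>" for I :: "'a set" and W \<eta> v
    using that
  proof (induction I arbitrary: W \<eta> v rule: finite_induct)
    case empty
    then show ?case by simp
  next
    case (insert N V)
    note D = admissible_insertD[OF insert.prems]
    note pp = admissible_pivot[OF insert.prems, of t]
    define p where "p = pivot V W \<eta> t N * exp (- t N)"
    define P where "P = p * exp (2 * t N)"
    define m where "m s = (\<Sum>k\<in>V. W N k * exp (t N + t k) * s k) / (p * exp (2 * t N))" for s
    define W' \<eta>' where "W' = elim_weight W N p" and "\<eta>' = elim_field W \<eta> N p"
    \<comment> \<open>Replacing \<open>s N\<close> by its conditional mean \<open>m s\<close> turns
      \<open>(v, s)\<close> into a functional of the remaining sites; \<open>v'\<close> holds its
      coefficients.\<close>
    define v' where "v' k = v k + v N * (W N k * exp (t N + t k) / P)" for k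
    have p: "p > 0" using pp by (simp add: p_def)
    have P: "P > 0" using p by (simp add: P_def)
    have adm': "admissible V W' \<eta>'" unfolding W'_def \<eta>'_def by (rule admissible_elim[OF insert.prems p])
    have q: "quad_form (insert N V) W \<eta> t s = P * (s N - m s)\<^sup>2 + quad_form V W' \<eta>' t s" for s
      unfolding P_def W'_def \<eta>'_def by (rule quad_form_elim[OF D(1) insert.hyps(2) D(3) pp p_def m_def])
    have mv: "v N * m s + (\<Sum>k\<in>V. v k * s k) = (\<Sum>k\<in>V. v' k * s k)" for s
      unfolding v'_def m_def P_def[symmetric]
      by (simp add: sum_divide_distrib sum_distrib_left sum.distrib algebra_simps)
    have m_cong: "m s = m s'" if "\<And>k. k \<in> V \<Longrightarrow> s k = s' k" for s s'
      unfolding m_def using that by simp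
    have KI: "insert N V \<times> {0::nat} = insert (N, 0) (V \<times> {0})" by auto
    note qmK [measurable] = qm[of "insert N V" W \<eta>, unfolded KI] and lmK [measurable] = lm[of v "insert N V", unfolded KI]
    note qmV [measurable] = qm[of V W' \<eta>'] and lmV [measurable] = lm[of v' V]
    have nin: "finite (V \<times> {0::nat})" "(N, 0::nat) \<notin> V \<times> {0}" using insert by auto
    have upd: "(\<lambda>i. (\<phi>((N, 0::nat) := x)) (i, 0)) N = x" "k \<in> V \<Longrightarrow> (\<lambda>i. (\<phi>((N, 0::nat) := x)) (i, 0)) k = \<phi> (k, 0)" for \<phi> :: "'a \<times> nat \<Rightarrow> real" and x k
      using insert by auto
    have qu: "quad_form (insert N V) W \<eta> t (\<lambda>i. (\<phi>((N, 0::nat) := x)) (i, 0)) = P * (x - m (\<lambda>i. \<phi> (i, 0)))\<^sup>2 + quad_form V W' \<eta>' t (\<lambda>i. \<phi> (i, 0))" for \<phi> :: "'a \<times> nat \<Rightarrow> real" and x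
    proof -
      have "m (\<lambda>i. (\<phi>((N, 0::nat) := x)) (i, 0)) = m (\<lambda>i. \<phi> (i, 0))" by (rule m_cong) (rule upd)
      moreover have "quad_form V W' \<eta>' t (\<lambda>i. (\<phi>((N, 0::nat) := x)) (i, 0)) = quad_form V W' \<eta>' t (\<lambda>i. \<phi> (i, 0))"
        by (rule quad_form_cong[OF refl]) (rule upd)
      ultimately show ?thesis unfolding q upd(1) by simp
    qed
    define C where "C = ennreal (sqrt (2 * pi / P))"
    have Z: "Z (insert N V) W \<eta> = C * Z V W' \<eta>'"
    proof -
      have "Z (insert N V) W \<eta> = (\<integral>\<^sup>+\<phi>. (\<integral>\<^sup>+x. ennreal (exp (- quad_form (insert N V) W \<eta> t (\<lambda>i. (\<phi>((N, 0::nat) := x)) (i, 0)) / 2)) \<partial>lborel) \<partial>lborel_Pi (V \<times> {0}))"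
        unfolding Z_def KI by (rule product_nn_integral_insert[OF nin]) measurable
      also have "\<dots> = (\<integral>\<^sup>+\<phi>. C * ennreal (exp (- quad_form V W' \<eta>' t (\<lambda>i. \<phi> (i, 0::nat)) / 2)) \<partial>lborel_Pi (V \<times> {0}))"
      proof (rule nn_integral_cong)
        fix \<phi> :: "'a \<times> nat \<Rightarrow> real"
        have "(\<integral>\<^sup>+x. ennreal (exp (- quad_form (insert N V) W \<eta> t (\<lambda>i. (\<phi>((N, 0::nat) := x)) (i, 0)) / 2)) \<partial>lborel)
          = (\<integral>\<^sup>+x. ennreal (exp (- quad_form V W' \<eta>' t (\<lambda>i. \<phi> (i, 0::nat)) / 2)) * ennreal (exp (- (P * (x - m (\<lambda>i. \<phi> (i, 0)))\<^sup>2) / 2)) \<partial>lborel)"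
          unfolding qu by (intro nn_integral_cong) (simp add: ennreal_mult[symmetric] exp_add[symmetric] add_divide_distrib)
        also have "\<dots> = C * ennreal (exp (- quad_form V W' \<eta>' t (\<lambda>i. \<phi> (i, 0::nat)) / 2))"
          by (subst nn_integral_cmult, simp, subst nn_integral_gauss(1)[OF P]) (simp add: C_def mult.commute)
        finally show "(\<integral>\<^sup>+x. ennreal (exp (- quad_form (insert N V) W \<eta> t (\<lambda>i. (\<phi>((N, 0::nat) := x)) (i, 0)) / 2)) \<partial>lborel) = C * ennreal (exp (- quad_form V W' \<eta>' t (\<lambda>i. \<phi> (i, 0::nat)) / 2))" .
      qed
      also have "\<dots> = C * Z V W' \<eta>'"
        unfolding Z_def by (rule nn_integral_cmult) measurable
      finally show ?thesis .
    qed
    have Y: "Y (insert N V) W \<eta> v = C * (ennreal ((v N)\<^sup>2 / P) * Z V W' \<eta>' + Y V W' \<eta>' v')"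
    proof -
      have "Y (insert N V) W \<eta> v = (\<integral>\<^sup>+\<phi>. (\<integral>\<^sup>+x. ennreal ((\<Sum>i\<in>insert N V. v i * (\<phi>((N, 0::nat) := x)) (i, 0))\<^sup>2 * exp (- quad_form (insert N V) W \<eta> t (\<lambda>i. (\<phi>((N, 0::nat) := x)) (i, 0)) / 2)) \<partial>lborel) \<partial>lborel_Pi (V \<times> {0}))"
        unfolding Y_def KI by (rule product_nn_integral_insert[OF nin]) measurable
      also have "\<dots> = (\<integral>\<^sup>+\<phi>. C * (ennreal ((v N)\<^sup>2 / P) * ennreal (exp (- quad_form V W' \<eta>' t (\<lambda>i. \<phi> (i, 0::nat)) / 2)) + ennreal ((\<Sum>k\<in>V. v' k * \<phi> (k, 0))\<^sup>2 * exp (- quad_form V W' \<eta>' t (\<lambda>i. \<phi> (i, 0::nat)) / 2))) \<partial>lborel_Pi (V \<times> {0}))"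
      proof (rule nn_integral_cong)
        fix \<phi> :: "'a \<times> nat \<Rightarrow> real"
        define E where "E = exp (- quad_form V W' \<eta>' t (\<lambda>i. \<phi> (i, 0::nat)) / 2)"
        have S: "(\<Sum>i\<in>insert N V. v i * (\<phi>((N, 0::nat) := x)) (i, 0)) = v N * x + (\<Sum>k\<in>V. v k * \<phi> (k, 0))" for x
        proof -
          have "(\<Sum>i\<in>V. v i * (\<phi>((N, 0::nat) := x)) (i, 0)) = (\<Sum>k\<in>V. v k * \<phi> (k, 0))"
            by (intro sum.cong refl) (simp only: upd)
          then show ?thesis using insert.hyps by simp
        qed
        have "(\<integral>\<^sup>+x. ennreal ((\<Sum>i\<in>insert N V. v i * (\<phi>((N, 0::nat) := x)) (i, 0))\<^sup>2 * exp (- quad_form (insert N V) W \<eta> t (\<lambda>i. (\<phi>((N, 0::nat) := x)) (i, 0)) / 2)) \<partial>lborel)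
          = (\<integral>\<^sup>+x. ennreal E * ennreal ((v N * x + (\<Sum>k\<in>V. v k * \<phi> (k, 0)))\<^sup>2 * exp (- (P * (x - m (\<lambda>i. \<phi> (i, 0)))\<^sup>2) / 2)) \<partial>lborel)"
          unfolding qu S E_def by (intro nn_integral_cong) (simp add: ennreal_mult[symmetric] exp_add[symmetric] add_divide_distrib)
        also have "\<dots> = ennreal E * ennreal (sqrt (2 * pi / P) * ((v N)\<^sup>2 / P + (v N * m (\<lambda>i. \<phi> (i, 0)) + (\<Sum>k\<in>V. v k * \<phi> (k, 0)))\<^sup>2))"
          by (subst nn_integral_cmult, simp, subst nn_integral_gauss(2)[OF P]) simp
        also have "\<dots> = C * (ennreal ((v N)\<^sup>2 / P) * ennreal E + ennreal ((\<Sum>k\<in>V. v' k * \<phi> (k, 0))\<^sup>2 * E))"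
          unfolding mv C_def using P by (simp add: ennreal_mult[symmetric] ennreal_plus[symmetric] E_def distrib_left mult_ac del: ennreal_plus)
        finally show "(\<integral>\<^sup>+x. ennreal ((\<Sum>i\<in>insert N V. v i * (\<phi>((N, 0::nat) := x)) (i, 0))\<^sup>2 * exp (- quad_form (insert N V) W \<eta> t (\<lambda>i. (\<phi>((N, 0::nat) := x)) (i, 0)) / 2)) \<partial>lborel)
           = C * (ennreal ((v N)\<^sup>2 / P) * ennreal (exp (- quad_form V W' \<eta>' t (\<lambda>i. \<phi> (i, 0::nat)) / 2)) + ennreal ((\<Sum>k\<in>V. v' k * \<phi> (k, 0))\<^sup>2 * exp (- quad_form V W' \<eta>' t (\<lambda>i. \<phi> (i, 0::nat)) / 2)))"
          unfolding E_def .
      qed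
      also have "\<dots> = C * (ennreal ((v N)\<^sup>2 / P) * Z V W' \<eta>' + Y V W' \<eta>' v')"
        unfolding Z_def Y_def
        by (subst nn_integral_cmult, measurable, subst nn_integral_add, measurable, subst nn_integral_cmult, measurable)
      finally show ?thesis .
    qed
    \<comment> \<open>The coordinate \<open>N\<close> is handled by
      \<open>2 * v N * x \<le> (v N)^2 / P + P * x^2\<close> with \<open>x = u N - m u\<close>. Its
      two terms are the conditional variance gained by \<open>Y\<close> and the square split off
      from \<open>quad_form\<close>.\<close>
    have key: "2 * (\<Sum>i\<in>insert N V. v i * u i) \<le> (v N)\<^sup>2 / P + P * (u N - m u)\<^sup>2 + 2 * (\<Sum>k\<in>V. v' k * u k)"
    proof -
      define x where "x = u N - m u"
      have "2 * v N * x \<le> (v N)\<^sup>2 / P + P * x\<^sup>2"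
      proof -
        have "0 \<le> (v N - P * x)\<^sup>2 / P" using P by simp
        also have "\<dots> = (v N)\<^sup>2 / P - 2 * v N * x + P * x\<^sup>2"
          using P by (simp add: power2_eq_square field_simps)
        finally show ?thesis by simp
      qed
      moreover have "(\<Sum>i\<in>insert N V. v i * u i) = v N * x + (\<Sum>k\<in>V. v' k * u k)"
        using insert.hyps unfolding mv[symmetric] x_def by (simp add: algebra_simps)
      ultimately show ?thesis unfolding x_def by simp
    qed
    \<comment> \<open>The embedding into \<open>ennreal\<close> cuts negative numbers off at 0, and
      the sum of \<open>v' k * u k\<close> may be negative. Passing through \<open>max 0\<close>
      makes the bound additive again.\<close>
    have "ennreal (2 * (\<Sum>i\<in>insert N V. v i * u i)) \<le> ennreal ((v N)\<^sup>2 / P) + ennreal (P * (u N - m u)\<^sup>2) + ennreal (2 * (\<Sum>k\<in>V. v' k * u k))"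
    proof -
      have "ennreal (2 * (\<Sum>i\<in>insert N V. v i * u i)) \<le> ennreal ((v N)\<^sup>2 / P + P * (u N - m u)\<^sup>2 + max 0 (2 * (\<Sum>k\<in>V. v' k * u k)))"
        using key by (intro ennreal_leI) linarith
      also have "\<dots> = ennreal ((v N)\<^sup>2 / P) + ennreal (P * (u N - m u)\<^sup>2) + ennreal (max 0 (2 * (\<Sum>k\<in>V. v' k * u k)))"
        using P by (subst ennreal_plus[symmetric] | simp)+
      also have "ennreal (max 0 (2 * (\<Sum>k\<in>V. v' k * u k))) = ennreal (2 * (\<Sum>k\<in>V. v' k * u k))"
        by (simp add: max_def ennreal_neg)
      finally show ?thesis .
    qed
    then have "ennreal (2 * (\<Sum>i\<in>insert N V. v i * u i)) * Z V W' \<eta>' \<le> (ennreal ((v N)\<^sup>2 / P) + ennreal (P * (u N - m u)\<^sup>2) + ennreal (2 * (\<Sum>k\<in>V. v' k * u k))) * Z V W' \<eta>'"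
      by (intro mult_right_mono) auto
    also have "\<dots> = (ennreal ((v N)\<^sup>2 / P) + ennreal (P * (u N - m u)\<^sup>2)) * Z V W' \<eta>' + ennreal (2 * (\<Sum>k\<in>V. v' k * u k)) * Z V W' \<eta>'"
      by (simp add: distrib_right)
    also have "\<dots> \<le> (ennreal ((v N)\<^sup>2 / P) + ennreal (P * (u N - m u)\<^sup>2)) * Z V W' \<eta>' + (Y V W' \<eta>' v' + ennreal (quad_form V W' \<eta>' t u) * Z V W' \<eta>')"
      by (intro add_left_mono insert.IH adm')
    also have "\<dots> = (ennreal ((v N)\<^sup>2 / P) * Z V W' \<eta>' + Y V W' \<eta>' v') + ennreal (quad_form (insert N V) W \<eta> t u) * Z V W' \<eta>'"
    proof -
      have "ennreal (quad_form (insert N V) W \<eta> t u) = ennreal (P * (u N - m u)\<^sup>2) + ennreal (quad_form V W' \<eta>' t u)"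
        unfolding q using P quad_form_nonneg[OF adm', of t u] by (simp add: ennreal_plus)
      then show ?thesis by (simp add: distrib_right add_ac)
    qed
    finally have "C * (ennreal (2 * (\<Sum>i\<in>insert N V. v i * u i)) * Z V W' \<eta>') \<le> C * ((ennreal ((v N)\<^sup>2 / P) * Z V W' \<eta>' + Y V W' \<eta>' v') + ennreal (quad_form (insert N V) W \<eta> t u) * Z V W' \<eta>')"
      by (intro mult_left_mono) auto
    then show ?case unfolding Z Y by (simp add: distrib_left mult_ac)
  qed
  have fin: "finite I" using assms by (simp add: admissible_def)
  note [measurable] = qm[of I W \<eta>] lm[of v I]
  have "(\<integral>\<^sup>+\<phi>. ennreal (2 * (\<Sum>i\<in>I. v i * u i) * exp (- quad_form I W \<eta> t (\<lambda>i. \<phi> (i, 0::nat)) / 2)) \<partial>lborel_Pi (I \<times> {0}))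
     = ennreal (2 * (\<Sum>i\<in>I. v i * u i)) * Z I W \<eta>"
    unfolding Z_def by (subst nn_integral_cmult[symmetric]) (measurable, auto simp: ennreal_mult'')
  moreover have "(\<integral>\<^sup>+\<phi>. ennreal (((\<Sum>i\<in>I. v i * \<phi> (i, 0::nat))\<^sup>2 + quad_form I W \<eta> t u) * exp (- quad_form I W \<eta> t (\<lambda>i. \<phi> (i, 0)) / 2)) \<partial>lborel_Pi (I \<times> {0}))
     = Y I W \<eta> v + ennreal (quad_form I W \<eta> t u) * Z I W \<eta>"
    unfolding Y_def Z_def using quad_form_nonneg[OF assms, of t u]
    by (subst nn_integral_cmult[symmetric], measurable, subst nn_integral_add[symmetric], measurable) (auto simp: distrib_right ennreal_mult intro!: nn_integral_cong)
  ultimately show ?thesis using main[OF fin assms] by simp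
qed

text \<open>With the \<open>t\<close> coordinates fixed, the Gaussian bound is used for
  \<open>v i = c i * e^(t i)\<close>, for which \<open>(v, s)\<close> is the sum of
  \<open>c i * y i\<close>, and for \<open>u = a * c\<close>. Then \<open>2 (v, u)\<close> is the
  left-hand observable, \<open>(u, D u)\<close> is \<open>a^2\<close> times the form in
  \<open>c\<close>, and the inequality is integrated over \<open>t\<close>.\<close>

lemma horo_weight_quadratic_bound:
  assumes adm: "admissible I W \<eta>" and a: "a \<ge> 0"
  shows "(\<integral>\<^sup>+\<phi>. ennreal (2 * a * (\<Sum>i\<in>I. (c i)\<^sup>2 * exp (\<phi> (i, 1::nat))) * horo_weight I W \<eta> (\<lambda>i. \<phi> (i, 1)) (\<lambda>i. \<phi> (i, 0))) \<partial>lborel_Pi (I \<times> {..<2}))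
    \<le> (\<integral>\<^sup>+\<phi>. ennreal (((\<Sum>i\<in>I. c i * (exp (\<phi> (i, 1)) * \<phi> (i, 0)))\<^sup>2 + a\<^sup>2 * quad_form I W \<eta> (\<lambda>i. \<phi> (i, 1)) c) * horo_weight I W \<eta> (\<lambda>i. \<phi> (i, 1)) (\<lambda>i. \<phi> (i, 0))) \<partial>lborel_Pi (I \<times> {..<2::nat}))"
    (is "integral\<^sup>N ?M ?l \<le> integral\<^sup>N ?M ?r")
proof -
  interpret product_sigma_finite "\<lambda>_. lborel :: real measure" by (rule product_sigma_finite_lborel)
  have fin: "finite I" using adm by (simp add: admissible_def)
  let ?T = "I \<times> {1::nat}" and ?S = "I \<times> {0::nat}"
  have TS: "I \<times> {..<2::nat} = ?T \<union> ?S" by (auto simp: numeral_2_eq_2 less_Suc_eq)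
  have dj: "?T \<inter> ?S = {}" "finite ?T" "finite ?S" using fin by auto
  have co: "(\<lambda>\<phi>. \<phi> (i, r)) \<in> borel_measurable (lborel_Pi (I \<times> {..<2::nat}))" if "i \<in> I" "r < 2" for i r
    by (rule measurable_coord) (use that in auto)
  have [measurable]: "(\<lambda>\<phi>. horo_weight I W \<eta> (\<lambda>i. \<phi> (i, 1::nat)) (\<lambda>i. \<phi> (i, 0))) \<in> borel_measurable ?M"
    by (rule measurable_horo_weight_coord) auto
  have [measurable]: "(\<lambda>\<phi>. quad_form I W \<eta> (\<lambda>i. \<phi> (i, 1::nat)) c) \<in> borel_measurable ?M"
    by (rule measurable_quad_form) (auto intro: co)
  have [measurable]: "(\<lambda>\<phi>. \<Sum>i\<in>I. c i * (exp (\<phi> (i, 1::nat)) * \<phi> (i, 0))) \<in> borel_measurable ?M"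
    by (intro borel_measurable_sum borel_measurable_times borel_measurable_const borel_measurable_exp[THEN measurable_compose[rotated]] co) auto
  have [measurable]: "(\<lambda>\<phi>. \<Sum>i\<in>I. (c i)\<^sup>2 * exp (\<phi> (i, 1::nat))) \<in> borel_measurable ?M"
    by (intro borel_measurable_sum borel_measurable_times borel_measurable_const borel_measurable_exp[THEN measurable_compose[rotated]] co) auto
  have lm: "?l \<in> borel_measurable ?M" and rm: "?r \<in> borel_measurable ?M" by measurable
  have "(\<integral>\<^sup>+y. ?l (merge ?T ?S (x, y)) \<partial>lborel_Pi ?S) \<le> (\<integral>\<^sup>+y. ?r (merge ?T ?S (x, y)) \<partial>lborel_Pi ?S)" for x :: "'a \<times> nat \<Rightarrow> real"
  proof -
    define t where "t i = x (i, 1)" for i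
    define B where "B = exp (- energy I W \<eta> t) * (\<Prod>i\<in>I. exp (- t i)) * det_on I (dmat I W \<eta> t) / (2 * pi) ^ card I"
    have B: "B > 0" unfolding B_def by (intro divide_pos_pos mult_pos_pos prod_pos det_dmat_pos adm) auto
    have mg: "merge ?T ?S (x, y) (i, 1) = t i" "merge ?T ?S (x, y) (i, 0) = y (i, 0)" if "i \<in> I" for i and y :: "'a \<times> nat \<Rightarrow> real"
      using that by (auto simp: merge_def t_def)
    have sw: "horo_weight I W \<eta> (\<lambda>i. merge ?T ?S (x, y) (i, 1)) (\<lambda>i. merge ?T ?S (x, y) (i, 0)) = B * exp (- quad_form I W \<eta> t (\<lambda>i. y (i, 0)) / 2)" for y
    proof -
      have "horo_weight I W \<eta> (\<lambda>i. merge ?T ?S (x, y) (i, 1)) (\<lambda>i. merge ?T ?S (x, y) (i, 0)) = horo_weight I W \<eta> t (\<lambda>i. y (i, 0))"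
        by (rule horo_weight_cong) (rule mg, assumption)+
      then show ?thesis unfolding horo_weight_def B_def by simp
    qed
    have qc: "quad_form I W \<eta> (\<lambda>i. merge ?T ?S (x, y) (i, 1)) c = quad_form I W \<eta> t c" for y
      by (rule quad_form_cong) (rule mg, assumption, rule refl)
    have qa: "a\<^sup>2 * quad_form I W \<eta> t c = quad_form I W \<eta> t (\<lambda>i. a * c i)"
      unfolding quad_form_def right_diff_distrib[symmetric] power_mult_distrib
      by (simp add: distrib_left sum_distrib_left mult_ac)
    have co': "(\<lambda>\<phi>. \<phi> (i, 0::nat)) \<in> borel_measurable (lborel_Pi ?S)" if "i \<in> I" for i
      by (rule measurable_coord) (use that in auto)
    have [measurable]: "(\<lambda>\<phi>. quad_form I W \<eta> t (\<lambda>i. \<phi> (i, 0::nat))) \<in> borel_measurable (lborel_Pi ?S)"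
      by (rule measurable_quad_form) (auto intro: co')
    have [measurable]: "(\<lambda>\<phi>. \<Sum>i\<in>I. (c i * exp (t i)) * \<phi> (i, 0::nat)) \<in> borel_measurable (lborel_Pi ?S)"
      by (intro borel_measurable_sum borel_measurable_times borel_measurable_const co')
    have "(\<integral>\<^sup>+y. ?l (merge ?T ?S (x, y)) \<partial>lborel_Pi ?S) =
        (\<integral>\<^sup>+y. ennreal B * ennreal (2 * (\<Sum>i\<in>I. (c i * exp (t i)) * (a * c i)) * exp (- quad_form I W \<eta> t (\<lambda>i. y (i, 0::nat)) / 2)) \<partial>lborel_Pi ?S)"
    proof (rule nn_integral_cong)
      fix y :: "'a \<times> nat \<Rightarrow> real"
      have "(\<Sum>i\<in>I. (c i)\<^sup>2 * exp (merge ?T ?S (x, y) (i, 1))) = (\<Sum>i\<in>I. (c i)\<^sup>2 * exp (t i))"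
        by (intro sum.cong refl) (simp only: mg)
      then have h: "2 * a * (\<Sum>i\<in>I. (c i)\<^sup>2 * exp (merge ?T ?S (x, y) (i, 1))) = 2 * (\<Sum>i\<in>I. (c i * exp (t i)) * (a * c i))"
        by (simp add: sum_distrib_left power2_eq_square mult_ac)
      show "?l (merge ?T ?S (x, y)) = ennreal B * ennreal (2 * (\<Sum>i\<in>I. (c i * exp (t i)) * (a * c i)) * exp (- quad_form I W \<eta> t (\<lambda>i. y (i, 0::nat)) / 2))"
        unfolding sw h using B by (subst ennreal_mult'[symmetric]) (auto simp: mult_ac)
    qed
    also have "\<dots> = ennreal B * (\<integral>\<^sup>+y. ennreal (2 * (\<Sum>i\<in>I. (c i * exp (t i)) * (a * c i)) * exp (- quad_form I W \<eta> t (\<lambda>i. y (i, 0::nat)) / 2)) \<partial>lborel_Pi ?S)"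
      by (rule nn_integral_cmult) measurable
    also have "\<dots> \<le> ennreal B * (\<integral>\<^sup>+y. ennreal (((\<Sum>i\<in>I. (c i * exp (t i)) * y (i, 0::nat))\<^sup>2 + quad_form I W \<eta> t (\<lambda>i. a * c i)) * exp (- quad_form I W \<eta> t (\<lambda>i. y (i, 0)) / 2)) \<partial>lborel_Pi ?S)"
      by (intro mult_left_mono gauss_lower_bound adm) auto
    also have "\<dots> = (\<integral>\<^sup>+y. ennreal B * ennreal (((\<Sum>i\<in>I. (c i * exp (t i)) * y (i, 0::nat))\<^sup>2 + quad_form I W \<eta> t (\<lambda>i. a * c i)) * exp (- quad_form I W \<eta> t (\<lambda>i. y (i, 0)) / 2)) \<partial>lborel_Pi ?S)"
      by (rule nn_integral_cmult[symmetric]) measurable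
    also have "\<dots> = (\<integral>\<^sup>+y. ?r (merge ?T ?S (x, y)) \<partial>lborel_Pi ?S)"
    proof (rule nn_integral_cong)
      fix y :: "'a \<times> nat \<Rightarrow> real"
      have h: "(\<Sum>i\<in>I. c i * (exp (merge ?T ?S (x, y) (i, 1)) * merge ?T ?S (x, y) (i, 0))) = (\<Sum>i\<in>I. (c i * exp (t i)) * y (i, 0))"
        by (intro sum.cong refl) (simp only: mg mult.assoc)
      show "ennreal B * ennreal (((\<Sum>i\<in>I. (c i * exp (t i)) * y (i, 0::nat))\<^sup>2 + quad_form I W \<eta> t (\<lambda>i. a * c i)) * exp (- quad_form I W \<eta> t (\<lambda>i. y (i, 0)) / 2)) = ?r (merge ?T ?S (x, y))"
        unfolding sw qc qa h using B by (subst ennreal_mult'[symmetric]) (auto simp: mult_ac)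
    qed
    finally show ?thesis .
  qed
  then show ?thesis
    unfolding TS product_nn_integral_fold[OF dj lm[unfolded TS]] product_nn_integral_fold[OF dj rm[unfolded TS]]
    by (rule nn_integral_mono)
qed

subsection \<open>Fourier analysis on the torus\<close>

lemma finite_torus [simp]: "finite (torus d L)"
  by (simp add: torus_def finite_PiE)

lemma torigin_in_torus: "L \<ge> 1 \<Longrightarrow> torigin d \<in> torus d L"
  by (auto simp: torus_def torigin_def)

lemma tadd_in_torus: "L \<ge> 1 \<Longrightarrow> tadd d L a b \<in> torus d L"
  by (auto simp: torus_def tadd_def)

lemma tadd_torigin: "a \<in> torus d L \<Longrightarrow> tadd d L (torigin d) a = a"
  by (rule ext) (auto simp: torus_def tadd_def torigin_def PiE_def extensional_def Pi_def restrict_def)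

lemma bij_betw_tadd:
  assumes "L \<ge> 1" "k \<in> torus d L"
  shows "bij_betw (\<lambda>j. tadd d L j k) (torus d L) (torus d L)"
proof -
  have "inj_on (\<lambda>j. tadd d L j k) (torus d L)"
  proof (rule inj_onI)
    fix a b assume a: "a \<in> torus d L" and b: "b \<in> torus d L" and e: "tadd d L a k = tadd d L b k"
    show "a = b"
    proof (rule PiE_ext[of _ "{..<d}" "\<lambda>_. {..<L}"])
      show "a \<in> PiE {..<d} (\<lambda>_. {..<L})" "b \<in> PiE {..<d} (\<lambda>_. {..<L})" using a b by (auto simp: torus_def)
      fix i assume i: "i \<in> {..<d}"
      have "(a i + k i) mod L = (b i + k i) mod L" using fun_cong[OF e, of i] i by (simp add: tadd_def)
      moreover have "a i < L" "b i < L" "k i < L" using a b assms(2) i by (auto simp: torus_def PiE_def Pi_def)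
      ultimately show "a i = b i" by (auto simp: mod_if split: if_splits)
    qed
  qed
  moreover have "(\<lambda>j. tadd d L j k) ` torus d L \<subseteq> torus d L" using tadd_in_torus[OF assms(1)] by auto
  ultimately show ?thesis using endo_inj_surj[OF finite_torus] by (auto simp: bij_betw_def)
qed

lemma cis_pdot_tadd:
  assumes "L \<ge> 1"
  shows "cis (pdot d L k (tadd d L a b)) = cis (pdot d L k a) * cis (pdot d L k b)"
proof -
  \<comment> \<open>The total carry: reducing \<open>a i + b i\<close> modulo \<open>L\<close> drops
    a multiple of \<open>L\<close>, and \<open>L\<close> times the \<open>i\<close>-th component of
    the momentum is \<open>2 pi * k i\<close>. The phase therefore changes by
    \<open>2 pi * n\<close>.\<close>
  define n where "n = (\<Sum>i<d. k i * ((a i + b i) div L))"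
  have "pdot d L k a + pdot d L k b = pdot d L k (tadd d L a b) + 2 * pi * real n"
  proof -
    have "2 * pi * real (k i) / real L * real (a i) + 2 * pi * real (k i) / real L * real (b i)
      = 2 * pi * real (k i) / real L * real (tadd d L a b i) + 2 * pi * real (k i * ((a i + b i) div L))" if "i < d" for i
    proof -
      have "real (a i) + real (b i) = real ((a i + b i) mod L) + real L * real ((a i + b i) div L)"
        by (metis add.commute mult_div_mod_eq of_nat_add of_nat_mult)
      then have "real (a i) + real (b i) = real (tadd d L a b i) + real L * real ((a i + b i) div L)"
        using that by (simp add: tadd_def)
      then have "2 * pi * real (k i) / real L * (real (a i) + real (b i)) = 2 * pi * real (k i) / real L * (real (tadd d L a b i) + real L * real ((a i + b i) div L))"
        by simp
      then show ?thesis using assms by (simp add: distrib_left)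
    qed
    then show ?thesis unfolding pdot_def n_def
      by (simp add: sum.distrib[symmetric] sum_distrib_left)
  qed
  then have "cis (pdot d L k a) * cis (pdot d L k b) = cis (pdot d L k (tadd d L a b)) * cis (2 * pi * real n)"
    by (simp only: cis_mult)
  also have "cis (2 * pi * real n) = 1" using cis_multiple_2pi[of "real n"] by simp
  finally show ?thesis by simp
qed

text \<open>Shifting the summation variable by \<open>l\<close> shows that the inner sum does not
  depend on \<open>l\<close>. The number of sites appears as a common factor in all terms of the
  infrared bound and is divided out there.\<close>

lemma translation_invariant_double_sum:
  fixes f :: "site \<Rightarrow> site \<Rightarrow> complex"
  assumes L: "L \<ge> 1"
    and f: "\<And>i j k. i \<in> torus d L \<Longrightarrow> j \<in> torus d L \<Longrightarrow> k \<in> torus d L \<Longrightarrow> f (tadd d L i k) (tadd d L j k) = f i j"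
  shows "(\<Sum>l\<in>torus d L. \<Sum>j\<in>torus d L. f j l) = of_nat (card (torus d L)) * (\<Sum>j\<in>torus d L. f j (torigin d))"
proof -
  have "(\<Sum>j\<in>torus d L. f j l) = (\<Sum>j\<in>torus d L. f j (torigin d))" if l: "l \<in> torus d L" for l
  proof -
    have "(\<Sum>j\<in>torus d L. f j l) = (\<Sum>j\<in>torus d L. f (tadd d L j l) l)"
      using sum.reindex_bij_betw[OF bij_betw_tadd[OF L l], of "\<lambda>j. f j l"] by simp
    also have "\<dots> = (\<Sum>j\<in>torus d L. f (tadd d L j l) (tadd d L (torigin d) l))"
      using tadd_torigin[OF l] by simp
    also have "\<dots> = (\<Sum>j\<in>torus d L. f j (torigin d))"
      by (intro sum.cong refl f torigin_in_torus L l)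
    finally show ?thesis .
  qed
  then show ?thesis by simp
qed

text \<open>The test vectors \<open>c = cos (p \<cdot> j)\<close> and \<open>c = sin (p \<cdot> j)\<close> together play the role of \<open>e\<^sup>i\<^sup>p\<^sup>j\<close>.\<close>
lemma infrared_bound:
  fixes g :: "site \<Rightarrow> site \<Rightarrow> real"
  assumes L: "L \<ge> 1"
    and g_sym: "\<And>i j. g i j = g j i"
    and g_inv: "\<And>i j k. i \<in> torus d L \<Longrightarrow> j \<in> torus d L \<Longrightarrow> k \<in> torus d L \<Longrightarrow> g (tadd d L i k) (tadd d L j k) = g i j"
    and \<beta>: "\<forall>i\<in>torus d L. \<forall>j\<in>torus d L. \<beta> i j = \<beta> j i \<and> \<beta> i j \<ge> 0"
    and \<beta>_inv: "translation_invariant d L \<beta>"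
    and h: "h > 0" and b: "b \<ge> 1" and A: "A \<ge> 0"
    and main: "\<And>(c :: site \<Rightarrow> real) a. a \<ge> 0 \<Longrightarrow> 2 * a * b * (\<Sum>j\<in>torus d L. (c j)\<^sup>2) \<le>
       (\<Sum>l\<in>torus d L. \<Sum>j\<in>torus d L. c j * c l * g j l)
       + a\<^sup>2 * (A * ((1/2) * (\<Sum>l\<in>torus d L. \<Sum>j\<in>torus d L. \<beta> j l * (c j - c l)\<^sup>2)) + h * b * (\<Sum>j\<in>torus d L. (c j)\<^sup>2))"
  shows "Im (fourier d L (g (torigin d)) k) = 0 \<and> Re (fourier d L (g (torigin d)) k) \<ge> 1 / (A * lam d L \<beta> k + h)"
proof -
  let ?T = "torus d L" and ?p = "pdot d L k"
  define N where "N = real (card ?T)"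
  have "?T \<noteq> {}" using torigin_in_torus[OF L] by auto
  then have N: "N > 0" unfolding N_def by (simp add: card_gt_0_iff)
  have o: "torigin d \<in> ?T" by (rule torigin_in_torus[OF L])
  have cd: "cis (?p (tadd d L i m) - ?p (tadd d L j m)) = cis (?p i - ?p j)" for i j m
  proof -
    have "cis (?p (tadd d L i m) - ?p (tadd d L j m)) = (cis (?p i) * cis (?p m)) / (cis (?p j) * cis (?p m))"
      by (simp only: cis_divide[symmetric] cis_pdot_tadd[OF L])
    also have "\<dots> = cis (?p i) / cis (?p j)" by simp
    finally show ?thesis by (simp only: cis_divide)
  qed
  have p0: "?p (torigin d) = 0" by (simp add: pdot_def torigin_def)
  have F: "(\<Sum>l\<in>?T. \<Sum>j\<in>?T. complex_of_real (g j l) * cis (?p j - ?p l)) = of_real N * fourier d L (g (torigin d)) k"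
    unfolding fourier_def N_def
    by (subst translation_invariant_double_sum[OF L]) (auto simp: g_inv cd p0 g_sym)
  have "of_real N * fourier d L (g (torigin d)) k = (\<Sum>l\<in>?T. \<Sum>j\<in>?T. complex_of_real (g j l) * cis (?p j - ?p l))"
    using F by simp
  then have "Re (of_real N * fourier d L (g (torigin d)) k) = (\<Sum>l\<in>?T. \<Sum>j\<in>?T. g j l * cos (?p j - ?p l))"
    and "Im (of_real N * fourier d L (g (torigin d)) k) = (\<Sum>l\<in>?T. \<Sum>j\<in>?T. g j l * sin (?p j - ?p l))"
    by simp_all
  then have re: "(\<Sum>l\<in>?T. \<Sum>j\<in>?T. g j l * cos (?p j - ?p l)) = N * Re (fourier d L (g (torigin d)) k)"
    and im: "N * Im (fourier d L (g (torigin d)) k) = (\<Sum>l\<in>?T. \<Sum>j\<in>?T. g j l * sin (?p j - ?p l))" by simp_all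
  \<comment> \<open>Exchanging \<open>j\<close> and \<open>l\<close> reverses the sine and preserves
    \<open>g\<close>, so the imaginary part is its own negative.\<close>
  have "(\<Sum>l\<in>?T. \<Sum>j\<in>?T. g j l * sin (?p j - ?p l)) = (\<Sum>l\<in>?T. \<Sum>j\<in>?T. - (g j l * sin (?p j - ?p l)))"
    by (subst sum.swap) (intro sum.cong refl, simp add: g_sym sin_diff algebra_simps)
  then have "(\<Sum>l\<in>?T. \<Sum>j\<in>?T. g j l * sin (?p j - ?p l)) = 0" by (simp add: sum_negf)
  then have Im0: "Im (fourier d L (g (torigin d)) k) = 0" using im N by simp
  have la: "(\<Sum>l\<in>?T. \<Sum>j\<in>?T. \<beta> j l * (1 - cos (?p j - ?p l))) = N * lam d L \<beta> k"
  proof -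
    let ?f = "\<lambda>j l. complex_of_real (\<beta> j l) * (1 - cis (?p j - ?p l))"
    have "(\<Sum>l\<in>?T. \<Sum>j\<in>?T. ?f j l) = of_nat (card ?T) * (\<Sum>j\<in>?T. ?f j (torigin d))"
      by (rule translation_invariant_double_sum[OF L]) (use \<beta>_inv in \<open>auto simp: cd translation_invariant_def\<close>)
    then have "Re (\<Sum>l\<in>?T. \<Sum>j\<in>?T. ?f j l) = Re (of_nat (card ?T) * (\<Sum>j\<in>?T. ?f j (torigin d)))" by simp
    then have "(\<Sum>l\<in>?T. \<Sum>j\<in>?T. \<beta> j l * (1 - cos (?p j - ?p l))) = N * (\<Sum>j\<in>?T. \<beta> j (torigin d) * (1 - cos (?p j)))"
      by (simp add: p0 N_def)
    also have "(\<Sum>j\<in>?T. \<beta> j (torigin d) * (1 - cos (?p j))) = lam d L \<beta> k"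
      unfolding lam_def
    proof (intro sum.cong refl)
      fix j assume "j \<in> ?T"
      then have "\<beta> j (torigin d) = \<beta> (torigin d) j" using \<beta> o by blast
      then show "\<beta> j (torigin d) * (1 - cos (?p j)) = \<beta> (torigin d) j * (1 - cos (?p j))" by simp
    qed
    finally show ?thesis .
  qed
  have lam0: "lam d L \<beta> k \<ge> 0"
    unfolding lam_def using \<beta> o by (intro sum_nonneg mult_nonneg_nonneg) auto
  let ?R = "Re (fourier d L (g (torigin d)) k)" and ?l = "lam d L \<beta> k"
  \<comment> \<open>The hypothesis \<open>main\<close> is added for the cosine and the sine vector.
    The squares sum to 1 at each site and the squared differences to
    \<open>2 * (1 - cos (p j - p l))\<close>, so every term is \<open>N\<close> times a quantity at
    the origin.\<close>
  have quad: "2 * a * b \<le> ?R + a\<^sup>2 * (A * ?l + h * b)" if a: "a \<ge> 0" for a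
  proof -
    let ?c = "\<lambda>j. cos (?p j)" and ?s = "\<lambda>j. sin (?p j)"
    have 1: "(\<Sum>j\<in>?T. (?c j)\<^sup>2) + (\<Sum>j\<in>?T. (?s j)\<^sup>2) = N"
      by (simp add: sum.distrib[symmetric] N_def)
    have 2: "(\<Sum>l\<in>?T. \<Sum>j\<in>?T. ?c j * ?c l * g j l) + (\<Sum>l\<in>?T. \<Sum>j\<in>?T. ?s j * ?s l * g j l) = N * ?R"
      unfolding re[symmetric] by (simp add: sum.distrib[symmetric] cos_diff algebra_simps)
    have 3: "(\<Sum>l\<in>?T. \<Sum>j\<in>?T. \<beta> j l * (?c j - ?c l)\<^sup>2) + (\<Sum>l\<in>?T. \<Sum>j\<in>?T. \<beta> j l * (?s j - ?s l)\<^sup>2) = 2 * (N * ?l)"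
    proof -
      have "(?c j - ?c l)\<^sup>2 + (?s j - ?s l)\<^sup>2 = 2 * (1 - cos (?p j - ?p l))" for j l
        by (simp add: sin_squared_eq cos_diff power2_diff)
      then have "\<beta> j l * (?c j - ?c l)\<^sup>2 + \<beta> j l * (?s j - ?s l)\<^sup>2 = 2 * (\<beta> j l * (1 - cos (?p j - ?p l)))" for j l
        by (simp only: distrib_left[symmetric] mult_ac)
      then show ?thesis unfolding la[symmetric] sum_distrib_left sum.distrib[symmetric] by (intro sum.cong refl)
    qed
    note m = add_mono[OF main[OF a, of ?c] main[OF a, of ?s]]
    have "2 * a * b * N \<le> N * ?R + a\<^sup>2 * (A * ((1/2) * (2 * (N * ?l))) + h * b * N)"
    proof -
      have "2 * a * b * N \<le> N * ?R + a\<^sup>2 * (A * ((1/2) * (2 * (N * ?l))) + h * b * N)"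
        if x: "x1 + x2 = N" and y: "y1 + y2 = N * ?R" and z: "z1 + z2 = 2 * (N * ?l)"
          and m: "2 * a * b * x1 + 2 * a * b * x2 \<le> (y1 + a\<^sup>2 * (A * ((1/2) * z1) + h * b * x1)) + (y2 + a\<^sup>2 * (A * ((1/2) * z2) + h * b * x2))"
        for x1 x2 y1 y2 z1 z2
      proof -
        have e: "x2 = N - x1" "y2 = N * ?R - y1" "z2 = 2 * (N * ?l) - z1" using x y z by simp_all
        show ?thesis using m unfolding e by (simp add: algebra_simps)
      qed
      from this[OF 1 2 3 m] show ?thesis .
    qed
    then have "N * (2 * a * b) \<le> N * (?R + a\<^sup>2 * (A * ?l + h * b))"
      by (simp add: algebra_simps)
    then show ?thesis using N by simp
  qed
  \<comment> \<open>\<open>D\<close> is the coefficient of \<open>a^2\<close>, and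
    \<open>a = b / D\<close> maximises \<open>2 * a * b - a^2 * D\<close>, with value
    \<open>b^2 / D\<close>. Since \<open>b \<ge> 1\<close> implies \<open>b \<le> b^2\<close>, also
    \<open>D \<le> b^2 * (A * lam + h)\<close>, and \<open>b\<close> disappears from the final
    bound.\<close>
  define D where "D = A * ?l + h * b"
  have D: "D > 0" unfolding D_def using A lam0 h b by (intro add_nonneg_pos mult_nonneg_nonneg mult_pos_pos) auto
  have "b\<^sup>2 / D \<le> ?R"
    using quad[of "b / D"] D b unfolding D_def[symmetric] by (simp add: power2_eq_square field_simps)
  moreover have "1 / (A * ?l + h) \<le> b\<^sup>2 / D"
  proof -
    have b2: "b \<le> b\<^sup>2" "1 \<le> b\<^sup>2" using b by (auto simp: power2_eq_square intro: mult_mono[of 1 b 1 b, simplified])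
    have "D \<le> b\<^sup>2 * (A * ?l) + b\<^sup>2 * h"
      unfolding D_def using b2 A lam0 h by (intro add_mono mult_right_mono[of 1 "b\<^sup>2", simplified] mult_nonneg_nonneg) (auto simp: mult.commute)
    then have "1 * D \<le> b\<^sup>2 * (A * ?l + h)" by (simp add: distrib_left)
    moreover have "A * ?l + h > 0" using A lam0 h by (intro add_nonneg_pos mult_nonneg_nonneg)
    ultimately show ?thesis using D by (simp add: divide_simps mult_ac)
  qed
  ultimately show ?thesis using Im0 by linarith
qed

section \<open>Permutations of the coordinates of a product Lebesgue measure\<close>

text \<open>It suffices to test measurable boxes: the preimage of a box is the box whose sides
  \<open>B\<close> are the sides \<open>A\<close> permuted by the inverse of \<open>f\<close>, and
  the product of the side measures is unchanged.\<close>

lemma PiM_lborel_reindex: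
  assumes K: "finite K" and f: "bij_betw f K K"
  shows "distr (lborel_Pi K) (lborel_Pi K) (\<lambda>\<phi>. \<lambda>n\<in>K. \<phi> (f n)) = lborel_Pi K"
proof -
  interpret product_sigma_finite "\<lambda>_. lborel :: real measure" by (rule product_sigma_finite_lborel)
  have fK: "f n \<in> K" if "n \<in> K" for n using f that by (auto simp: bij_betw_def)
  have m: "(\<lambda>\<phi>. \<lambda>n\<in>K. \<phi> (f n)) \<in> lborel_Pi K \<rightarrow>\<^sub>M lborel_Pi K"
    by (intro measurable_restrict measurable_component_singleton fK)
  show ?thesis
  proof (rule PiM_eqI[OF K])
    fix A assume A: "\<And>i. i \<in> K \<Longrightarrow> A i \<in> sets (lborel :: real measure)"
    define B where "B i = A (the_inv_into K f i)" for i
    have inv: "the_inv_into K f (f i) = i" "the_inv_into K f i \<in> K" "f (the_inv_into K f i) = i" if "i \<in> K" for i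
      using that f the_inv_into_f_f[of f K i] f_the_inv_into_f_bij_betw[OF f] the_inv_into_into[of f K i K]
      by (auto simp: bij_betw_def)
    have pre: "(\<lambda>\<phi>. \<lambda>n\<in>K. \<phi> (f n)) -` (Pi\<^sub>E K A) \<inter> space (lborel_Pi K) = Pi\<^sub>E K B"
    proof (intro set_eqI iffI)
      fix \<phi> assume "\<phi> \<in> (\<lambda>\<phi>. \<lambda>n\<in>K. \<phi> (f n)) -` (Pi\<^sub>E K A) \<inter> space (lborel_Pi K)"
      then have e: "\<phi> \<in> extensional K" and 1: "\<And>n. n \<in> K \<Longrightarrow> \<phi> (f n) \<in> A n"
        by (auto simp: space_PiM PiE_def Pi_def)
      have "\<phi> i \<in> B i" if "i \<in> K" for i using 1[OF inv(2)[OF that]] inv(3)[OF that] by (simp add: B_def)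
      then show "\<phi> \<in> Pi\<^sub>E K B" using e by (auto simp: PiE_def)
    next
      fix \<phi> assume p: "\<phi> \<in> Pi\<^sub>E K B"
      then have "\<phi> (f n) \<in> A n" if "n \<in> K" for n
        using PiE_mem[OF p fK[OF that]] inv(1)[OF that] by (simp add: B_def)
      then show "\<phi> \<in> (\<lambda>\<phi>. \<lambda>n\<in>K. \<phi> (f n)) -` (Pi\<^sub>E K A) \<inter> space (lborel_Pi K)"
        using p by (auto simp: space_PiM PiE_def Pi_def)
    qed
    have B: "B i \<in> sets lborel" if "i \<in> K" for i using A inv(2)[OF that] by (simp add: B_def)
    have "emeasure (distr (lborel_Pi K) (lborel_Pi K) (\<lambda>\<phi>. \<lambda>n\<in>K. \<phi> (f n))) (Pi\<^sub>E K A) = emeasure (lborel_Pi K) (Pi\<^sub>E K B)"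
      using A K m by (subst emeasure_distr) (auto simp: pre intro!: sets_PiM_I_finite)
    also have "\<dots> = (\<Prod>i\<in>K. emeasure lborel (B i))" using K B by (intro emeasure_PiM) auto
    also have "\<dots> = (\<Prod>i\<in>K. emeasure lborel (B (f i)))"
      using prod.reindex_bij_betw[OF f, of "\<lambda>i. emeasure lborel (B i)"] by simp
    also have "\<dots> = (\<Prod>i\<in>K. emeasure lborel (A i))"
      by (intro prod.cong refl) (simp add: B_def inv)
    finally show "emeasure (distr (lborel_Pi K) (lborel_Pi K) (\<lambda>\<phi>. \<lambda>n\<in>K. \<phi> (f n))) (Pi\<^sub>E K A) = (\<Prod>i\<in>K. emeasure lborel (A i))" .
  qed simp
qed

lemma PiM_integral_reindex:
  fixes F F' :: "('a \<Rightarrow> real) \<Rightarrow> real"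
  assumes K: "finite K" and f: "bij_betw f K K" and F: "F \<in> borel_measurable (lborel_Pi K)"
    and F': "\<And>\<phi>. F (\<lambda>n\<in>K. \<phi> (f n)) = F' \<phi>"
  shows "(\<integral>\<phi>. F' \<phi> \<partial>lborel_Pi K) = (\<integral>\<phi>. F \<phi> \<partial>lborel_Pi K)"
proof -
  have fK: "f n \<in> K" if "n \<in> K" for n using f that by (auto simp: bij_betw_def)
  have m: "(\<lambda>\<phi>. \<lambda>n\<in>K. \<phi> (f n)) \<in> lborel_Pi K \<rightarrow>\<^sub>M lborel_Pi K"
    by (intro measurable_restrict measurable_component_singleton fK)
  have "(\<integral>\<phi>. F \<phi> \<partial>lborel_Pi K) = (\<integral>\<phi>. F \<phi> \<partial>distr (lborel_Pi K) (lborel_Pi K) (\<lambda>\<phi>. \<lambda>n\<in>K. \<phi> (f n)))"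
    unfolding PiM_lborel_reindex[OF K f] ..
  also have "\<dots> = (\<integral>\<phi>. F (\<lambda>n\<in>K. \<phi> (f n)) \<partial>lborel_Pi K)"
    by (rule integral_distr[OF m F])
  finally show ?thesis unfolding F' by simp
qed

subsection \<open>The supersymmetric model\<close>

text \<open>Conjugation by \<open>\<pi>\<close> is a sign-preserving bijection of the permutations
  of \<open>I\<close>.\<close>

lemma det_on_reindex:
  assumes \<pi>: "\<pi> permutes I" and I: "finite I"
  shows "det_on I (\<lambda>i j. M (\<pi> i) (\<pi> j)) = det_on I M"
proof -
  let ?c = "\<lambda>\<sigma>. \<pi> \<circ> \<sigma> \<circ> inv \<pi>"
  have b: "bij_betw ?c {\<sigma>. \<sigma> permutes I} {\<sigma>. \<sigma> permutes I}"
  proof (rule bij_betwI[where g="\<lambda>\<sigma>. inv \<pi> \<circ> \<sigma> \<circ> \<pi>"])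
    show "?c \<in> {\<sigma>. \<sigma> permutes I} \<rightarrow> {\<sigma>. \<sigma> permutes I}" "(\<lambda>\<sigma>. inv \<pi> \<circ> \<sigma> \<circ> \<pi>) \<in> {\<sigma>. \<sigma> permutes I} \<rightarrow> {\<sigma>. \<sigma> permutes I}"
      using \<pi> by (auto intro!: permutes_compose permutes_inv)
  qed (auto simp: fun_eq_iff permutes_inverses[OF \<pi>])
  have "det_on I M = (\<Sum>\<sigma>\<in>{\<sigma>. \<sigma> permutes I}. of_int (sign (?c \<sigma>)) * (\<Prod>i\<in>I. M i (?c \<sigma> i)))"
    unfolding det_on_def by (rule sum.reindex_bij_betw[OF b, symmetric])
  also have "\<dots> = (\<Sum>\<sigma>\<in>{\<sigma>. \<sigma> permutes I}. of_int (sign \<sigma>) * (\<Prod>i\<in>I. M (\<pi> i) (\<pi> (\<sigma> i))))"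
  proof (intro sum.cong refl)
    fix \<sigma> assume "\<sigma> \<in> {\<sigma>. \<sigma> permutes I}"
    then have \<sigma>: "permutation \<sigma>" "permutation \<pi>" "permutation (inv \<pi>)" using \<pi> I
      by (auto intro: permutation_permutes[THEN iffD2] permutes_inv)
    have "sign (?c \<sigma>) = sign \<sigma>"
      using \<sigma> by (simp add: sign_compose permutation_compose sign_inverse)
    moreover have "(\<Prod>i\<in>I. M i (?c \<sigma> i)) = (\<Prod>i\<in>I. M (\<pi> i) (?c \<sigma> (\<pi> i)))"
      using prod.permute[OF \<pi>, of "\<lambda>i. M i (?c \<sigma> i)"] by (simp add: o_def)
    ultimately show "of_int (sign (?c \<sigma>)) * (\<Prod>i\<in>I. M i (?c \<sigma> i)) = of_int (sign \<sigma>) * (\<Prod>i\<in>I. M (\<pi> i) (\<pi> (\<sigma> i)))"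
      by (simp add: permutes_inverses[OF \<pi>])
  qed
  finally show ?thesis by (simp add: det_on_def)
qed

lemma horo_weight_reindex:
  assumes \<pi>: "\<pi> permutes I" and I: "finite I"
    and W: "\<And>i j. i \<in> I \<Longrightarrow> j \<in> I \<Longrightarrow> W (\<pi> i) (\<pi> j) = W i j" and \<eta>: "\<And>i. i \<in> I \<Longrightarrow> \<eta> (\<pi> i) = \<eta> i"
  shows "horo_weight I W \<eta> (\<lambda>i. t (\<pi> i)) (\<lambda>i. s (\<pi> i)) = horo_weight I W \<eta> t s"
proof -
  have b: "bij_betw \<pi> I I" using \<pi> by (rule permutes_imp_bij)
  have r1: "(\<Sum>i\<in>I. f (\<pi> i)) = (\<Sum>i\<in>I. f i)" for f :: "'a \<Rightarrow> real" by (rule sum.reindex_bij_betw[OF b])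
  have r2: "(\<Sum>i\<in>I. \<Sum>j\<in>I. f (\<pi> i) (\<pi> j)) = (\<Sum>i\<in>I. \<Sum>j\<in>I. f i j)" for f :: "'a \<Rightarrow> 'a \<Rightarrow> real"
    using r1[of "\<lambda>i. \<Sum>j\<in>I. f i j"] r1[of "f (\<pi> _)"] by (simp add: sum.reindex_bij_betw[OF b])
  have e: "energy I W \<eta> (\<lambda>i. t (\<pi> i)) = energy I W \<eta> t"
    unfolding energy_def r1[of "\<lambda>i. \<eta> i * (cosh (t i) - 1)", symmetric] r2[of "\<lambda>i j. W i j * (cosh (t i - t j) - 1)", symmetric]
    by (simp add: W \<eta> cong: sum.cong)
  have q: "quad_form I W \<eta> (\<lambda>i. t (\<pi> i)) (\<lambda>i. s (\<pi> i)) = quad_form I W \<eta> t s"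
    unfolding quad_form_def r1[of "\<lambda>i. \<eta> i * (exp (t i) * (s i)\<^sup>2)", symmetric] r2[of "\<lambda>i j. W i j * (exp (t i + t j) * (s i - s j)\<^sup>2)", symmetric]
    by (simp add: W \<eta> cong: sum.cong)
  have p: "(\<Prod>i\<in>I. exp (- t (\<pi> i))) = (\<Prod>i\<in>I. exp (- t i))" by (rule prod.reindex_bij_betw[OF b])
  have "dmat I W \<eta> (\<lambda>i. t (\<pi> i)) i j = dmat I W \<eta> t (\<pi> i) (\<pi> j)" if ij: "i \<in> I" "j \<in> I" for i j
  proof -
    have inj: "\<pi> i = \<pi> j \<longleftrightarrow> i = j" using permutes_inj[OF \<pi>] by (auto simp: inj_def)
    have b': "bij_betw \<pi> (I - {i}) (I - {\<pi> i})" using b ij by (intro bij_betw_DiffI) (auto simp: bij_betw_def)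
    have "(\<Sum>k\<in>I - {\<pi> i}. W (\<pi> i) k * exp (t (\<pi> i) + t k)) = (\<Sum>k\<in>I - {i}. W (\<pi> i) (\<pi> k) * exp (t (\<pi> i) + t (\<pi> k)))"
      by (rule sum.reindex_bij_betw[OF b', symmetric])
    also have "\<dots> = (\<Sum>k\<in>I - {i}. W i k * exp (t (\<pi> i) + t (\<pi> k)))"
      using ij by (intro sum.cong refl) (simp add: W)
    finally show ?thesis using ij inj by (cases "i = j") (auto simp: dmat_def W \<eta>)
  qed
  then have "det_on I (dmat I W \<eta> (\<lambda>i. t (\<pi> i))) = det_on I (\<lambda>i j. dmat I W \<eta> t (\<pi> i) (\<pi> j))"
    by (rule det_on_cong)
  then have d: "det_on I (dmat I W \<eta> (\<lambda>i. t (\<pi> i))) = det_on I (dmat I W \<eta> t)"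
    using det_on_reindex[OF \<pi> I] by simp
  show ?thesis unfolding horo_weight_def e q p d ..
qed

text \<open>The Hamiltonian contains the logarithm of the determinant, so recovering the determinant
  as a factor uses its positivity. The remaining terms match after the factor 1/2 in front of the
  squares is collected.\<close>

lemma S22_weight:
  assumes adm: "admissible (torus d L) \<beta> (\<lambda>_. h)"
  shows "exp (- S22_H d L \<beta> h \<phi>) = horo_weight (torus d L) \<beta> (\<lambda>_. h) (\<lambda>i. \<phi> (i, 1)) (\<lambda>i. \<phi> (i, 0))"
proof -
  let ?T = "torus d L" and ?t = "\<lambda>i. \<phi> (i, 1::nat)" and ?s = "\<lambda>i. \<phi> (i, 0::nat)"
  have D: "det_on ?T (Dmat d L \<beta> h ?t) = det_on ?T (dmat ?T \<beta> (\<lambda>_. h) ?t)"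
    by (rule det_on_cong) (auto simp: Dmat_def dmat_def)
  have "(1/2) * (\<Sum>i\<in>?T. \<Sum>j\<in>?T. \<beta> i j * (cosh (?t i - ?t j) - 1 + (1/2) * (?s i - ?s j)\<^sup>2 * exp (?t i + ?t j)))
       + h * (\<Sum>i\<in>?T. cosh (?t i) - 1 + (1/2) * (?s i)\<^sup>2 * exp (?t i))
     = energy ?T \<beta> (\<lambda>_. h) ?t + quad_form ?T \<beta> (\<lambda>_. h) ?t ?s / 2"
    unfolding energy_def quad_form_def
    by (simp add: distrib_left sum.distrib sum_distrib_left sum_divide_distrib add_divide_distrib mult_ac)
  then have H: "S22_H d L \<beta> h \<phi> = energy ?T \<beta> (\<lambda>_. h) ?t + quad_form ?T \<beta> (\<lambda>_. h) ?t ?s / 2 + (\<Sum>i\<in>?T. ?t i + ln (2 * pi)) - ln (det_on ?T (dmat ?T \<beta> (\<lambda>_. h) ?t))"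
    unfolding S22_H_def Let_def D by simp
  have X: "exp (- (\<Sum>i\<in>?T. ?t i + ln (2 * pi))) = (\<Prod>i\<in>?T. exp (- ?t i)) / (2 * pi) ^ card ?T"
  proof -
    have "exp (- (\<Sum>i\<in>?T. ?t i + ln (2 * pi))) = (\<Prod>i\<in>?T. exp (- (?t i + ln (2 * pi))))"
      by (simp only: sum_negf[symmetric] exp_sum[OF finite_torus])
    also have "\<dots> = (\<Prod>i\<in>?T. exp (- ?t i) / (2 * pi))"
    proof (intro prod.cong refl)
      fix i
      have "exp (ln (2 * pi)) = 2 * pi" by simp
      then show "exp (- (?t i + ln (2 * pi))) = exp (- ?t i) / (2 * pi)"
        by (simp only: exp_minus exp_add inverse_mult_distrib divide_inverse)
    qed
    finally show ?thesis by (simp add: prod_dividef)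
  qed
  have "exp (- S22_H d L \<beta> h \<phi>) = exp (- energy ?T \<beta> (\<lambda>_. h) ?t) * exp (- quad_form ?T \<beta> (\<lambda>_. h) ?t ?s / 2) * exp (- (\<Sum>i\<in>?T. ?t i + ln (2 * pi))) * exp (ln (det_on ?T (dmat ?T \<beta> (\<lambda>_. h) ?t)))"
    unfolding H by (simp only: exp_add[symmetric]) simp
  then show ?thesis unfolding X horo_weight_def using det_dmat_pos[OF adm, of ?t] by (simp add: mult_ac)
qed

text \<open>Here \<open>b = 1\<close> because each \<open>e^(t i)\<close> has mean 1. The factor
  \<open>A = 1 + G(0)\<close> bounds the mean of \<open>e^(t i + t j)\<close>, which multiplies
  \<open>\<beta> i j * (c i - c j)^2\<close> in the quadratic form.\<close>

lemma S22_infrared: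
  fixes d L :: nat and \<beta> :: "site \<Rightarrow> site \<Rightarrow> real" and h :: real
  assumes L: "L \<ge> 1"
    and \<beta>: "\<forall>i\<in>torus d L. \<forall>j\<in>torus d L. \<beta> i j = \<beta> j i \<and> \<beta> i j \<ge> 0"
    and \<beta>_inv: "translation_invariant d L \<beta>"
    and h: "h > 0"
  shows "Im (fourier d L (S22_G d L \<beta> h) k) = 0 \<and>
     Re (fourier d L (S22_G d L \<beta> h) k) \<ge> 1 / ((1 + S22_G d L \<beta> h (torigin d)) * lam d L \<beta> k + h)"
proof -
  let ?T = "torus d L" and ?o = "torigin d"
  let ?M = "lborel_Pi (?T \<times> {..<2::nat})"
  have adm: "admissible ?T \<beta> (\<lambda>_. h)" using \<beta> h by (simp add: admissible_def)
  have o: "?o \<in> ?T" by (rule torigin_in_torus[OF L])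
  define w where "w \<phi> = horo_weight ?T \<beta> (\<lambda>_. h) (\<lambda>i. \<phi> (i, 1::nat)) (\<lambda>i. \<phi> (i, 0))" for \<phi>
  define y where "y \<phi> i = exp (\<phi> (i, 1::nat)) * \<phi> (i, 0)" for \<phi> :: "site \<times> nat \<Rightarrow> real" and i
  define g where "g i j = (\<integral>\<phi>. y \<phi> i * y \<phi> j * w \<phi> \<partial>?M)" for i j
  have w0: "w \<phi> \<ge> 0" for \<phi> unfolding w_def by (intro less_imp_le horo_weight_pos adm)
  have wm [measurable]: "w \<in> borel_measurable ?M" unfolding w_def[abs_def] by (rule measurable_horo_weight_coord) auto
  have tm: "(\<lambda>\<phi>. \<phi> (i, 1::nat)) \<in> borel_measurable ?M" if "i \<in> ?T" for i
    by (rule measurable_coord) (use that in auto)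
  have ym: "(\<lambda>\<phi>. y \<phi> i) \<in> borel_measurable ?M" if "i \<in> ?T" for i
    unfolding y_def by (intro borel_measurable_times borel_measurable_exp[THEN measurable_compose[rotated]] measurable_coord) (use that in auto)
  have G: "S22_G d L \<beta> h = g ?o"
    unfolding S22_G_def S22_expect_def g_def S22_space_def S22_weight[OF adm] w_def y_def by simp
  have sm: "horo_mean ?T \<beta> (\<lambda>_. h) i F = (\<integral>\<^sup>+\<phi>. F (\<phi> (i, 1)) (\<phi> (i, 0)) * ennreal (w \<phi>) \<partial>?M)" for i F
    unfolding horo_mean_def w_def ..
  have int_y2: "integrable ?M (\<lambda>\<phi>. (y \<phi> i)\<^sup>2 * w \<phi>)" if i: "i \<in> ?T" for i
  proof (rule integrableI_nonneg)
    note [measurable] = ym[OF i]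
    show "(\<lambda>\<phi>. (y \<phi> i)\<^sup>2 * w \<phi>) \<in> borel_measurable ?M" by measurable
    have "(\<integral>\<^sup>+\<phi>. ennreal ((y \<phi> i)\<^sup>2 * w \<phi>) \<partial>?M) = horo_mean ?T \<beta> (\<lambda>_. h) i (\<lambda>t s. ennreal ((exp t * s)\<^sup>2))"
      unfolding sm y_def by (simp add: ennreal_mult w0)
    then show "(\<integral>\<^sup>+\<phi>. ennreal ((y \<phi> i)\<^sup>2 * w \<phi>) \<partial>?M) < \<infinity>" using horo_mean_values(3)[OF adm i] by simp
  qed (use w0 in auto)
  have int_prod: "integrable ?M (\<lambda>\<phi>. f \<phi> * f' \<phi> * w \<phi>)"
    if i: "integrable ?M (\<lambda>\<phi>. (f \<phi>)\<^sup>2 * w \<phi>)" "integrable ?M (\<lambda>\<phi>. (f' \<phi>)\<^sup>2 * w \<phi>)"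
      and m: "f \<in> borel_measurable ?M" "f' \<in> borel_measurable ?M" for f f'
  proof (rule Bochner_Integration.integrable_bound[OF Bochner_Integration.integrable_add[OF i]])
    note [measurable] = m
    show "(\<lambda>\<phi>. f \<phi> * f' \<phi> * w \<phi>) \<in> borel_measurable ?M" by measurable
    have "\<bar>a * b\<bar> \<le> a\<^sup>2 + b\<^sup>2" for a b :: real
    proof -
      have "0 \<le> (\<bar>a\<bar> - \<bar>b\<bar>)\<^sup>2" by simp
      then have "2 * \<bar>a * b\<bar> \<le> a\<^sup>2 + b\<^sup>2" by (simp add: power2_diff abs_mult)
      then show ?thesis using abs_ge_zero[of "a * b"] by linarith
    qed
    then have "\<bar>f \<phi> * f' \<phi>\<bar> * w \<phi> \<le> ((f \<phi>)\<^sup>2 + (f' \<phi>)\<^sup>2) * w \<phi>" for \<phi>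
      using w0 by (intro mult_right_mono) auto
    then show "AE \<phi> in ?M. norm (f \<phi> * f' \<phi> * w \<phi>) \<le> norm ((f \<phi>)\<^sup>2 * w \<phi> + (f' \<phi>)\<^sup>2 * w \<phi>)"
      using w0 by (simp add: abs_mult distrib_right)
  qed
  have int_g: "integrable ?M (\<lambda>\<phi>. y \<phi> i * y \<phi> j * w \<phi>)" if "i \<in> ?T" "j \<in> ?T" for i j
    by (intro int_prod int_y2 ym that)
  have nn1: "(\<integral>\<^sup>+\<phi>. ennreal (exp (\<phi> (i, 1)) * w \<phi>) \<partial>?M) = 1" if i: "i \<in> ?T" for i
    using horo_mean_values(2)[OF adm i] unfolding sm by (simp add: ennreal_mult w0)
  have int1: "integrable ?M (\<lambda>\<phi>. exp (\<phi> (i, 1)) * w \<phi>)" and val1: "(\<integral>\<phi>. exp (\<phi> (i, 1)) * w \<phi> \<partial>?M) = 1" if i: "i \<in> ?T" for i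
  proof -
    note [measurable] = tm[OF i]
    show I: "integrable ?M (\<lambda>\<phi>. exp (\<phi> (i, 1)) * w \<phi>)"
    proof (rule integrableI_nonneg)
      show "(\<lambda>\<phi>. exp (\<phi> (i, 1)) * w \<phi>) \<in> borel_measurable ?M" by measurable
      show "(\<integral>\<^sup>+\<phi>. ennreal (exp (\<phi> (i, 1)) * w \<phi>) \<partial>?M) < \<infinity>" unfolding nn1[OF i] by simp
    qed (use w0 in auto)
    show "(\<integral>\<phi>. exp (\<phi> (i, 1)) * w \<phi> \<partial>?M) = 1"
      using nn_integral_eq_integral[OF I] nn1[OF i] w0 by simp
  qed
  have nn2: "(\<integral>\<^sup>+\<phi>. ennreal ((exp (\<phi> (i, 1)))\<^sup>2 * w \<phi>) \<partial>?M) = ennreal (1 + g i i)" if i: "i \<in> ?T" for i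
  proof -
    have "(\<integral>\<^sup>+\<phi>. ennreal ((exp (\<phi> (i, 1)))\<^sup>2 * w \<phi>) \<partial>?M) = horo_mean ?T \<beta> (\<lambda>_. h) i (\<lambda>t s. ennreal (exp (2 * t)))"
      unfolding sm by (simp add: ennreal_mult w0 exp_double)
    also have "\<dots> = 1 + horo_mean ?T \<beta> (\<lambda>_. h) i (\<lambda>t s. ennreal ((exp t * s)\<^sup>2))"
      by (rule horo_mean_values(4)[OF adm i])
    also have "horo_mean ?T \<beta> (\<lambda>_. h) i (\<lambda>t s. ennreal ((exp t * s)\<^sup>2)) = (\<integral>\<^sup>+\<phi>. ennreal ((y \<phi> i)\<^sup>2 * w \<phi>) \<partial>?M)"
      unfolding sm y_def by (simp add: ennreal_mult w0)
    also have "\<dots> = ennreal (g i i)"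
      unfolding g_def by (subst nn_integral_eq_integral[OF int_y2[OF i]]) (use w0 in \<open>auto simp: power2_eq_square\<close>)
    also have "1 + ennreal (g i i) = ennreal (1 + g i i)"
      unfolding g_def using w0 by (subst ennreal_plus) (auto intro!: integral_nonneg_AE)
    finally show ?thesis .
  qed
  have gpos: "g i i \<ge> 0" for i unfolding g_def using w0 by (intro integral_nonneg_AE) auto
  have int2: "integrable ?M (\<lambda>\<phi>. (exp (\<phi> (i, 1)))\<^sup>2 * w \<phi>)" and val2: "(\<integral>\<phi>. (exp (\<phi> (i, 1)))\<^sup>2 * w \<phi> \<partial>?M) = 1 + g i i" if i: "i \<in> ?T" for i
  proof -
    note [measurable] = tm[OF i]
    show I: "integrable ?M (\<lambda>\<phi>. (exp (\<phi> (i, 1)))\<^sup>2 * w \<phi>)"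
    proof (rule integrableI_nonneg)
      show "(\<lambda>\<phi>. (exp (\<phi> (i, 1)))\<^sup>2 * w \<phi>) \<in> borel_measurable ?M" by measurable
      show "(\<integral>\<^sup>+\<phi>. ennreal ((exp (\<phi> (i, 1)))\<^sup>2 * w \<phi>) \<partial>?M) < \<infinity>" unfolding nn2[OF i] by simp
    qed (use w0 in auto)
    have "(\<integral>\<phi>. (exp (\<phi> (i, 1)))\<^sup>2 * w \<phi> \<partial>?M) \<ge> 0" using w0 by (intro integral_nonneg_AE) auto
    then show "(\<integral>\<phi>. (exp (\<phi> (i, 1)))\<^sup>2 * w \<phi> \<partial>?M) = 1 + g i i"
      using nn_integral_eq_integral[OF I] nn2[OF i] w0 gpos[of i] by (simp add: add_nonneg_nonneg del: ennreal_plus)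
  qed
  have hb1: "has_bochner_integral ?M (\<lambda>\<phi>. exp (\<phi> (i, 1)) * w \<phi>) 1" if i: "i \<in> ?T" for i
    unfolding has_bochner_integral_iff using int1[OF i] val1[OF i] by blast
  have expm: "(\<lambda>\<phi>. exp (\<phi> (i, 1::nat))) \<in> borel_measurable ?M" if "i \<in> ?T" for i
    using tm[OF that] by measurable
  have int3: "integrable ?M (\<lambda>\<phi>. exp (\<phi> (i, 1)) * exp (\<phi> (j, 1)) * w \<phi>)" if "i \<in> ?T" "j \<in> ?T" for i j
    by (intro int_prod int2 expm that)
  have g_inv: "g (tadd d L i m) (tadd d L j m) = g i j" if i: "i \<in> ?T" and j: "j \<in> ?T" and m: "m \<in> ?T" for i j m
  proof -
    \<comment> \<open>\<open>tadd\<close> maps every argument into the torus, also arguments outside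
      it; \<open>permutes\<close> requires the identity there.\<close>
    define \<pi> where "\<pi> n = (if n \<in> ?T then tadd d L n m else n)" for n
    have b: "bij_betw \<pi> ?T ?T"
      using bij_betw_tadd[OF L m] by (rule bij_betw_cong[THEN iffD1, rotated]) (simp add: \<pi>_def)
    then have perm: "\<pi> permutes ?T" by (rule bij_imp_permutes) (simp add: \<pi>_def)
    let ?f = "\<lambda>(n, r :: nat). (\<pi> n, r)"
    have bf: "bij_betw ?f (?T \<times> {..<2::nat}) (?T \<times> {..<2})"
      using bij_betw_map_prod[OF b bij_betw_id[of "{..<2::nat}"]] by (simp add: map_prod_def id_def)
    have "g (\<pi> i) (\<pi> j) = g i j"
      unfolding g_def
    proof (rule PiM_integral_reindex[OF _ bf])
      show "(\<lambda>\<phi>. y \<phi> i * y \<phi> j * w \<phi>) \<in> borel_measurable ?M"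
        using ym[OF i] ym[OF j] by measurable
      fix \<phi> :: "site \<times> nat \<Rightarrow> real"
      let ?\<psi> = "\<lambda>n\<in>?T \<times> {..<2::nat}. \<phi> (?f n)"
      have "w ?\<psi> = horo_weight ?T \<beta> (\<lambda>_. h) (\<lambda>i. \<phi> (\<pi> i, 1)) (\<lambda>i. \<phi> (\<pi> i, 0))"
        unfolding w_def by (rule horo_weight_cong) auto
      also have "\<dots> = w \<phi>" unfolding w_def
        by (rule horo_weight_reindex[OF perm, where t="\<lambda>i. \<phi> (i, 1)" and s="\<lambda>i. \<phi> (i, 0)"])
          (use \<beta>_inv m in \<open>auto simp: \<pi>_def translation_invariant_def\<close>)
      finally have "w ?\<psi> = w \<phi>" .
      moreover have "y ?\<psi> n = y \<phi> (\<pi> n)" if "n \<in> ?T" for n using that by (simp add: y_def)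
      ultimately show "y ?\<psi> i * y ?\<psi> j * w ?\<psi> = y \<phi> (\<pi> i) * y \<phi> (\<pi> j) * w \<phi>" using i j by simp
    qed simp
    then show ?thesis using i j by (simp add: \<pi>_def)
  qed
  have gd: "g i i = g ?o ?o" if "i \<in> ?T" for i
    using g_inv[OF o o that] tadd_torigin[OF that] by simp
  \<comment> \<open>By the arithmetic-geometric mean inequality the product is at most the average
    of the two squares, each with mean \<open>1 + G(0)\<close> by the Ward identity and translation
    invariance.\<close>
  have val3: "(\<integral>\<phi>. exp (\<phi> (i, 1)) * exp (\<phi> (j, 1)) * w \<phi> \<partial>?M) \<le> 1 + g ?o ?o" if ij: "i \<in> ?T" "j \<in> ?T" for i j
  proof -
    have "(\<integral>\<phi>. exp (\<phi> (i, 1)) * exp (\<phi> (j, 1)) * w \<phi> \<partial>?M) \<le> (\<integral>\<phi>. (1/2) * ((exp (\<phi> (i, 1)))\<^sup>2 * w \<phi> + (exp (\<phi> (j, 1)))\<^sup>2 * w \<phi>) \<partial>?M)"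
    proof (rule integral_mono)
      fix \<phi> :: "site \<times> nat \<Rightarrow> real"
      have "0 \<le> (exp (\<phi> (i, 1)) - exp (\<phi> (j, 1)))\<^sup>2" by simp
      then have "exp (\<phi> (i, 1)) * exp (\<phi> (j, 1)) \<le> (1/2) * ((exp (\<phi> (i, 1)))\<^sup>2 + (exp (\<phi> (j, 1)))\<^sup>2)"
        by (simp add: power2_diff)
      from mult_right_mono[OF this w0[of \<phi>]]
      show "exp (\<phi> (i, 1)) * exp (\<phi> (j, 1)) * w \<phi> \<le> (1/2) * ((exp (\<phi> (i, 1)))\<^sup>2 * w \<phi> + (exp (\<phi> (j, 1)))\<^sup>2 * w \<phi>)"
        by (simp add: distrib_right)
    qed (intro int3 ij integrable_mult_right Bochner_Integration.integrable_add int2)+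
    also have "\<dots> = 1 + g ?o ?o"
      using int2[OF ij(1)] int2[OF ij(2)] val2[OF ij(1)] val2[OF ij(2)] gd[OF ij(1)] gd[OF ij(2)] by simp
    finally show ?thesis .
  qed
  show ?thesis unfolding G
  proof (rule infrared_bound[where g=g and b=1, OF L _ g_inv \<beta> \<beta>_inv h])
    show "g i j = g j i" for i j unfolding g_def by (simp add: mult.commute)
    show "0 \<le> 1 + g ?o ?o" using gpos[of ?o] by simp
    fix c :: "site \<Rightarrow> real" and a :: real assume a: "a \<ge> 0"
    let ?l = "\<lambda>\<phi>. 2 * a * (\<Sum>i\<in>?T. (c i)\<^sup>2 * exp (\<phi> (i, 1::nat))) * w \<phi>"
    let ?r = "\<lambda>\<phi>. ((\<Sum>i\<in>?T. c i * y \<phi> i)\<^sup>2 + a\<^sup>2 * quad_form ?T \<beta> (\<lambda>_. h) (\<lambda>i. \<phi> (i, 1)) c) * w \<phi>"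
    have le: "(\<integral>\<^sup>+\<phi>. ennreal (?l \<phi>) \<partial>?M) \<le> (\<integral>\<^sup>+\<phi>. ennreal (?r \<phi>) \<partial>?M)"
      using horo_weight_quadratic_bound[OF adm a, of c] unfolding w_def y_def .
    \<comment> \<open>Both integrands are expanded into linear combinations of functions already
      known to be integrable. This permits the passage from the extended integrals in
      \<open>le\<close> to real ones.\<close>
    have l_eq: "?l \<phi> = (\<Sum>i\<in>?T. (2 * a * (c i)\<^sup>2) * (exp (\<phi> (i, 1)) * w \<phi>))" for \<phi>
      by (simp add: sum_distrib_left sum_distrib_right mult_ac)
    have r_eq: "?r \<phi> = (\<Sum>l\<in>?T. \<Sum>j\<in>?T. (c j * c l) * (y \<phi> j * y \<phi> l * w \<phi>))
        + a\<^sup>2 * ((1/2) * (\<Sum>l\<in>?T. \<Sum>j\<in>?T. (\<beta> l j * (c l - c j)\<^sup>2) * (exp (\<phi> (l, 1)) * exp (\<phi> (j, 1)) * w \<phi>))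
          + (\<Sum>i\<in>?T. (h * (c i)\<^sup>2) * (exp (\<phi> (i, 1)) * w \<phi>)))" for \<phi>
    proof -
      have "(\<Sum>i\<in>?T. c i * y \<phi> i)\<^sup>2 * w \<phi> = (\<Sum>l\<in>?T. \<Sum>j\<in>?T. (c j * c l) * (y \<phi> j * y \<phi> l * w \<phi>))"
        unfolding power2_eq_square sum_product unfolding sum_distrib_right by (intro sum.cong refl) (simp only: mult_ac)
      moreover have "quad_form ?T \<beta> (\<lambda>_. h) (\<lambda>i. \<phi> (i, 1)) c * w \<phi> = (1/2) * (\<Sum>l\<in>?T. \<Sum>j\<in>?T. (\<beta> l j * (c l - c j)\<^sup>2) * (exp (\<phi> (l, 1)) * exp (\<phi> (j, 1)) * w \<phi>))
          + (\<Sum>i\<in>?T. (h * (c i)\<^sup>2) * (exp (\<phi> (i, 1)) * w \<phi>))"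
      proof -
        have "(\<Sum>l\<in>?T. \<Sum>j\<in>?T. \<beta> l j * (exp (\<phi> (l, 1)) * exp (\<phi> (j, 1)) * (c l - c j)\<^sup>2)) * w \<phi>
           = (\<Sum>l\<in>?T. \<Sum>j\<in>?T. (\<beta> l j * (c l - c j)\<^sup>2) * (exp (\<phi> (l, 1)) * exp (\<phi> (j, 1)) * w \<phi>))"
          unfolding sum_distrib_right by (intro sum.cong refl) (simp only: mult_ac)
        moreover have "(\<Sum>i\<in>?T. h * (exp (\<phi> (i, 1)) * (c i)\<^sup>2)) * w \<phi> = (\<Sum>i\<in>?T. (h * (c i)\<^sup>2) * (exp (\<phi> (i, 1)) * w \<phi>))"
          unfolding sum_distrib_right by (intro sum.cong refl) (simp only: mult_ac)
        ultimately show ?thesis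
          unfolding quad_form_def exp_add distrib_right mult.assoc[of "1/2"] by simp
      qed
      ultimately show ?thesis by (simp add: distrib_right mult.assoc)
    qed
    have int_l: "integrable ?M ?l" unfolding l_eq
      by (intro Bochner_Integration.integrable_sum integrable_mult_right int1)
    have int_r: "integrable ?M ?r" unfolding r_eq
      by (intro Bochner_Integration.integrable_sum Bochner_Integration.integrable_add integrable_mult_right int1 int_g int3)
    have L0: "?l \<phi> \<ge> 0" and R0: "?r \<phi> \<ge> 0" for \<phi>
      using a w0 quad_form_nonneg[OF adm] by (auto intro!: mult_nonneg_nonneg sum_nonneg add_nonneg_nonneg)
    have "ennreal (integral\<^sup>L ?M ?l) \<le> ennreal (integral\<^sup>L ?M ?r)"
      using le unfolding nn_integral_eq_integral[OF int_l AE_I2[OF L0]] nn_integral_eq_integral[OF int_r AE_I2[OF R0]] .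
    then have LR: "integral\<^sup>L ?M ?l \<le> integral\<^sup>L ?M ?r"
      using R0 by (simp add: ennreal_le_iff integral_nonneg_AE)
    have il: "integral\<^sup>L ?M ?l = 2 * a * (\<Sum>j\<in>?T. (c j)\<^sup>2)"
    proof -
      have "has_bochner_integral ?M ?l (\<Sum>i\<in>?T. (2 * a * (c i)\<^sup>2) * 1)" unfolding l_eq
        by (intro has_bochner_integral_sum has_bochner_integral_mult_right hb1)
      then show ?thesis by (simp add: has_bochner_integral_iff sum_distrib_left)
    qed
    let ?e = "\<lambda>l j. \<integral>\<phi>. exp (\<phi> (l, 1)) * exp (\<phi> (j, 1)) * w \<phi> \<partial>?M"
    have ir: "integral\<^sup>L ?M ?r = (\<Sum>l\<in>?T. \<Sum>j\<in>?T. (c j * c l) * g j l) + a\<^sup>2 * ((1/2) * (\<Sum>l\<in>?T. \<Sum>j\<in>?T. (\<beta> l j * (c l - c j)\<^sup>2) * ?e l j) + (\<Sum>i\<in>?T. (h * (c i)\<^sup>2) * 1))"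
    proof -
      have "has_bochner_integral ?M ?r ((\<Sum>l\<in>?T. \<Sum>j\<in>?T. (c j * c l) * g j l) + a\<^sup>2 * ((1/2) * (\<Sum>l\<in>?T. \<Sum>j\<in>?T. (\<beta> l j * (c l - c j)\<^sup>2) * ?e l j) + (\<Sum>i\<in>?T. (h * (c i)\<^sup>2) * 1)))"
        unfolding r_eq g_def
        by (intro has_bochner_integral_add has_bochner_integral_sum has_bochner_integral_mult_right hb1
            has_bochner_integral_integrable int_g int3)
      then show ?thesis by (simp only: has_bochner_integral_iff)
    qed
    have "(\<Sum>l\<in>?T. \<Sum>j\<in>?T. (\<beta> l j * (c l - c j)\<^sup>2) * ?e l j) \<le> (\<Sum>l\<in>?T. \<Sum>j\<in>?T. (\<beta> l j * (c l - c j)\<^sup>2) * (1 + g ?o ?o))"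
      using \<beta> by (intro sum_mono mult_left_mono val3) auto
    also have "\<dots> = (1 + g ?o ?o) * (\<Sum>l\<in>?T. \<Sum>j\<in>?T. \<beta> j l * (c j - c l)\<^sup>2)"
      unfolding sum_distrib_left
      by (subst sum.swap) (simp add: mult_ac)
    finally have X: "(\<Sum>l\<in>?T. \<Sum>j\<in>?T. (\<beta> l j * (c l - c j)\<^sup>2) * ?e l j) \<le> (1 + g ?o ?o) * (\<Sum>l\<in>?T. \<Sum>j\<in>?T. \<beta> j l * (c j - c l)\<^sup>2)" .
    have Y: "(\<Sum>i\<in>?T. (h * (c i)\<^sup>2) * 1) = h * 1 * (\<Sum>j\<in>?T. (c j)\<^sup>2)"
      by (simp add: sum_distrib_left)
    have "a\<^sup>2 * ((1/2) * (\<Sum>l\<in>?T. \<Sum>j\<in>?T. (\<beta> l j * (c l - c j)\<^sup>2) * ?e l j) + (\<Sum>i\<in>?T. (h * (c i)\<^sup>2) * 1))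
       \<le> a\<^sup>2 * ((1 + g ?o ?o) * ((1/2) * (\<Sum>l\<in>?T. \<Sum>j\<in>?T. \<beta> j l * (c j - c l)\<^sup>2)) + h * 1 * (\<Sum>j\<in>?T. (c j)\<^sup>2))"
      unfolding Y using X by (intro mult_left_mono) (simp_all del: One_nat_def)
    then show "2 * a * 1 * (\<Sum>j\<in>?T. (c j)\<^sup>2) \<le> (\<Sum>l\<in>?T. \<Sum>j\<in>?T. c j * c l * g j l)
       + a\<^sup>2 * ((1 + g ?o ?o) * ((1/2) * (\<Sum>l\<in>?T. \<Sum>j\<in>?T. \<beta> j l * (c j - c l)\<^sup>2)) + h * 1 * (\<Sum>j\<in>?T. (c j)\<^sup>2))"
      using LR unfolding il ir by simp
  qed auto
qed

subsection \<open>The hyperbolic sigma models\<close>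

locale hyperbolic_model =
  fixes d L n :: nat and \<beta> :: "site \<Rightarrow> site \<Rightarrow> real" and h :: real
  assumes L: "L \<ge> 1" and n: "n \<ge> 2"
    and \<beta>: "\<forall>i\<in>torus d L. \<forall>j\<in>torus d L. \<beta> i j = \<beta> j i \<and> \<beta> i j \<ge> 0"
    and \<beta>_inv: "translation_invariant d L \<beta>"
    and h: "h > 0"
begin

abbreviation "T \<equiv> torus d L"
abbreviation "K \<equiv> T \<times> {..<n}"
abbreviation "M \<equiv> lborel_Pi K"
abbreviation "z \<equiv> Hn_z n"
abbreviation "w \<equiv> Hn_weight d L n \<beta> h"
abbreviation y :: "(site \<times> nat \<Rightarrow> real) \<Rightarrow> site \<Rightarrow> real" where "y \<phi> j \<equiv> \<phi> (j, 1)"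

text \<open>A single gauge for growth and decay: it dominates every \<open>z\<close> and every
  coordinate, is at least 1, and the weight is at most a constant times
  \<open>e^(-h S)\<close>.\<close>

definition S :: "(site \<times> nat \<Rightarrow> real) \<Rightarrow> real" where "S \<phi> = (\<Sum>j\<in>T. z \<phi> j)"

lemma \<beta>_sym: "i \<in> T \<Longrightarrow> j \<in> T \<Longrightarrow> \<beta> i j = \<beta> j i"
  using \<beta> by blast

lemma \<beta>_nonneg: "i \<in> T \<Longrightarrow> j \<in> T \<Longrightarrow> \<beta> i j \<ge> 0"
  using \<beta> by blast

lemma z_sq: "(z \<phi> j)\<^sup>2 = 1 + (\<Sum>r<n. (\<phi> (j, r))\<^sup>2)"
  unfolding Hn_z_def by (intro real_sqrt_pow2) (simp add: sum_nonneg add_nonneg_nonneg)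

lemma z_ge_1: "z \<phi> j \<ge> 1"
  unfolding Hn_z_def using sum_nonneg[of "{..<n}" "\<lambda>r. (\<phi> (j, r))\<^sup>2"] by simp

lemma z_pos: "z \<phi> j > 0"
  using z_ge_1[of \<phi> j] by linarith

lemma z_le_S: "j \<in> T \<Longrightarrow> z \<phi> j \<le> S \<phi>"
  unfolding S_def using z_pos by (intro member_le_sum) (auto intro: less_imp_le)

lemma S_ge_1: "S \<phi> \<ge> 1"
  using z_le_S[OF torigin_in_torus[OF L], of \<phi>] z_ge_1[of \<phi> "torigin d"] by linarith

lemma coord_le_z:
  assumes "r < n"
  shows "1 + (\<phi> (j, r))\<^sup>2 \<le> (z \<phi> j)\<^sup>2" "\<bar>\<phi> (j, r)\<bar> \<le> z \<phi> j"
proof -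
  have "(\<phi> (j, r))\<^sup>2 \<le> (\<Sum>r<n. (\<phi> (j, r))\<^sup>2)" using assms by (intro member_le_sum) auto
  then show 1: "1 + (\<phi> (j, r))\<^sup>2 \<le> (z \<phi> j)\<^sup>2" unfolding z_sq by simp
  have "\<bar>\<phi> (j, r)\<bar>\<^sup>2 \<le> (z \<phi> j)\<^sup>2" using 1 by simp
  then show "\<bar>\<phi> (j, r)\<bar> \<le> z \<phi> j" by (rule power2_le_imp_le) (use z_pos less_imp_le in blast)
qed

text \<open>The reversed Cauchy--Schwarz inequality on the hyperboloid, which makes every
  interaction term non-negative. Young's inequality is applied to each spatial component and to the
  pair \<open>1, 1\<close>.\<close>

lemma dot_le: "Hn_dot n \<phi> i j \<le> - 1"
proof -
  \<comment> \<open>With this ratio the weighted sum \<open>u * z i ^2 + z j ^2 / u\<close> is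
    exactly \<open>2 * z i * z j\<close>.\<close>
  define u where "u = z \<phi> j / z \<phi> i"
  have u: "u > 0" using z_pos by (simp add: u_def)
  have ab: "a * b \<le> (1/2) * (u * a\<^sup>2 + b\<^sup>2 / u)" for a b :: real
  proof -
    have "0 \<le> (u * a - b)\<^sup>2 / u" using u by simp
    also have "\<dots> = u * a\<^sup>2 + b\<^sup>2 / u - 2 * (a * b)" using u by (simp add: power2_eq_square field_simps)
    finally show ?thesis by simp
  qed
  have "1 + (\<Sum>r<n. \<phi> (i, r) * \<phi> (j, r)) \<le> (1/2) * (u * 1\<^sup>2 + 1\<^sup>2 / u) + (\<Sum>r<n. (1/2) * (u * (\<phi> (i, r))\<^sup>2 + (\<phi> (j, r))\<^sup>2 / u))"
    using ab[of 1 1] ab by (intro add_mono sum_mono) auto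
  also have "\<dots> = (1/2) * (u * (z \<phi> i)\<^sup>2 + (z \<phi> j)\<^sup>2 / u)"
    unfolding z_sq by (simp add: sum.distrib sum_distrib_left sum_divide_distrib add_divide_distrib distrib_left)
  also have "\<dots> = z \<phi> i * z \<phi> j"
    unfolding u_def using z_pos[of \<phi> i] z_pos[of \<phi> j] by (simp add: power2_eq_square)
  finally show ?thesis unfolding Hn_dot_def by simp
qed

lemma w_pos: "w \<phi> > 0"
  unfolding Hn_weight_def using z_pos by (intro mult_pos_pos prod_pos) auto

text \<open>The interaction is dropped by \<open>dot_le\<close> and the density \<open>1 / z\<close>
  by \<open>z \<ge> 1\<close>, so the external field alone supplies the decay.\<close>

lemma w_le: "w \<phi> \<le> exp (h * card T) * exp (- h * S \<phi>)"
proof -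
  have "0 \<le> (\<Sum>i\<in>T. \<Sum>j\<in>T. \<beta> i j * (- Hn_dot n \<phi> i j - 1))"
  proof (intro sum_nonneg mult_nonneg_nonneg \<beta>_nonneg)
    show "0 \<le> - Hn_dot n \<phi> i j - 1" for i j using dot_le[of \<phi> i j] by linarith
  qed
  moreover have "(\<Sum>j\<in>T. z \<phi> j - 1) = S \<phi> - card T" by (simp add: S_def sum_subtractf)
  ultimately have "Hn_H d L n \<beta> h \<phi> \<ge> h * (S \<phi> - card T)" unfolding Hn_H_def by simp
  then have "exp (- Hn_H d L n \<beta> h \<phi>) \<le> exp (h * card T) * exp (- h * S \<phi>)"
    by (simp add: exp_add[symmetric] algebra_simps)
  moreover have "(\<Prod>j\<in>T. 1 / z \<phi> j) \<le> 1" using z_ge_1 z_pos by (intro prod_le_1) (auto intro: less_imp_le)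
  moreover have "(\<Prod>j\<in>T. 1 / z \<phi> j) \<ge> 0" using z_pos by (intro prod_nonneg) (auto intro: less_imp_le)
  ultimately show ?thesis unfolding Hn_weight_def
    by (metis exp_ge_zero mult_left_le order_trans)
qed

lemma measurable_phi: "j \<in> T \<Longrightarrow> r < n \<Longrightarrow> (\<lambda>\<phi>. \<phi> (j, r)) \<in> borel_measurable M"
  by (rule measurable_coord) auto

lemma measurable_y: "j \<in> T \<Longrightarrow> (\<lambda>\<phi>. y \<phi> j) \<in> borel_measurable M"
  using n by (intro measurable_phi) auto

lemma measurable_z: "j \<in> T \<Longrightarrow> (\<lambda>\<phi>. z \<phi> j) \<in> borel_measurable M"
  unfolding Hn_z_def
  by (intro borel_measurable_sqrt[THEN measurable_compose[rotated]] borel_measurable_add borel_measurable_sum borel_measurable_power borel_measurable_const measurable_phi) auto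

lemma measurable_w [measurable]: "w \<in> borel_measurable M"
proof -
  have "(\<lambda>\<phi>. Hn_dot n \<phi> i j) \<in> borel_measurable M" if "i \<in> T" "j \<in> T" for i j
    unfolding Hn_dot_def using that
    by (intro borel_measurable_diff borel_measurable_sum borel_measurable_times measurable_phi measurable_z) auto
  then have [measurable]: "(\<lambda>\<phi>. Hn_H d L n \<beta> h \<phi>) \<in> borel_measurable M"
    unfolding Hn_H_def
    by (intro borel_measurable_add borel_measurable_times borel_measurable_sum borel_measurable_diff borel_measurable_uminus borel_measurable_const measurable_z)
  have [measurable]: "(\<lambda>\<phi>. \<Prod>j\<in>T. 1 / z \<phi> j) \<in> borel_measurable M"
    by (intro borel_measurable_prod borel_measurable_divide borel_measurable_const measurable_z)
  show ?thesis unfolding Hn_weight_def[abs_def] by measurable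
qed

section \<open>Observables of polynomial growth and their expectations\<close>

text \<open>Growth is measured in powers of \<open>S\<close>, so the class is closed under the
  algebraic operations, and membership alone gives integrability against \<open>w\<close>.\<close>

definition poly_bounded :: "((site \<times> nat \<Rightarrow> real) \<Rightarrow> real) \<Rightarrow> bool" where
  "poly_bounded F \<longleftrightarrow> F \<in> borel_measurable M \<and> (\<exists>C m. C \<ge> 0 \<and> (\<forall>\<phi>. \<bar>F \<phi>\<bar> \<le> C * S \<phi> ^ m))"

lemma poly_bounded_const [simp]: "poly_bounded (\<lambda>_. c)"
  unfolding poly_bounded_def by (intro conjI exI[of _ "\<bar>c\<bar>"] exI[of _ "0::nat"]) auto

lemma poly_bounded_z: "j \<in> T \<Longrightarrow> poly_bounded (\<lambda>\<phi>. z \<phi> j)"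
  unfolding poly_bounded_def using z_le_S[of j] z_pos[THEN less_imp_le]
  by (auto intro!: exI[of _ "1::real"] exI[of _ "1::nat"] measurable_z)

lemma poly_bounded_phi: "j \<in> T \<Longrightarrow> r < n \<Longrightarrow> poly_bounded (\<lambda>\<phi>. \<phi> (j, r))"
  unfolding poly_bounded_def using order_trans[OF coord_le_z(2) z_le_S]
  by (auto intro!: exI[of _ "1::real"] exI[of _ "1::nat"] measurable_phi)

lemma poly_bounded_y: "j \<in> T \<Longrightarrow> poly_bounded (\<lambda>\<phi>. y \<phi> j)"
  using n by (intro poly_bounded_phi) auto

lemma poly_bounded_mult:
  assumes "poly_bounded F" "poly_bounded G"
  shows "poly_bounded (\<lambda>\<phi>. F \<phi> * G \<phi>)"
proof -
  obtain C m where F: "F \<in> borel_measurable M" "C \<ge> 0" "\<And>\<phi>. \<bar>F \<phi>\<bar> \<le> C * S \<phi> ^ m"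
    using assms(1) unfolding poly_bounded_def by blast
  obtain D k where G: "G \<in> borel_measurable M" "D \<ge> 0" "\<And>\<phi>. \<bar>G \<phi>\<bar> \<le> D * S \<phi> ^ k"
    using assms(2) unfolding poly_bounded_def by blast
  have "\<bar>F \<phi> * G \<phi>\<bar> \<le> (C * D) * S \<phi> ^ (m + k)" for \<phi>
  proof -
    have "\<bar>F \<phi> * G \<phi>\<bar> \<le> (C * S \<phi> ^ m) * (D * S \<phi> ^ k)"
      unfolding abs_mult using F G S_ge_1[of \<phi>] by (intro mult_mono) auto
    then show ?thesis by (simp add: power_add mult_ac)
  qed
  then show ?thesis using F G unfolding poly_bounded_def
    by (auto intro!: exI[of _ "C * D"] exI[of _ "m + k"])
qed

lemma poly_bounded_add:
  assumes "poly_bounded F" "poly_bounded G"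
  shows "poly_bounded (\<lambda>\<phi>. F \<phi> + G \<phi>)"
proof -
  obtain C m where F: "F \<in> borel_measurable M" "C \<ge> 0" "\<And>\<phi>. \<bar>F \<phi>\<bar> \<le> C * S \<phi> ^ m"
    using assms(1) unfolding poly_bounded_def by blast
  obtain D k where G: "G \<in> borel_measurable M" "D \<ge> 0" "\<And>\<phi>. \<bar>G \<phi>\<bar> \<le> D * S \<phi> ^ k"
    using assms(2) unfolding poly_bounded_def by blast
  have "\<bar>F \<phi> + G \<phi>\<bar> \<le> (C + D) * S \<phi> ^ (m + k)" for \<phi>
  proof -
    have "C * S \<phi> ^ m \<le> C * S \<phi> ^ (m + k)" "D * S \<phi> ^ k \<le> D * S \<phi> ^ (m + k)"
      using F G S_ge_1[of \<phi>] by (auto intro!: mult_left_mono power_increasing)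
    then show ?thesis using F(3)[of \<phi>] G(3)[of \<phi>] abs_triangle_ineq[of "F \<phi>" "G \<phi>"] by (simp add: distrib_right)
  qed
  then show ?thesis using F G unfolding poly_bounded_def
    by (auto intro!: exI[of _ "C + D"] exI[of _ "m + k"])
qed

lemma poly_bounded_diff:
  assumes "poly_bounded F" "poly_bounded G"
  shows "poly_bounded (\<lambda>\<phi>. F \<phi> - G \<phi>)"
  using poly_bounded_add[OF assms(1) poly_bounded_mult[OF poly_bounded_const[of "-1"] assms(2)]] by simp

lemma poly_bounded_sum:
  assumes "\<And>i. i \<in> I \<Longrightarrow> poly_bounded (F i)"
  shows "poly_bounded (\<lambda>\<phi>. \<Sum>i\<in>I. F i \<phi>)"
  using assms by (induction I rule: infinite_finite_induct) (auto intro: poly_bounded_add)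

lemma poly_bounded_power:
  assumes "poly_bounded F"
  shows "poly_bounded (\<lambda>\<phi>. F \<phi> ^ k)"
  by (induction k) (auto intro: poly_bounded_mult assms)

lemmas poly_bounded_intros = poly_bounded_const poly_bounded_z poly_bounded_y poly_bounded_mult poly_bounded_add
  poly_bounded_diff poly_bounded_sum poly_bounded_power

lemma poly_bounded_integrable:
  assumes "poly_bounded F"
  shows "integrable M (\<lambda>\<phi>. F \<phi> * w \<phi>)"
proof -
  obtain C m where F: "F \<in> borel_measurable M" "C \<ge> 0" "\<And>\<phi>. \<bar>F \<phi>\<bar> \<le> C * S \<phi> ^ m"
    using assms unfolding poly_bounded_def by blast
  \<comment> \<open>The power \<open>m\<close> pays for \<open>F\<close>, and each coordinate costs
    two more, because \<open>1 + (\<phi> k)^2\<close> is bounded by \<open>S\<close>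
    squared.\<close>
  obtain B where B: "\<And>x. x \<ge> 0 \<Longrightarrow> x ^ (m + 2 * card K) * exp (- h * x) \<le> B"
    using power_exp_bound[OF h] by metis
  show ?thesis
  proof (rule PiM_integrable_bound)
    show "(\<lambda>\<phi>. F \<phi> * w \<phi>) \<in> borel_measurable M" using F(1) by measurable
    fix \<phi> :: "site \<times> nat \<Rightarrow> real"
    have "(\<Prod>k\<in>K. 1 + (\<phi> k)\<^sup>2) \<le> (\<Prod>k\<in>K. (S \<phi>)\<^sup>2)"
    proof (intro prod_mono conjI)
      fix k assume "k \<in> K"
      then obtain j r where k: "k = (j, r)" "j \<in> T" "r < n" by auto
      have "1 + (\<phi> (j, r))\<^sup>2 \<le> (z \<phi> j)\<^sup>2" by (rule coord_le_z(1)[OF k(3)])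
      also have "\<dots> \<le> (S \<phi>)\<^sup>2" using z_le_S[OF k(2)] z_pos[of \<phi> j] by (intro power_mono) auto
      finally show "1 + (\<phi> k)\<^sup>2 \<le> (S \<phi>)\<^sup>2" using k by simp
    qed (simp add: add_nonneg_nonneg)
    also have "\<dots> = S \<phi> ^ (2 * card K)" by (simp add: power_mult)
    finally have P: "(\<Prod>k\<in>K. 1 + (\<phi> k)\<^sup>2) \<le> S \<phi> ^ (2 * card K)" .
    have "\<bar>F \<phi> * w \<phi>\<bar> * (\<Prod>k\<in>K. 1 + (\<phi> k)\<^sup>2) \<le> (C * S \<phi> ^ m * (exp (h * card T) * exp (- h * S \<phi>))) * S \<phi> ^ (2 * card K)"
      unfolding abs_mult
      using F(2,3) w_le[of \<phi>] w_pos[of \<phi>] P S_ge_1[of \<phi>]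
      by (intro mult_mono prod_nonneg) (auto intro: add_nonneg_nonneg)
    also have "\<dots> = C * exp (h * card T) * (S \<phi> ^ (m + 2 * card K) * exp (- h * S \<phi>))"
      by (simp only: power_add mult_ac)
    also have "\<dots> \<le> C * exp (h * card T) * B"
      using F(2) B[of "S \<phi>"] S_ge_1[of \<phi>] by (intro mult_left_mono) auto
    finally show "\<bar>F \<phi> * w \<phi>\<bar> * (\<Prod>k\<in>K. 1 + (\<phi> k)\<^sup>2) \<le> C * exp (h * card T) * B" .
  qed simp
qed

definition Z :: real where "Z = (\<integral>\<phi>. w \<phi> \<partial>M)"
definition E :: "((site \<times> nat \<Rightarrow> real) \<Rightarrow> real) \<Rightarrow> real" where "E F = (\<integral>\<phi>. F \<phi> * w \<phi> \<partial>M) / Z"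

lemma E_eq: "Hn_expect d L n \<beta> h F = E F"
  by (simp add: Hn_expect_def E_def Z_def Hn_space_def)

lemma w_integrable: "integrable M w"
  using poly_bounded_integrable[of "\<lambda>_. 1"] by simp

text \<open>If the integral of the positive weight vanished, the product measure would be null, but
  its unit cube has measure 1. Without this the quotient defining \<open>E\<close> could be a
  division by zero.\<close>

lemma Z_pos: "Z > 0"
proof -
  have "Z \<noteq> 0"
  proof
    assume "Z = 0"
    then have "AE \<phi> in M. w \<phi> = 0"
      unfolding Z_def using integral_nonneg_eq_0_iff_AE[OF w_integrable AE_I2[OF less_imp_le[OF w_pos]]] by simp
    moreover have "w \<phi> \<noteq> 0" for \<phi> using w_pos[of \<phi>] by simp
    ultimately have "AE \<phi> in M. False" by simp
    then have "emeasure M (space M) = 0" by (simp add: AE_iff_measurable[OF _ refl])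
    interpret product_sigma_finite "\<lambda>_. lborel :: real measure" by (rule product_sigma_finite_lborel)
    have "emeasure M (Pi\<^sub>E K (\<lambda>_. {0..1::real})) = (\<Prod>k\<in>K. emeasure lborel {0..1::real})"
      by (rule emeasure_PiM) auto
    also have "\<dots> = 1" by simp
    finally have "emeasure M (Pi\<^sub>E K (\<lambda>_. {0..1::real})) = 1" .
    moreover have "emeasure M (Pi\<^sub>E K (\<lambda>_. {0..1::real})) \<le> emeasure M (space M)"
      by (rule emeasure_space)
    ultimately show False using \<open>emeasure M (space M) = 0\<close> by simp
  qed
  moreover have "Z \<ge> 0" unfolding Z_def using w_pos[THEN less_imp_le] by (intro integral_nonneg_AE) auto
  ultimately show ?thesis by simp
qed

lemma E_const: "E (\<lambda>_. c) = c"
  unfolding E_def using Z_pos by (simp add: Z_def)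

lemma E_cmult: "E (\<lambda>\<phi>. c * F \<phi>) = c * E F"
  unfolding E_def by (simp add: mult.assoc)

lemma E_add: "poly_bounded F \<Longrightarrow> poly_bounded G \<Longrightarrow> E (\<lambda>\<phi>. F \<phi> + G \<phi>) = E F + E G"
  unfolding E_def by (simp add: distrib_right poly_bounded_integrable add_divide_distrib)

lemma E_diff: "poly_bounded F \<Longrightarrow> poly_bounded G \<Longrightarrow> E (\<lambda>\<phi>. F \<phi> - G \<phi>) = E F - E G"
  unfolding E_def by (simp add: left_diff_distrib poly_bounded_integrable diff_divide_distrib)

lemma E_sum: "(\<And>i. i \<in> I \<Longrightarrow> poly_bounded (F i)) \<Longrightarrow> E (\<lambda>\<phi>. \<Sum>i\<in>I. F i \<phi>) = (\<Sum>i\<in>I. E (F i))"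
  unfolding E_def by (simp add: sum_distrib_right poly_bounded_integrable sum_divide_distrib)

lemma E_mono:
  assumes "poly_bounded F" "poly_bounded G" "\<And>\<phi>. F \<phi> \<le> G \<phi>"
  shows "E F \<le> E G"
  unfolding E_def using Z_pos w_pos[THEN less_imp_le] assms
  by (intro divide_right_mono integral_mono poly_bounded_integrable mult_right_mono) auto

section \<open>Symmetries of the hyperbolic model: torus translations and permutations of spatial
  components\<close>

text \<open>All ingredients are sums or products over sites of sums over components, so a
  relabelling of both merely reindexes them. \<open>\<psi>\<close> is prescribed on the index set
  only, because the transformed configurations are restricted functions.\<close>

lemma weight_reindex:
  assumes \<pi>: "\<pi> permutes T" and \<tau>: "\<tau> permutes {..<n}"
    and inv: "\<And>i j. i \<in> T \<Longrightarrow> j \<in> T \<Longrightarrow> \<beta> (\<pi> i) (\<pi> j) = \<beta> i j"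
    and \<psi>: "\<And>j r. j \<in> T \<Longrightarrow> r < n \<Longrightarrow> \<psi> (j, r) = \<phi> (\<pi> j, \<tau> r)"
  shows "j \<in> T \<Longrightarrow> z \<psi> j = z \<phi> (\<pi> j)" "w \<psi> = w \<phi>"
proof -
  have b: "bij_betw \<pi> T T" using \<pi> by (rule permutes_imp_bij)
  have b\<tau>: "bij_betw \<tau> {..<n} {..<n}" using \<tau> by (rule permutes_imp_bij)
  show z: "z \<psi> j = z \<phi> (\<pi> j)" if j: "j \<in> T" for j
    unfolding Hn_z_def using sum.reindex_bij_betw[OF b\<tau>, of "\<lambda>r. (\<phi> (\<pi> j, r))\<^sup>2"] \<psi>[OF j] by simp
  have dot: "Hn_dot n \<psi> i j = Hn_dot n \<phi> (\<pi> i) (\<pi> j)" if ij: "i \<in> T" "j \<in> T" for i j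
    unfolding Hn_dot_def z[OF ij(1)] z[OF ij(2)]
    using sum.reindex_bij_betw[OF b\<tau>, of "\<lambda>r. \<phi> (\<pi> i, r) * \<phi> (\<pi> j, r)"] \<psi>[OF ij(1)] \<psi>[OF ij(2)] by simp
  have r1: "(\<Sum>i\<in>T. f (\<pi> i)) = (\<Sum>i\<in>T. f i)" for f :: "site \<Rightarrow> real" by (rule sum.reindex_bij_betw[OF b])
  have r2: "(\<Sum>i\<in>T. \<Sum>j\<in>T. f (\<pi> i) (\<pi> j)) = (\<Sum>i\<in>T. \<Sum>j\<in>T. f i j)" for f :: "site \<Rightarrow> site \<Rightarrow> real"
    using r1[of "\<lambda>i. \<Sum>j\<in>T. f i j"] by (simp add: sum.reindex_bij_betw[OF b])
  have "(\<Sum>i\<in>T. \<Sum>j\<in>T. \<beta> i j * (- Hn_dot n \<psi> i j - 1)) = (\<Sum>i\<in>T. \<Sum>j\<in>T. \<beta> (\<pi> i) (\<pi> j) * (- Hn_dot n \<phi> (\<pi> i) (\<pi> j) - 1))"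
    by (intro sum.cong refl) (simp add: dot inv)
  also have "\<dots> = (\<Sum>i\<in>T. \<Sum>j\<in>T. \<beta> i j * (- Hn_dot n \<phi> i j - 1))"
    by (rule r2[of "\<lambda>i j. \<beta> i j * (- Hn_dot n \<phi> i j - 1)"])
  finally have 1: "(\<Sum>i\<in>T. \<Sum>j\<in>T. \<beta> i j * (- Hn_dot n \<psi> i j - 1)) = (\<Sum>i\<in>T. \<Sum>j\<in>T. \<beta> i j * (- Hn_dot n \<phi> i j - 1))" .
  have 2: "(\<Sum>j\<in>T. z \<psi> j - 1) = (\<Sum>j\<in>T. z \<phi> j - 1)"
    using r1[of "\<lambda>j. z \<phi> j - 1"] by (simp add: z)
  have 3: "(\<Prod>j\<in>T. 1 / z \<psi> j) = (\<Prod>j\<in>T. 1 / z \<phi> j)"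
    using prod.reindex_bij_betw[OF b, of "\<lambda>j. 1 / z \<phi> j"] by (simp add: z)
  show "w \<psi> = w \<phi>" unfolding Hn_weight_def Hn_H_def 1 2 3 ..
qed

lemma E_reindex:
  assumes \<pi>: "\<pi> permutes T" and \<tau>: "\<tau> permutes {..<n}"
    and inv: "\<And>i j. i \<in> T \<Longrightarrow> j \<in> T \<Longrightarrow> \<beta> (\<pi> i) (\<pi> j) = \<beta> i j"
    and F: "poly_bounded F"
    and F': "\<And>\<phi>. F (\<lambda>k\<in>K. \<phi> (\<pi> (fst k), \<tau> (snd k))) = F' \<phi>"
  shows "E F' = E F"
proof -
  let ?f = "\<lambda>k. (\<pi> (fst k), \<tau> (snd k))"
  have bf: "bij_betw ?f K K"
    using bij_betw_map_prod[OF permutes_imp_bij[OF \<pi>] permutes_imp_bij[OF \<tau>]] by (simp add: map_prod_def split_beta')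
  have "(\<integral>\<phi>. F' \<phi> * w \<phi> \<partial>M) = (\<integral>\<phi>. F \<phi> * w \<phi> \<partial>M)"
  proof (rule PiM_integral_reindex[OF _ bf])
    show "(\<lambda>\<phi>. F \<phi> * w \<phi>) \<in> borel_measurable M" using F by (auto simp: poly_bounded_def)
    fix \<phi> :: "site \<times> nat \<Rightarrow> real"
    have "w (\<lambda>k\<in>K. \<phi> (?f k)) = w \<phi>"
      by (rule weight_reindex(2)[OF \<pi> \<tau> inv]) auto
    then show "F (\<lambda>k\<in>K. \<phi> (?f k)) * w (\<lambda>k\<in>K. \<phi> (?f k)) = F' \<phi> * w \<phi>" using F'[of \<phi>] by simp
  qed simp
  then show ?thesis by (simp add: E_def)
qed

definition shift :: "site \<Rightarrow> site \<Rightarrow> site" where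
  "shift m j = (if j \<in> T then tadd d L j m else j)"

lemma shift_permutes: "m \<in> T \<Longrightarrow> shift m permutes T"
proof -
  assume m: "m \<in> T"
  have "bij_betw (shift m) T T"
    using bij_betw_tadd[OF L m] by (rule bij_betw_cong[THEN iffD1, rotated]) (simp add: shift_def)
  then show ?thesis by (rule bij_imp_permutes) (simp add: shift_def)
qed

lemma shift_\<beta>: "m \<in> T \<Longrightarrow> i \<in> T \<Longrightarrow> j \<in> T \<Longrightarrow> \<beta> (shift m i) (shift m j) = \<beta> i j"
  using \<beta>_inv by (auto simp: shift_def translation_invariant_def)

definition g :: "site \<Rightarrow> site \<Rightarrow> real" where "g i j = E (\<lambda>\<phi>. y \<phi> i * y \<phi> j)"

lemma g_inv:
  assumes "i \<in> T" "j \<in> T" "m \<in> T"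
  shows "g (tadd d L i m) (tadd d L j m) = g i j"
  unfolding g_def
  by (rule E_reindex[OF shift_permutes[OF assms(3)] permutes_id shift_\<beta>[OF assms(3)]])
    (use assms n in \<open>auto simp: shift_def intro!: poly_bounded_mult poly_bounded_phi\<close>)

lemma E_z_inv:
  assumes "m \<in> T"
  shows "E (\<lambda>\<phi>. z \<phi> m) = E (\<lambda>\<phi>. z \<phi> (torigin d))"
proof (rule E_reindex[OF shift_permutes[OF assms] permutes_id shift_\<beta>[OF assms]])
  have o: "torigin d \<in> T" by (rule torigin_in_torus[OF L])
  show "poly_bounded (\<lambda>\<phi>. z \<phi> (torigin d))" by (intro poly_bounded_intros o)
  show "z (\<lambda>k\<in>K. \<phi> (shift m (fst k), id (snd k))) (torigin d) = z \<phi> m" for \<phi>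
    using weight_reindex(1)[OF shift_permutes[OF assms] permutes_id shift_\<beta>[OF assms], where \<phi>=\<phi> and j="torigin d"]
      o tadd_torigin[OF assms] by (simp add: shift_def)
qed

text \<open>Isotropy of the spatial components, of which only the transposition of component 1 with
  component \<open>r\<close> is used. It is the origin of the factor \<open>n\<close> in the second
  moment of \<open>z\<close>.\<close>

lemma E_component:
  assumes j: "j \<in> T" and r: "r < n"
  shows "E (\<lambda>\<phi>. (\<phi> (j, r))\<^sup>2) = g j j"
  unfolding g_def
proof (rule E_reindex[OF permutes_id])
  show "Transposition.transpose 1 r permutes {..<n}" using n r by (intro permutes_swap_id) auto
qed (use j n in \<open>auto simp: power2_eq_square intro!: poly_bounded_mult poly_bounded_phi\<close>)

lemma g_diag: "j \<in> T \<Longrightarrow> g j j = g (torigin d) (torigin d)"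
  using g_inv[OF torigin_in_torus[OF L] torigin_in_torus[OF L], of j] tadd_torigin[of j d L] by simp

lemma E_z_sq:
  assumes "j \<in> T"
  shows "E (\<lambda>\<phi>. (z \<phi> j)\<^sup>2) = 1 + real n * g (torigin d) (torigin d)"
proof -
  have "E (\<lambda>\<phi>. (z \<phi> j)\<^sup>2) = E (\<lambda>\<phi>. 1 + (\<Sum>r<n. (\<phi> (j, r))\<^sup>2))" unfolding z_sq ..
  also have "\<dots> = 1 + (\<Sum>r<n. E (\<lambda>\<phi>. (\<phi> (j, r))\<^sup>2))"
  proof -
    have p: "poly_bounded (\<lambda>\<phi>. (\<phi> (j, r))\<^sup>2)" if "r \<in> {..<n}" for r
      using that assms by (intro poly_bounded_power poly_bounded_phi) auto
    have q: "poly_bounded (\<lambda>\<phi>. \<Sum>r<n. (\<phi> (j, r))\<^sup>2)" by (rule poly_bounded_sum) (rule p)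
    have s: "E (\<lambda>\<phi>. \<Sum>r<n. (\<phi> (j, r))\<^sup>2) = (\<Sum>r<n. E (\<lambda>\<phi>. (\<phi> (j, r))\<^sup>2))" by (rule E_sum) (rule p)
    show ?thesis unfolding E_add[OF poly_bounded_const q] E_const s ..
  qed
  also have "\<dots> = 1 + (\<Sum>r<n. g (torigin d) (torigin d))"
    using E_component[OF assms] g_diag[OF assms] by simp
  finally show ?thesis by simp
qed

section \<open>Lorentz boosts and the quadratic inequality\<close>

text \<open>\<open>A \<phi> j\<close> is \<open>z j\<close> times the partial derivative of the
  Hamiltonian in \<open>y j\<close>. The factor \<open>z j\<close> clears the denominator of the
  derivative \<open>y j / z j\<close> of \<open>z j\<close> and leaves a polynomial in the
  \<open>y\<close> and \<open>z\<close>.\<close>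

definition A :: "(site \<times> nat \<Rightarrow> real) \<Rightarrow> site \<Rightarrow> real" where
  "A \<phi> j = (\<Sum>l\<in>T. \<beta> j l * (y \<phi> j * z \<phi> l - z \<phi> j * y \<phi> l)) + h * y \<phi> j"

lemma poly_bounded_A: "j \<in> T \<Longrightarrow> poly_bounded (\<lambda>\<phi>. A \<phi> j)"
  unfolding A_def by (intro poly_bounded_intros)

lemma DERIV_upd: "((\<lambda>x. (\<phi>(k := x)) k') has_real_derivative of_bool (k' = k)) (at x)"
  by (cases "k' = k") auto

lemma DERIV_z: "((\<lambda>x. z (\<phi>((j, 1) := x)) i) has_real_derivative of_bool (i = j) * (x / z (\<phi>((j, 1) := x)) i)) (at x)"
proof -
  let ?\<psi> = "\<lambda>x. \<phi>((j, 1) := x)"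
  have pos: "0 < 1 + (\<Sum>r<n. (?\<psi> x (i, r))\<^sup>2)" by (intro add_pos_nonneg sum_nonneg) auto
  have "((\<lambda>x. 1 + (\<Sum>r<n. (?\<psi> x (i, r))\<^sup>2)) has_real_derivative 0 + (\<Sum>r<n. of_nat 2 * ?\<psi> x (i, r) ^ (2 - Suc 0) * of_bool ((i, r) = (j, 1)))) (at x)"
  proof (intro DERIV_add DERIV_const DERIV_sum)
    show "((\<lambda>x. (?\<psi> x (i, r))\<^sup>2) has_real_derivative of_nat 2 * ?\<psi> x (i, r) ^ (2 - Suc 0) * of_bool ((i, r) = (j, 1))) (at x)" for r
      by (rule DERIV_cong[OF DERIV_power[OF DERIV_upd]]) (simp only: mult_ac)
  qed
  moreover have "(\<Sum>r<n. of_nat 2 * ?\<psi> x (i, r) ^ (2 - Suc 0) * of_bool ((i, r) = (j, 1))) = of_bool (i = j) * (2 * x)"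
  proof -
    have "(\<Sum>r<n. of_nat 2 * ?\<psi> x (i, r) ^ (2 - Suc 0) * of_bool ((i, r) = (j, 1))) = (\<Sum>r<n. if r = 1 then of_bool (i = j) * (2 * x) else 0)"
      by (intro sum.cong refl) auto
    then show ?thesis using n by simp
  qed
  ultimately have "((\<lambda>x. 1 + (\<Sum>r<n. (?\<psi> x (i, r))\<^sup>2)) has_real_derivative of_bool (i = j) * (2 * x)) (at x)" by (simp only: add_0_left)
  note DERIV_chain2[OF DERIV_real_sqrt[OF pos] this]
  moreover have "inverse s / 2 * (b * (2 * x)) = b * (x / s)" for s b :: real
    by (cases "s = 0") (simp_all add: field_simps)
  ultimately show ?thesis unfolding Hn_z_def by (simp only:)
qed

lemma DERIV_y: "((\<lambda>x. y (\<phi>((j, 1) := x)) i) has_real_derivative of_bool (i = j)) (at x)"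
  using DERIV_upd[of \<phi> "(j, 1)" "(i, 1)" x] by simp

lemma DERIV_H:
  assumes j: "j \<in> T"
  shows "((\<lambda>x. Hn_H d L n \<beta> h (\<phi>((j, 1) := x))) has_real_derivative A (\<phi>((j, 1) := x)) j / z (\<phi>((j, 1) := x)) j) (at x)"
proof -
  define \<psi> where "\<psi> = \<phi>((j, 1) := x)"
  define e where "e i = (of_bool (i = j) :: real)" for i
  have yx: "e i * x = e i * y \<psi> i" for i by (simp add: e_def \<psi>_def)
  have dot: "((\<lambda>x. Hn_dot n (\<phi>((j, 1) := x)) i l) has_real_derivative
      (e i * y \<psi> l + e l * y \<psi> i) - (e i * (x / z \<psi> i) * z \<psi> l + e l * (x / z \<psi> l) * z \<psi> i)) (at x)" for i l
  proof -
    have "((\<lambda>x. \<Sum>r<n. (\<phi>((j, 1) := x)) (i, r) * (\<phi>((j, 1) := x)) (l, r)) has_real_derivative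
       (\<Sum>r<n. of_bool ((i, r) = (j, 1)) * \<psi> (l, r) + of_bool ((l, r) = (j, 1)) * \<psi> (i, r))) (at x)"
      unfolding \<psi>_def by (intro DERIV_sum DERIV_mult DERIV_upd)
    moreover have "(\<Sum>r<n. of_bool ((i, r) = (j, 1)) * \<psi> (l, r) + of_bool ((l, r) = (j, 1)) * \<psi> (i, r)) = e i * y \<psi> l + e l * y \<psi> i"
    proof -
      have "(\<Sum>r<n. of_bool ((i, r) = (j, 1)) * \<psi> (l, r) + of_bool ((l, r) = (j, 1)) * \<psi> (i, r)) = (\<Sum>r<n. if r = 1 then e i * y \<psi> l + e l * y \<psi> i else 0)"
        by (intro sum.cong refl) (auto simp: e_def)
      then show ?thesis using n by simp
    qed
    ultimately show ?thesis unfolding Hn_dot_def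
      using DERIV_diff[OF _ DERIV_mult[OF DERIV_z[of \<phi> j i x] DERIV_z[of \<phi> j l x]]]
      unfolding \<psi>_def[symmetric] e_def[symmetric] by simp
  qed
  have dz: "((\<lambda>x. z (\<phi>((j, 1) := x)) i) has_real_derivative e i * (x / z \<psi> i)) (at x)" for i
    unfolding \<psi>_def e_def by (rule DERIV_z)
  \<comment> \<open>\<open>D i l\<close> is the part of the derivative that comes from the first
    endpoint. By symmetry of \<open>\<beta>\<close> the second endpoint gives \<open>D l i\<close>,
    and the two together cancel the factor 1/2 of the ordered double sum.\<close>
  define D where "D i l = \<beta> i l * (e i * (x / z \<psi> i) * z \<psi> l - e i * y \<psi> l)" for i l
  have "((\<lambda>x. Hn_H d L n \<beta> h (\<phi>((j, 1) := x))) has_real_derivative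
     (1/2) * (\<Sum>i\<in>T. \<Sum>l\<in>T. \<beta> i l * (- ((e i * y \<psi> l + e l * y \<psi> i) - (e i * (x / z \<psi> i) * z \<psi> l + e l * (x / z \<psi> l) * z \<psi> i)) - 0))
     + h * (\<Sum>i\<in>T. e i * (x / z \<psi> i) - 0)) (at x)"
    unfolding Hn_H_def
    by (intro DERIV_add DERIV_cmult DERIV_sum DERIV_diff DERIV_minus dot DERIV_const dz)
  moreover have "(\<Sum>i\<in>T. \<Sum>l\<in>T. \<beta> i l * (- ((e i * y \<psi> l + e l * y \<psi> i) - (e i * (x / z \<psi> i) * z \<psi> l + e l * (x / z \<psi> l) * z \<psi> i)) - 0))
     = 2 * (\<Sum>i\<in>T. \<Sum>l\<in>T. D i l)"
  proof -
    have "(\<Sum>i\<in>T. \<Sum>l\<in>T. \<beta> i l * (- ((e i * y \<psi> l + e l * y \<psi> i) - (e i * (x / z \<psi> i) * z \<psi> l + e l * (x / z \<psi> l) * z \<psi> i)) - 0))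
      = (\<Sum>i\<in>T. \<Sum>l\<in>T. D i l + D l i)"
      unfolding D_def by (intro sum.cong refl) (simp add: \<beta>_sym algebra_simps)
    also have "\<dots> = (\<Sum>i\<in>T. \<Sum>l\<in>T. D i l) + (\<Sum>i\<in>T. \<Sum>l\<in>T. D l i)" by (simp add: sum.distrib)
    also have "(\<Sum>i\<in>T. \<Sum>l\<in>T. D l i) = (\<Sum>i\<in>T. \<Sum>l\<in>T. D i l)" by (rule sum.swap)
    finally show ?thesis by simp
  qed
  moreover have "(\<Sum>i\<in>T. \<Sum>l\<in>T. D i l) = (\<Sum>l\<in>T. \<beta> j l * ((x / z \<psi> j) * z \<psi> l - y \<psi> l))"
  proof -
    have "(\<Sum>i\<in>T. \<Sum>l\<in>T. D i l) = (\<Sum>i\<in>T. if i = j then (\<Sum>l\<in>T. \<beta> j l * ((x / z \<psi> j) * z \<psi> l - y \<psi> l)) else 0)"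
      by (intro sum.cong refl) (auto simp: D_def e_def)
    then show ?thesis using j by simp
  qed
  moreover have "(\<Sum>i\<in>T. e i * (x / z \<psi> i) - 0) = x / z \<psi> j"
  proof -
    have "(\<Sum>i\<in>T. e i * (x / z \<psi> i) - 0) = (\<Sum>i\<in>T. if i = j then x / z \<psi> j else 0)"
      by (intro sum.cong refl) (auto simp: e_def)
    then show ?thesis using j by simp
  qed
  ultimately have "((\<lambda>x. Hn_H d L n \<beta> h (\<phi>((j, 1) := x))) has_real_derivative
     (\<Sum>l\<in>T. \<beta> j l * ((x / z \<psi> j) * z \<psi> l - y \<psi> l)) + h * (x / z \<psi> j)) (at x)" by simp
  moreover have "(\<Sum>l\<in>T. \<beta> j l * ((x / z \<psi> j) * z \<psi> l - y \<psi> l)) + h * (x / z \<psi> j) = A \<psi> j / z \<psi> j"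
  proof -
    have "y \<psi> j = x" by (simp add: \<psi>_def)
    moreover have "\<beta> j l * ((x / z \<psi> j) * z \<psi> l - y \<psi> l) = \<beta> j l * (x * z \<psi> l - z \<psi> j * y \<psi> l) / z \<psi> j" for l
      using z_pos[of \<psi> j] by (simp add: field_simps)
    ultimately show ?thesis unfolding A_def by (simp add: sum_divide_distrib add_divide_distrib)
  qed
  ultimately show ?thesis unfolding \<psi>_def by simp
qed

text \<open>The factor \<open>z j\<close> cancels the density \<open>1 / z j\<close> contained in
  \<open>w\<close>, so the derivative meets only \<open>e^(-H)\<close>. This is the infinitesimal
  form of the invariance of \<open>\<mu>\<close> under boosts.\<close>

lemma DERIV_zw:
  assumes j: "j \<in> T"
  shows "((\<lambda>x. z (\<phi>((j, 1) := x)) j * w (\<phi>((j, 1) := x))) has_real_derivative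
     - A (\<phi>((j, 1) := x)) j * w (\<phi>((j, 1) := x))) (at x)"
proof -
  define P where "P = (\<Prod>l\<in>T - {j}. 1 / z \<phi> l)"
  have zl: "z (\<phi>((j, 1) := x)) l = z \<phi> l" if "l \<noteq> j" for x l
    using that unfolding Hn_z_def by simp
  have w: "w (\<phi>((j, 1) := x)) = exp (- Hn_H d L n \<beta> h (\<phi>((j, 1) := x))) * P / z (\<phi>((j, 1) := x)) j" for x
    unfolding Hn_weight_def P_def using j zl by (simp add: prod.remove[of T j])
  have zw: "z (\<phi>((j, 1) := x)) j * w (\<phi>((j, 1) := x)) = exp (- Hn_H d L n \<beta> h (\<phi>((j, 1) := x))) * P" for x
    unfolding w using z_pos[of "\<phi>((j, 1) := x)" j] by simp
  have "((\<lambda>x. exp (- Hn_H d L n \<beta> h (\<phi>((j, 1) := x))) * P) has_real_derivative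
     exp (- Hn_H d L n \<beta> h (\<phi>((j, 1) := x))) * - (A (\<phi>((j, 1) := x)) j / z (\<phi>((j, 1) := x)) j) * P) (at x)"
    by (intro DERIV_cmult_right DERIV_chain2[OF DERIV_exp] DERIV_minus DERIV_H j)
  then show ?thesis unfolding zw unfolding w by (rule DERIV_cong) simp
qed

text \<open>Integration by parts for the infinitesimal Lorentz boost \<open>z\<^sub>j \<partial>/\<partial>y\<^sub>j\<close>, which preserves the
  measure \<open>\<mu>\<close> and maps the Hamiltonian to \<open>A\<^sub>j\<close>.\<close>
lemma boost_by_parts:
  assumes j: "j \<in> T" and F: "poly_bounded F" and F': "poly_bounded F'"
    and deriv: "\<And>\<phi> x. ((\<lambda>x. F (\<phi>((j, 1) := x))) has_real_derivative F' (\<phi>((j, 1) := x))) (at x)"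
    and cont: "\<And>\<phi> x. isCont (\<lambda>x. F' (\<phi>((j, 1) := x))) x"
  shows "E (\<lambda>\<phi>. F \<phi> * A \<phi> j) = E (\<lambda>\<phi>. z \<phi> j * F' \<phi>)"
proof -
  let ?D = "\<lambda>\<phi>. (z \<phi> j * F' \<phi> - F \<phi> * A \<phi> j) * w \<phi>"
  have pb: "poly_bounded (\<lambda>\<phi>. z \<phi> j * F' \<phi>)" "poly_bounded (\<lambda>\<phi>. F \<phi> * A \<phi> j)" "poly_bounded (\<lambda>\<phi>. F \<phi> * z \<phi> j)"
    by (intro poly_bounded_mult poly_bounded_z poly_bounded_A F F' j)+
  have "(\<integral>\<phi>. ?D \<phi> \<partial>M) = 0"
  proof (rule PiM_integral_deriv_eq_0[where G="\<lambda>\<phi>. F \<phi> * z \<phi> j * w \<phi>"])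
    show "(j, 1) \<in> K" using j n by auto
    show "integrable M (\<lambda>\<phi>. F \<phi> * z \<phi> j * w \<phi>)" by (rule poly_bounded_integrable[OF pb(3)])
    show "integrable M ?D" by (rule poly_bounded_integrable[OF poly_bounded_diff[OF pb(1,2)]])
    fix \<phi> :: "site \<times> nat \<Rightarrow> real" and x :: real
    let ?\<psi> = "\<lambda>x. \<phi>((j, 1) := x)"
    have "((\<lambda>x. F (?\<psi> x) * (z (?\<psi> x) j * w (?\<psi> x))) has_real_derivative
        F' (?\<psi> x) * (z (?\<psi> x) j * w (?\<psi> x)) + - A (?\<psi> x) j * w (?\<psi> x) * F (?\<psi> x)) (at x)"
      by (intro DERIV_mult deriv DERIV_zw j)
    then show "((\<lambda>x. F (?\<psi> x) * z (?\<psi> x) j * w (?\<psi> x)) has_real_derivative ?D (?\<psi> x)) (at x)"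
      unfolding mult.assoc[of "F _"] by (rule DERIV_cong) (simp add: algebra_simps)
    have cz: "isCont (\<lambda>x. z (?\<psi> x) l) x" for l by (rule DERIV_isCont[OF DERIV_z])
    have cy: "isCont (\<lambda>x. y (?\<psi> x) l) x" for l by (rule DERIV_isCont[OF DERIV_y])
    have cF: "isCont (\<lambda>x. F (?\<psi> x)) x" by (rule DERIV_isCont[OF deriv])
    \<comment> \<open>Continuity of \<open>w\<close> along the line is read off from that of
      \<open>z * w\<close>, which is already known to be differentiable, by dividing by the positive
      \<open>z\<close>.\<close>
    have "isCont (\<lambda>x. (z (?\<psi> x) j * w (?\<psi> x)) / z (?\<psi> x) j) x"
      by (rule isCont_divide[OF DERIV_isCont[OF DERIV_zw[OF j]] cz]) (metis less_irrefl z_pos)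
    moreover have "(z (?\<psi> x) j * w (?\<psi> x)) / z (?\<psi> x) j = w (?\<psi> x)" for x using z_pos[of "?\<psi> x" j] by simp
    ultimately have cw: "isCont (\<lambda>x. w (?\<psi> x)) x" by simp
    have cA: "isCont (\<lambda>x. A (?\<psi> x) j) x" unfolding A_def by (intro continuous_intros cz cy)
    show "isCont (\<lambda>x. ?D (?\<psi> x)) x" by (intro continuous_intros cz cF cw cA cont)
  qed simp
  then have "E (\<lambda>\<phi>. z \<phi> j * F' \<phi> - F \<phi> * A \<phi> j) = 0" unfolding E_def by simp
  then show ?thesis unfolding E_diff[OF pb(1,2)] by simp
qed

text \<open>Expansion of \<open>0 \<le> E (Y - a * AA)^2\<close>, with \<open>Y\<close> the sum of
  \<open>c j * y j\<close> and \<open>AA\<close> the sum of \<open>c j * A j\<close>. The boost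
  identity evaluates the mixed term as \<open>\<langle>z\<^sub>0\<rangle>\<close> times the sum of
  the squares of \<open>c\<close>, and turns the square of \<open>AA\<close> into the second boost
  derivative of the Hamiltonian.\<close>

lemma quadratic_bound:
  fixes c :: "site \<Rightarrow> real"
  shows "2 * a * E (\<lambda>\<phi>. z \<phi> (torigin d)) * (\<Sum>j\<in>T. (c j)\<^sup>2) \<le> (\<Sum>l\<in>T. \<Sum>j\<in>T. c j * c l * g j l)
     + a\<^sup>2 * ((1 + (real n + 1) * g (torigin d) (torigin d)) * ((1/2) * (\<Sum>l\<in>T. \<Sum>j\<in>T. \<beta> j l * (c j - c l)\<^sup>2))
       + h * E (\<lambda>\<phi>. z \<phi> (torigin d)) * (\<Sum>j\<in>T. (c j)\<^sup>2))"
proof -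
  let ?o = "torigin d"
  define Y where "Y \<phi> = (\<Sum>j\<in>T. c j * y \<phi> j)" for \<phi>
  define AA where "AA \<phi> = (\<Sum>j\<in>T. c j * A \<phi> j)" for \<phi>
  define b where "b = E (\<lambda>\<phi>. z \<phi> ?o)"
  have pY: "poly_bounded Y" unfolding Y_def by (intro poly_bounded_intros)
  have pA: "poly_bounded AA" unfolding AA_def by (intro poly_bounded_intros poly_bounded_A)
  \<comment> \<open>The derivative of \<open>AA\<close> in \<open>y j\<close>, by the product rule
    and \<open>y j / z j\<close> for the derivative of \<open>z j\<close>. The quotients are written
    with \<open>y j\<close> instead of the varied coordinate, which has the same value
    there.\<close>
  define AA' where "AA' j \<phi> = (\<Sum>l\<in>T. \<Sum>m\<in>T. c l * \<beta> l m * ((of_bool (l = j) * z \<phi> m + of_bool (m = j) * (y \<phi> j / z \<phi> m) * y \<phi> l)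
       - (of_bool (l = j) * (y \<phi> j / z \<phi> l) * y \<phi> m + of_bool (m = j) * z \<phi> l))) + h * c j" for j \<phi>
  have zsum: "E (\<lambda>\<phi>. \<Sum>j\<in>T. (c j)\<^sup>2 * z \<phi> j) = b * (\<Sum>j\<in>T. (c j)\<^sup>2)"
  proof -
    have "E (\<lambda>\<phi>. \<Sum>j\<in>T. (c j)\<^sup>2 * z \<phi> j) = (\<Sum>j\<in>T. E (\<lambda>\<phi>. (c j)\<^sup>2 * z \<phi> j))"
      by (intro E_sum poly_bounded_intros)
    moreover have "E (\<lambda>\<phi>. (c j)\<^sup>2 * z \<phi> j) = b * (c j)\<^sup>2" if "j \<in> T" for j
      unfolding E_cmult E_z_inv[OF that] b_def by (rule mult.commute)
    ultimately show ?thesis by (simp add: sum_distrib_left)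
  qed
  have YA: "E (\<lambda>\<phi>. Y \<phi> * AA \<phi>) = b * (\<Sum>j\<in>T. (c j)\<^sup>2)"
  proof -
    have "E (\<lambda>\<phi>. Y \<phi> * A \<phi> j) = E (\<lambda>\<phi>. z \<phi> j * c j)" if j: "j \<in> T" for j
    proof (rule boost_by_parts[OF j pY])
      fix \<phi> :: "site \<times> nat \<Rightarrow> real" and x :: real
      have "((\<lambda>x. Y (\<phi>((j, 1) := x))) has_real_derivative (\<Sum>l\<in>T. c l * of_bool (l = j))) (at x)"
        unfolding Y_def by (intro DERIV_sum DERIV_cmult DERIV_y)
      moreover have "(\<Sum>l\<in>T. c l * of_bool (l = j)) = c j"
        using j by (simp add: of_bool_def if_distrib[of "\<lambda>x. _ * x"] cong: if_cong)
      ultimately show "((\<lambda>x. Y (\<phi>((j, 1) := x))) has_real_derivative c j) (at x)" by simp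
    qed auto
    moreover have "E (\<lambda>\<phi>. Y \<phi> * AA \<phi>) = (\<Sum>j\<in>T. c j * E (\<lambda>\<phi>. Y \<phi> * A \<phi> j))"
    proof -
      have "E (\<lambda>\<phi>. Y \<phi> * AA \<phi>) = E (\<lambda>\<phi>. \<Sum>j\<in>T. c j * (Y \<phi> * A \<phi> j))"
        unfolding AA_def by (simp add: sum_distrib_left mult_ac)
      also have "\<dots> = (\<Sum>j\<in>T. E (\<lambda>\<phi>. c j * (Y \<phi> * A \<phi> j)))"
        by (intro E_sum poly_bounded_intros pY poly_bounded_A)
      finally show ?thesis by (simp add: E_cmult)
    qed
    ultimately have "E (\<lambda>\<phi>. Y \<phi> * AA \<phi>) = (\<Sum>j\<in>T. c j * (c j * b))"
      using E_z_inv by (simp add: mult.commute[of "z _ _"] E_cmult b_def)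
    then show ?thesis by (simp add: sum_distrib_left power2_eq_square mult_ac)
  qed
  \<comment> \<open>The sum of \<open>c j * z j * AA' j\<close> after simplification. Only
    differences \<open>c m - c l\<close> occur in the interaction part: a global boost leaves the
    interaction invariant.\<close>
  define R where "R \<phi> = (\<Sum>l\<in>T. \<Sum>m\<in>T. (1/2) * \<beta> m l * (c m - c l)\<^sup>2 * (z \<phi> m * z \<phi> l - y \<phi> m * y \<phi> l)) + h * (\<Sum>j\<in>T. (c j)\<^sup>2 * z \<phi> j)" for \<phi>
  have pA': "poly_bounded (\<lambda>\<phi>. z \<phi> j * AA' j \<phi>)" "poly_bounded (AA' j)" if "j \<in> T" for j
  proof -
    have q: "poly_bounded (\<lambda>\<phi>. y \<phi> j / z \<phi> m)" if "m \<in> T" for m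
      unfolding poly_bounded_def
    proof (intro conjI exI[of _ 1] exI[of _ "1::nat"] allI)
      show "(\<lambda>\<phi>. y \<phi> j / z \<phi> m) \<in> borel_measurable M"
        using measurable_y[OF \<open>j \<in> T\<close>] measurable_z[OF that] by (intro borel_measurable_divide)
      fix \<phi> :: "site \<times> nat \<Rightarrow> real"
      have "\<bar>y \<phi> j / z \<phi> m\<bar> \<le> \<bar>y \<phi> j\<bar>" using z_ge_1[of \<phi> m] by (simp add: abs_div divide_le_eq mult_left_le)
        (metis abs_ge_zero mult_left_le_one_le mult.commute mult_le_cancel_left1 not_less order_trans)
      also have "\<dots> \<le> S \<phi>" using coord_le_z(2)[of 1 \<phi> j] n z_le_S[OF \<open>j \<in> T\<close>, of \<phi>] by simp
      finally show "\<bar>y \<phi> j / z \<phi> m\<bar> \<le> 1 * S \<phi> ^ 1" by simp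
    qed simp
    show "poly_bounded (AA' j)" unfolding AA'_def[abs_def] by (intro poly_bounded_intros q)
    then show "poly_bounded (\<lambda>\<phi>. z \<phi> j * AA' j \<phi>)" by (intro poly_bounded_mult poly_bounded_z that)
  qed
  have AAA: "E (\<lambda>\<phi>. AA \<phi> * AA \<phi>) = E R"
  proof -
    have "E (\<lambda>\<phi>. AA \<phi> * A \<phi> j) = E (\<lambda>\<phi>. z \<phi> j * AA' j \<phi>)" if j: "j \<in> T" for j
    proof (rule boost_by_parts[OF j pA pA'(2)[OF j]])
      fix \<phi> :: "site \<times> nat \<Rightarrow> real" and x :: real
      let ?\<psi> = "\<phi>((j, 1) := x)"
      have "((\<lambda>x. AA (\<phi>((j, 1) := x))) has_real_derivative
         (\<Sum>l\<in>T. c l * ((\<Sum>m\<in>T. \<beta> l m * ((of_bool (l = j) * z ?\<psi> m + of_bool (m = j) * (x / z ?\<psi> m) * y ?\<psi> l)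
           - (of_bool (l = j) * (x / z ?\<psi> l) * y ?\<psi> m + of_bool (m = j) * z ?\<psi> l))) + h * of_bool (l = j)))) (at x)"
        unfolding AA_def A_def
        by (intro DERIV_sum DERIV_cmult DERIV_add DERIV_diff DERIV_mult DERIV_y DERIV_z)
      moreover have "(\<Sum>l\<in>T. c l * ((\<Sum>m\<in>T. \<beta> l m * ((of_bool (l = j) * z ?\<psi> m + of_bool (m = j) * (x / z ?\<psi> m) * y ?\<psi> l)
           - (of_bool (l = j) * (x / z ?\<psi> l) * y ?\<psi> m + of_bool (m = j) * z ?\<psi> l))) + h * of_bool (l = j))) = AA' j ?\<psi>"
      proof -
        have "(\<Sum>l\<in>T. h * (c l * of_bool (l = j))) = h * c j"
          using j by (simp add: of_bool_def if_distrib[of "\<lambda>x. _ * x"] cong: if_cong)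
        moreover have "y ?\<psi> j = x" by simp
        ultimately show ?thesis unfolding AA'_def
          by (simp add: distrib_left sum.distrib sum_distrib_left mult.assoc mult.left_commute[of _ h])
      qed
      ultimately show "((\<lambda>x. AA (\<phi>((j, 1) := x))) has_real_derivative AA' j ?\<psi>) (at x)" by simp
      show "isCont (\<lambda>x. AA' j (\<phi>((j, 1) := x))) x"
        unfolding AA'_def using z_pos
        by (intro continuous_intros DERIV_isCont[OF DERIV_z] DERIV_isCont[OF DERIV_y]) (metis less_irrefl)+
    qed
    moreover have "E (\<lambda>\<phi>. AA \<phi> * AA \<phi>) = (\<Sum>j\<in>T. c j * E (\<lambda>\<phi>. AA \<phi> * A \<phi> j))"
    proof -
      have "E (\<lambda>\<phi>. AA \<phi> * AA \<phi>) = E (\<lambda>\<phi>. \<Sum>j\<in>T. c j * (AA \<phi> * A \<phi> j))"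
        unfolding AA_def[of _, THEN arg_cong, of "\<lambda>v. _ * v"] by (simp add: sum_distrib_left mult_ac)
      also have "\<dots> = (\<Sum>j\<in>T. E (\<lambda>\<phi>. c j * (AA \<phi> * A \<phi> j)))"
        by (intro E_sum poly_bounded_intros pA poly_bounded_A)
      finally show ?thesis by (simp add: E_cmult)
    qed
    ultimately have "E (\<lambda>\<phi>. AA \<phi> * AA \<phi>) = (\<Sum>j\<in>T. E (\<lambda>\<phi>. c j * (z \<phi> j * AA' j \<phi>)))"
      by (simp add: E_cmult)
    also have "\<dots> = E (\<lambda>\<phi>. \<Sum>j\<in>T. c j * (z \<phi> j * AA' j \<phi>))"
      by (intro E_sum[symmetric] poly_bounded_mult[OF poly_bounded_const] pA')
    also have "(\<lambda>\<phi>. \<Sum>j\<in>T. c j * (z \<phi> j * AA' j \<phi>)) = R"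
    proof
      fix \<phi> :: "site \<times> nat \<Rightarrow> real"
      have dl: "(\<Sum>j\<in>T. of_bool (l = j) * f j) = f l" if "l \<in> T" for l and f :: "site \<Rightarrow> real"
        using that by (simp add: of_bool_def if_distrib[of "\<lambda>x. x * _"] cong: if_cong)
      \<comment> \<open>\<open>?u j l m\<close> is the \<open>(l, m)\<close> term of
        \<open>c j * z j * AA' j\<close>. Summing over \<open>j\<close> first evaluates the
        indicators, and each quotient \<open>y / z\<close> is then multiplied by the matching
        \<open>z\<close>, which yields \<open>?t l m\<close>.\<close>
      let ?u = "\<lambda>j l m. c l * \<beta> l m *
          ((of_bool (l = j) * (c j * z \<phi> j * z \<phi> m) + of_bool (m = j) * (c j * z \<phi> j * (y \<phi> j / z \<phi> m) * y \<phi> l))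
           - (of_bool (l = j) * (c j * z \<phi> j * (y \<phi> j / z \<phi> l) * y \<phi> m) + of_bool (m = j) * (c j * z \<phi> j * z \<phi> l)))"
      let ?t = "\<lambda>l m. c l * \<beta> l m * ((c l * z \<phi> l * z \<phi> m + c m * y \<phi> m * y \<phi> l) - (c l * y \<phi> l * y \<phi> m + c m * z \<phi> m * z \<phi> l))"
      have "(\<Sum>j\<in>T. c j * (z \<phi> j * AA' j \<phi>)) = (\<Sum>j\<in>T. (\<Sum>l\<in>T. \<Sum>m\<in>T. ?u j l m) + h * ((c j)\<^sup>2 * z \<phi> j))"
        unfolding AA'_def distrib_left sum_distrib_left
        by (intro sum.cong refl arg_cong2[where f="(+)"]) (simp_all add: algebra_simps power2_eq_square)
      also have "\<dots> = (\<Sum>j\<in>T. \<Sum>l\<in>T. \<Sum>m\<in>T. ?u j l m) + h * (\<Sum>j\<in>T. (c j)\<^sup>2 * z \<phi> j)"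
        by (simp add: sum.distrib sum_distrib_left)
      also have "(\<Sum>j\<in>T. \<Sum>l\<in>T. \<Sum>m\<in>T. ?u j l m)
         = (\<Sum>l\<in>T. \<Sum>m\<in>T. \<Sum>j\<in>T. ?u j l m)"
        by (subst sum.swap) (intro sum.cong refl sum.swap)
      also have "\<dots> = (\<Sum>l\<in>T. \<Sum>m\<in>T. ?t l m)"
      proof (intro sum.cong refl)
        fix l m assume lm: "l \<in> T" "m \<in> T"
        show "(\<Sum>j\<in>T. ?u j l m) = ?t l m"
          unfolding sum_distrib_left[symmetric] sum_subtractf sum.distrib dl[OF lm(1)] dl[OF lm(2)]
          using z_pos[of \<phi> l] z_pos[of \<phi> m] by simp
      qed
      also have "\<dots> = (\<Sum>l\<in>T. \<Sum>m\<in>T. (1/2) * \<beta> m l * (c m - c l)\<^sup>2 * (z \<phi> m * z \<phi> l - y \<phi> m * y \<phi> l))"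
      proof -
        \<comment> \<open>\<open>?t l m\<close> equals
          \<open>\<beta> l m * c l * (c l - c m) * (z l * z m - y l * y m)\<close>. Averaging over
          the exchange of \<open>l\<close> and \<open>m\<close> replaces
          \<open>c l * (c l - c m)\<close> by half of the squared difference.\<close>
        have "(\<Sum>l\<in>T. \<Sum>m\<in>T. ?t l m) = (1/2) * ((\<Sum>l\<in>T. \<Sum>m\<in>T. ?t l m) + (\<Sum>l\<in>T. \<Sum>m\<in>T. ?t m l))"
          using sum.swap[of ?t T T] by simp
        also have "\<dots> = (\<Sum>l\<in>T. \<Sum>m\<in>T. (1/2) * (?t l m + ?t m l))"
          by (simp only: sum.distrib[symmetric] sum_distrib_left)
        also have "\<dots> = (\<Sum>l\<in>T. \<Sum>m\<in>T. (1/2) * \<beta> m l * (c m - c l)\<^sup>2 * (z \<phi> m * z \<phi> l - y \<phi> m * y \<phi> l))"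
        proof (intro sum.cong refl)
          fix l m assume lm: "l \<in> T" "m \<in> T"
          show "(1/2) * (?t l m + ?t m l) = (1/2) * \<beta> m l * (c m - c l)\<^sup>2 * (z \<phi> m * z \<phi> l - y \<phi> m * y \<phi> l)"
            unfolding \<beta>_sym[OF lm] by (simp add: power2_eq_square algebra_simps)
        qed
        finally show ?thesis .
      qed
      finally show "(\<Sum>j\<in>T. c j * (z \<phi> j * AA' j \<phi>)) = R \<phi>" unfolding R_def .
    qed
    finally show ?thesis .
  qed
  have zy: "E (\<lambda>\<phi>. z \<phi> m * z \<phi> l - y \<phi> m * y \<phi> l) \<le> 1 + (real n + 1) * g ?o ?o" if ml: "m \<in> T" "l \<in> T" for m l
  proof -
    have "E (\<lambda>\<phi>. z \<phi> m * z \<phi> l - y \<phi> m * y \<phi> l) \<le> E (\<lambda>\<phi>. (1/2) * (((z \<phi> m)\<^sup>2 + (z \<phi> l)\<^sup>2) + (y \<phi> m * y \<phi> m + y \<phi> l * y \<phi> l)))"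
    proof (rule E_mono)
      fix \<phi> :: "site \<times> nat \<Rightarrow> real"
      \<comment> \<open>The sum \<open>y m + y l\<close> is squared, not the difference, because the
        product of the \<open>y\<close> enters with a minus sign. The mean of the resulting bound is
        \<open>1 + n * G(0)\<close> from the \<open>z\<close> terms plus \<open>G(0)\<close> from
        the \<open>y\<close> terms.\<close>
      have "0 \<le> (z \<phi> m - z \<phi> l)\<^sup>2 + (y \<phi> m + y \<phi> l)\<^sup>2" by simp
      then show "z \<phi> m * z \<phi> l - y \<phi> m * y \<phi> l \<le> (1/2) * (((z \<phi> m)\<^sup>2 + (z \<phi> l)\<^sup>2) + (y \<phi> m * y \<phi> m + y \<phi> l * y \<phi> l))"
        by (simp add: power2_eq_square algebra_simps)
    qed (intro poly_bounded_intros ml)+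
    also have "\<dots> = (1/2) * ((E (\<lambda>\<phi>. (z \<phi> m)\<^sup>2) + E (\<lambda>\<phi>. (z \<phi> l)\<^sup>2)) + (g m m + g l l))"
      unfolding g_def E_cmult by (subst E_add, (intro poly_bounded_intros ml)+)+ simp
    also have "\<dots> = 1 + (real n + 1) * g ?o ?o"
      unfolding E_z_sq[OF ml(1)] E_z_sq[OF ml(2)] g_diag[OF ml(1)] g_diag[OF ml(2)] by (simp add: algebra_simps)
    finally show ?thesis .
  qed
  have "E R = (\<Sum>l\<in>T. \<Sum>m\<in>T. (1/2) * \<beta> m l * (c m - c l)\<^sup>2 * E (\<lambda>\<phi>. z \<phi> m * z \<phi> l - y \<phi> m * y \<phi> l)) + h * (b * (\<Sum>j\<in>T. (c j)\<^sup>2))"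
  proof -
    have p: "poly_bounded (\<lambda>\<phi>. (1/2) * \<beta> m l * (c m - c l)\<^sup>2 * (z \<phi> m * z \<phi> l - y \<phi> m * y \<phi> l))" if "l \<in> T" "m \<in> T" for l m
      by (intro poly_bounded_intros that)
    have "E R = E (\<lambda>\<phi>. \<Sum>l\<in>T. \<Sum>m\<in>T. (1/2) * \<beta> m l * (c m - c l)\<^sup>2 * (z \<phi> m * z \<phi> l - y \<phi> m * y \<phi> l)) + E (\<lambda>\<phi>. h * (\<Sum>j\<in>T. (c j)\<^sup>2 * z \<phi> j))"
      unfolding R_def by (intro E_add poly_bounded_sum p poly_bounded_intros)
    also have "E (\<lambda>\<phi>. \<Sum>l\<in>T. \<Sum>m\<in>T. (1/2) * \<beta> m l * (c m - c l)\<^sup>2 * (z \<phi> m * z \<phi> l - y \<phi> m * y \<phi> l))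
       = (\<Sum>l\<in>T. E (\<lambda>\<phi>. \<Sum>m\<in>T. (1/2) * \<beta> m l * (c m - c l)\<^sup>2 * (z \<phi> m * z \<phi> l - y \<phi> m * y \<phi> l)))"
      by (intro E_sum poly_bounded_sum p)
    also have "\<dots> = (\<Sum>l\<in>T. \<Sum>m\<in>T. E (\<lambda>\<phi>. (1/2) * \<beta> m l * (c m - c l)\<^sup>2 * (z \<phi> m * z \<phi> l - y \<phi> m * y \<phi> l)))"
      by (intro sum.cong refl E_sum p)
    finally show ?thesis unfolding E_cmult zsum .
  qed
  also have "\<dots> \<le> (\<Sum>l\<in>T. \<Sum>m\<in>T. (1/2) * \<beta> m l * (c m - c l)\<^sup>2 * (1 + (real n + 1) * g ?o ?o)) + h * (b * (\<Sum>j\<in>T. (c j)\<^sup>2))"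
    using \<beta>_nonneg by (intro add_mono sum_mono mult_left_mono zy order_refl mult_nonneg_nonneg) auto
  also have "(\<Sum>l\<in>T. \<Sum>m\<in>T. (1/2) * \<beta> m l * (c m - c l)\<^sup>2 * (1 + (real n + 1) * g ?o ?o)) = (1 + (real n + 1) * g ?o ?o) * ((1/2) * (\<Sum>l\<in>T. \<Sum>m\<in>T. \<beta> m l * (c m - c l)\<^sup>2))"
    unfolding sum_distrib_left by (intro sum.cong refl) (simp only: mult_ac)
  finally have ER: "E R \<le> (1 + (real n + 1) * g ?o ?o) * ((1/2) * (\<Sum>l\<in>T. \<Sum>m\<in>T. \<beta> m l * (c m - c l)\<^sup>2)) + h * b * (\<Sum>j\<in>T. (c j)\<^sup>2)"
    by (simp only: mult.assoc)
  have YY: "E (\<lambda>\<phi>. Y \<phi> * Y \<phi>) = (\<Sum>l\<in>T. \<Sum>j\<in>T. c j * c l * g j l)"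
  proof -
    have "Y \<phi> * Y \<phi> = (\<Sum>l\<in>T. \<Sum>j\<in>T. c j * c l * (y \<phi> j * y \<phi> l))" for \<phi>
      unfolding Y_def sum_product by (intro sum.cong refl) (simp only: mult_ac)
    then have "E (\<lambda>\<phi>. Y \<phi> * Y \<phi>) = E (\<lambda>\<phi>. \<Sum>l\<in>T. \<Sum>j\<in>T. c j * c l * (y \<phi> j * y \<phi> l))" by simp
    also have "\<dots> = (\<Sum>l\<in>T. E (\<lambda>\<phi>. \<Sum>j\<in>T. c j * c l * (y \<phi> j * y \<phi> l)))"
      by (intro E_sum poly_bounded_intros)
    also have "\<dots> = (\<Sum>l\<in>T. \<Sum>j\<in>T. E (\<lambda>\<phi>. c j * c l * (y \<phi> j * y \<phi> l)))"
      by (intro sum.cong refl E_sum poly_bounded_intros)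
    finally show ?thesis unfolding E_cmult g_def .
  qed
  have "0 \<le> E (\<lambda>\<phi>. (Y \<phi> - a * AA \<phi>) * (Y \<phi> - a * AA \<phi>))"
  proof -
    have "poly_bounded (\<lambda>\<phi>. (Y \<phi> - a * AA \<phi>) * (Y \<phi> - a * AA \<phi>))"
      by (intro poly_bounded_mult poly_bounded_diff poly_bounded_const pY pA)
    from E_mono[OF poly_bounded_const[of 0] this] show ?thesis by (simp add: E_const)
  qed
  also have "(\<lambda>\<phi>. (Y \<phi> - a * AA \<phi>) * (Y \<phi> - a * AA \<phi>)) = (\<lambda>\<phi>. (Y \<phi> * Y \<phi> - (2 * a) * (Y \<phi> * AA \<phi>)) + a\<^sup>2 * (AA \<phi> * AA \<phi>))"
    by (rule ext) (simp add: power2_eq_square algebra_simps)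
  also have "E \<dots> = E (\<lambda>\<phi>. Y \<phi> * Y \<phi> - (2 * a) * (Y \<phi> * AA \<phi>)) + E (\<lambda>\<phi>. a\<^sup>2 * (AA \<phi> * AA \<phi>))"
    by (intro E_add poly_bounded_mult poly_bounded_diff poly_bounded_const pY pA)
  also have "E (\<lambda>\<phi>. Y \<phi> * Y \<phi> - (2 * a) * (Y \<phi> * AA \<phi>)) = E (\<lambda>\<phi>. Y \<phi> * Y \<phi>) - E (\<lambda>\<phi>. (2 * a) * (Y \<phi> * AA \<phi>))"
    by (intro E_diff poly_bounded_mult poly_bounded_const pY pA)
  finally have "0 \<le> (\<Sum>l\<in>T. \<Sum>j\<in>T. c j * c l * g j l) - 2 * a * (b * (\<Sum>j\<in>T. (c j)\<^sup>2)) + a\<^sup>2 * E R"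
    unfolding E_cmult YY YA AAA .
  moreover have "a\<^sup>2 * E R \<le> a\<^sup>2 * ((1 + (real n + 1) * g ?o ?o) * ((1/2) * (\<Sum>l\<in>T. \<Sum>m\<in>T. \<beta> m l * (c m - c l)\<^sup>2)) + h * b * (\<Sum>j\<in>T. (c j)\<^sup>2))"
    by (intro mult_left_mono ER) simp
  ultimately show ?thesis unfolding b_def[symmetric] mult.assoc[of "2 * a"] by linarith
qed

text \<open>Here \<open>b = \<langle>z\<^sub>0\<rangle>\<close>, which is at least 1 because
  \<open>z\<close> is; its exact value does not enter the result.\<close>

lemma Hn_infrared:
  "Im (fourier d L (Hn_G d L n \<beta> h) k) = 0 \<and>
   Re (fourier d L (Hn_G d L n \<beta> h) k) \<ge> 1 / ((1 + (real n + 1) * Hn_G d L n \<beta> h (torigin d)) * lam d L \<beta> k + h)"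
proof -
  let ?o = "torigin d"
  have o: "?o \<in> T" by (rule torigin_in_torus[OF L])
  have G: "Hn_G d L n \<beta> h = g ?o"
    unfolding Hn_G_def E_eq g_def ..
  show ?thesis unfolding G
  proof (rule infrared_bound[where g=g, OF L _ g_inv \<beta> \<beta>_inv h _ _ quadratic_bound])
    show "g i j = g j i" for i j unfolding g_def by (simp add: mult.commute)
    show "1 \<le> E (\<lambda>\<phi>. z \<phi> ?o)"
      using E_mono[OF poly_bounded_const[of 1] poly_bounded_z[OF o] z_ge_1] by (simp add: E_const)
    have "0 \<le> g ?o ?o"
      unfolding g_def using E_mono[OF poly_bounded_const[of 0] poly_bounded_mult[OF poly_bounded_y poly_bounded_y], OF o o] by (simp add: E_const)
    then show "0 \<le> 1 + (real n + 1) * g ?o ?o" by simp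
  qed
qed

end

theorem theorem1p3:
  fixes d L :: nat and \<beta> :: "site \<Rightarrow> site \<Rightarrow> real" and h :: real
  assumes "d \<ge> 1" and "L \<ge> 1"
    and "\<forall>i\<in>torus d L. \<forall>j\<in>torus d L. \<beta> i j = \<beta> j i \<and> \<beta> i j \<ge> 0"
    and "translation_invariant d L \<beta>"
    and "h > 0"
  shows "(\<forall>n::nat. n \<ge> 2 \<longrightarrow> (\<forall>k\<in>torus d L.
            Im (fourier d L (Hn_G d L n \<beta> h) k) = 0 \<and>
            Re (fourier d L (Hn_G d L n \<beta> h) k) \<ge>
              1 / ((1 + (real n + 1) * Hn_G d L n \<beta> h (torigin d)) * lam d L \<beta> k + h)))
       \<and> (\<forall>k\<in>torus d L.
            Im (fourier d L (S22_G d L \<beta> h) k) = 0 \<and>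
            Re (fourier d L (S22_G d L \<beta> h) k) \<ge>
              1 / ((1 + S22_G d L \<beta> h (torigin d)) * lam d L \<beta> k + h))"
proof (rule conjI; intro allI impI ballI)
  fix n :: nat and k assume "n \<ge> 2"
  then interpret hyperbolic_model d L n \<beta> h
    using assms by unfold_locales auto
  show "Im (fourier d L (Hn_G d L n \<beta> h) k) = 0 \<and>
     Re (fourier d L (Hn_G d L n \<beta> h) k) \<ge> 1 / ((1 + (real n + 1) * Hn_G d L n \<beta> h (torigin d)) * lam d L \<beta> k + h)"
    by (rule Hn_infrared)
next
  fix k
  show "Im (fourier d L (S22_G d L \<beta> h) k) = 0 \<and>
     Re (fourier d L (S22_G d L \<beta> h) k) \<ge> 1 / ((1 + S22_G d L \<beta> h (torigin d)) * lam d L \<beta> k + h)"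
    by (rule S22_infrared[OF assms(2-5)])
qed

end
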